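(* In the setting of the context, consider the two-phase Riemann problem with phase transition. It is solvable by a (b)-type solution if and only if $$f_z(\tilde p,\mathbf W_V,\mathbf W_L)\ge0$$ and the following condition holds: if the root $p^\ast\in(0,\tilde p]$ of $f_z(\cdot,\mathbf W_V,\mathbf W_L)$ satisfies $p^\ast>p_V$, then $z(p^\ast)>-\frac{a_V(\bar p)}{v_V(\bar p)}$, where $\bar p\in(p_V,p^\ast)$ is the pressure with $\frac{a_V(\bar p)^2}{v_V(\bar p)^2}=-\frac{p^\ast-p_V}{v_V(p^\ast)-v_V(p_V)}$.
   Context: Thermodynamics. Two phases (vapor $V$, liquid $L$) of one substance at a fixed temperature. For $K\in\{V,L\}$, $v_K(p)>0$ is the specific volume as a (at least $C^2$) function of the pressure $p$, with $p\in(0,\infty)$ for $K=V$ and $p\in[p_{min},\infty)$ for $K=L$, where $p_{min}\le 0$ is the minimum liquid pressure; $\rho=1/v$ is the density. The sound speed $a_K(p)>0$ is defined by $v_K'=-v_K^2/a_K^2$; the Gibbs energy satisfies $g_K'=v_K$; the saturation pressure $p_0>0$ satisfies $g_L(p_0)=g_V(p_0)$. $\gamma_K=\frac{a_K^2}{p v_K}$, $\mathcal G_K=1+\frac{a_K}{v_K}a_K'$, and $\mathcal G_K>0$ is assumed. $v_K(p)\to0$ as $p\to\infty$, and $v_V(p)\to\infty$ as $p\to0^+$. $\tau>0$ is a constant. There are constants $\alpha\in(0,1)$, $\beta>0$ such that, with $\sigma_{max}=\frac{1+\sqrt{11-6\alpha}}2$, uniformly for $p_V\in(0,\sigma_{max}p_0]$,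 $p_L\in[p_{min},\infty)$: $0<\frac{v_L(p_L)}{v_V(p_V)}\le\alpha$, $0<\frac{v_L(p_L)a_V(p_V)}{v_V(p_V)a_L(p_L)}\le\alpha\beta<1$, $\tau(1-\alpha)^2a_V(p_V)^3<\gamma_V(p_V)$. With $\varepsilon(\gamma_V)=\frac1{\gamma_V}-1-\frac{\tau a_V^3}{\gamma_V^2}(1-\alpha)^2(1-(\alpha\beta)^2)$, one of the following holds (for these $p_V$ and all $p_L>0$): (I) $\gamma_V\le1\le\gamma_L$ and $\frac1{\gamma_L}\ge1+\frac{\varepsilon(\gamma_V)}\alpha$; or (II) $\gamma_V<1$, $\gamma_L<1$, $\alpha\le\frac{1-1/\gamma_V}{1-1/\gamma_L}$ and $\varepsilon(\gamma_V)\le0$. Interface. $h(p_V,p_L)=\tau\bigl[g_L(p_L)-g_V(p_V)-\frac12(p_L-p_V)(v_L(p_L)+v_V(p_V))\bigr]$. For $p\in(0,\sigma_{max}p_0]$, $\varphi(p)$ denotes the unique liquid pressure $q$ with $q-p+(p\,h(p,q))^2(v_L(q)-v_V(p))=0$ and $-\frac{a_V(p)}{v_V(p)}\le p\,h(p,q)\le\frac{a_L(q)}{v_L(q)}$; $z(p)=p\,h(p,\varphi(p))$. Maximum vapor pressure $\tilde p$ (assumed $\le\sigma_{max}p_0$): let $\bar v$ be a function with $\bar v'>0$, $\bar v(p_{min})=v_L(p_{min})$, $\bar v(\tilde p)=v_V(\tilde p)$, and inverse $\bar p(\cdot)$; let $p(v)$ be the inverse of $v_L$ for $v\le v_L(p_{min})$,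 $\bar p(v)$ for $v_L(p_{min})<v<v_V(\tilde p)$, and the inverse of $v_V$ for $v\ge v_V(\tilde p)$. Then $\tilde p$ solves $0=p_0(v_V(p_0)-v_L(p_0))-\int_{v_L(p_0)}^{v_V(p_0)}p(v)\,\mathrm dv$. Riemann problem. Isothermal Euler equations $\partial_t\rho+\partial_x(\rho u)=0$, $\partial_t(\rho u)+\partial_x(\rho u^2+p)=0$, with initial data: vapor state $\mathbf W_V=(\rho_V,u_V)$, of pressure $p_V\in(0,\tilde p]$, for $x<0$, and liquid state $\mathbf W_L=(\rho_L,u_L)$, of pressure $p_L\ge p_{min}$, for $x>0$. Across a discontinuity of speed $W$, with $[\![\Psi]\!]=\Psi^+-\Psi^-$ (right minus left) and $Z=-\rho(u-W)$: $[\![Z]\!]=0$, $-Z[\![u]\!]+[\![p]\!]=0$, and $Z[\![g+\tfrac12u^2]\!]\ge0$. A solution is self-similar and consists of four constant states separated by two classical waves (shocks or rarefaction waves inside one phase) and one phase boundary, with vapor pressures in $(0,\tilde p]$. ``With phase transition'' means that at the phase boundary (vapor on the left) the mass flux $z$ satisfies the kinetic relation $z=\tau p_V^\ast\,[\![g+\frac12u^2]\!]$ and $-a_V/v_V\le z\le a_L/v_L$, where $p_V^\ast$ is the vapor pressure at the phase boundary. A solution is of type (b) if the phase boundary lies between the two classical waves (one in the vapor on the left, one in the liquid on the right). The function $f_z$. For $K\in\{V,L\}$ let $f_K(q,\mathbf W_K)=\sqrt{-(q-p_K)(v_K(q)-v_K(p_K))}$ if $q>p_K$ and $f_K(q,\mathbf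 W_K)=\int_{p_K}^q\frac{v_K(\zeta)}{a_K(\zeta)}\,\mathrm d\zeta$ if $q\le p_K$, and $$f_z(p,\mathbf W_V,\mathbf W_L)=f_V(p,\mathbf W_V)+f_L(\varphi(p),\mathbf W_L)+z(p)\bigl(v_L(\varphi(p))-v_V(p)\bigr)+u_L-u_V.$$
   Formalization: In the entropy inequality and the kinetic relation, the velocity u in [[g+½u²]] is taken relative to the discontinuity, i.e. [[g+½(u−W)²]]; with the laboratory velocity the relations are not Galilean invariant, contradict z=p·h(p,φ(p)), and the equivalence fails. *)

theory Defs
  imports "HOL-Analysis.Analysis"
begin

section \<open>Thermodynamics\<close>

text \<open>A phase is given by its pressure range and, as functions of the pressure, its specific
  volume, sound speed and Gibbs energy.\<close>

record phase =
  prange :: "real set"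
  vol :: "real \<Rightarrow> real"
  cs :: "real \<Rightarrow> real"
  gib :: "real \<Rightarrow> real"

record two_phase =
  Vap :: phase
  Liq :: phase
  pmin :: real               \<comment> \<open>minimum liquid pressure\<close>
  psat :: real               \<comment> \<open>saturation pressure\<close>
  tau :: real
  alpha :: real
  beta :: real
  vbar :: "real \<Rightarrow> real"     \<comment> \<open>interpolates the two isotherms between \<open>pmin\<close> and \<open>pmax\<close>\<close>
  pmax :: real               \<comment> \<open>maximum vapor pressure\<close>

definition density :: "phase \<Rightarrow> real \<Rightarrow> real" where
  "density K p = 1 / vol K p"

text \<open>Derivatives are taken within the pressure range, hence one-sided at the left end point
  of the liquid range.\<close>

definition C2_on :: "(real \<Rightarrow> real) \<Rightarrow> real set \<Rightarrow> bool" where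
  "C2_on f S \<longleftrightarrow> (\<exists>f' f''.
     (\<forall>x\<in>S. (f has_real_derivative f' x) (at x within S)) \<and>
     (\<forall>x\<in>S. (f' has_real_derivative f'' x) (at x within S)) \<and>
     continuous_on S f'')"

definition gamma :: "phase \<Rightarrow> real \<Rightarrow> real" where
  "gamma K p = (cs K p)\<^sup>2 / (p * vol K p)"

definition GG :: "phase \<Rightarrow> real \<Rightarrow> real" where
  "GG K p = 1 + cs K p / vol K p * vector_derivative (cs K) (at p within prange K)"

locale admissible_phase =
  fixes K :: phase
  assumes vol_pos: "p \<in> prange K \<Longrightarrow> vol K p > 0"
    and vol_C2: "C2_on (vol K) (prange K)"
    and cs_pos: "p \<in> prange K \<Longrightarrow> cs K p > 0"
    and vol_deriv: "p \<in> prange K \<Longrightarrow>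
      (vol K has_real_derivative - (vol K p)\<^sup>2 / (cs K p)\<^sup>2) (at p within prange K)"
    and gib_deriv: "p \<in> prange K \<Longrightarrow>
      (gib K has_real_derivative vol K p) (at p within prange K)"
    and GG_pos: "p \<in> prange K \<Longrightarrow> GG K p > 0"
    and vol_at_top: "(vol K \<longlongrightarrow> 0) at_top"

definition sigma_max :: "two_phase \<Rightarrow> real" where
  "sigma_max M = (1 + sqrt (11 - 6 * alpha M)) / 2"

definition eps :: "two_phase \<Rightarrow> real \<Rightarrow> real" where
  "eps M p = 1 / gamma (Vap M) p - 1
     - tau M * cs (Vap M) p ^ 3 / (gamma (Vap M) p)\<^sup>2
       * (1 - alpha M)\<^sup>2 * (1 - (alpha M * beta M)\<^sup>2)"

definition cond_I :: "two_phase \<Rightarrow> real \<Rightarrow> real \<Rightarrow> bool" where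
  "cond_I M p q \<longleftrightarrow> gamma (Vap M) p \<le> 1 \<and> 1 \<le> gamma (Liq M) q
     \<and> 1 / gamma (Liq M) q \<ge> 1 + eps M p / alpha M"

definition cond_II :: "two_phase \<Rightarrow> real \<Rightarrow> real \<Rightarrow> bool" where
  "cond_II M p q \<longleftrightarrow> gamma (Vap M) p < 1 \<and> gamma (Liq M) q < 1
     \<and> alpha M \<le> (1 - 1 / gamma (Vap M) p) / (1 - 1 / gamma (Liq M) q)
     \<and> eps M p \<le> 0"


section \<open>The phase boundary\<close>

definition h :: "two_phase \<Rightarrow> real \<Rightarrow> real \<Rightarrow> real" where
  "h M p q = tau M * (gib (Liq M) q - gib (Vap M) p
     - (q - p) * (vol (Liq M) q + vol (Vap M) p) / 2)"

definition interface_pressure :: "two_phase \<Rightarrow> real \<Rightarrow> real \<Rightarrow> bool" where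
  "interface_pressure M p q \<longleftrightarrow> q \<in> prange (Liq M)
     \<and> q - p + (p * h M p q)\<^sup>2 * (vol (Liq M) q - vol (Vap M) p) = 0
     \<and> - (cs (Vap M) p / vol (Vap M) p) \<le> p * h M p q
     \<and> p * h M p q \<le> cs (Liq M) q / vol (Liq M) q"

definition phi :: "two_phase \<Rightarrow> real \<Rightarrow> real" where
  "phi M p = (THE q. interface_pressure M p q)"

definition zflux :: "two_phase \<Rightarrow> real \<Rightarrow> real" where
  "zflux M p = p * h M p (phi M p)"

text \<open>The pressure as a function of the specific volume, along the liquid isotherm, the
  increasing interpolation, and the vapor isotherm.\<close>

definition p_of_v :: "two_phase \<Rightarrow> real \<Rightarrow> real" where
  "p_of_v M v =
    (if v \<le> vol (Liq M) (pmin M) then inv_into (prange (Liq M)) (vol (Liq M)) v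
     else if v < vol (Vap M) (pmax M) then inv_into {pmin M..pmax M} (vbar M) v
     else inv_into (prange (Vap M)) (vol (Vap M)) v)"

text \<open>One of \<open>cond_I\<close>, \<open>cond_II\<close> is required for each pair of pressures; which one may depend
  on the pair. (\<open>cond_II\<close> cannot hold for all liquid pressures, as \<open>gamma (Liq M) q\<close> is
  unbounded for \<open>q\<close> near 0.)

  Assumption \<open>phi_unique\<close> says that \<open>phi\<close> is well defined.\<close>

locale two_phase_setting =
  V: admissible_phase "Vap M" + L: admissible_phase "Liq M" for M :: two_phase +
  assumes prange_Vap: "prange (Vap M) = {0<..}"
    and prange_Liq: "prange (Liq M) = {pmin M..}"
    and pmin: "pmin M \<le> 0"
    and vol_Vap_at_0: "filterlim (vol (Vap M)) at_top (at_right 0)"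
    and psat_pos: "psat M > 0"
    and psat: "gib (Liq M) (psat M) = gib (Vap M) (psat M)"
    and tau: "tau M > 0"
    and alpha: "0 < alpha M" "alpha M < 1"
    and beta: "beta M > 0" "alpha M * beta M < 1"
    and vol_ratio: "\<lbrakk>p \<in> {0<..sigma_max M * psat M}; q \<in> {pmin M..}\<rbrakk> \<Longrightarrow>
      0 < vol (Liq M) q / vol (Vap M) p \<and> vol (Liq M) q / vol (Vap M) p \<le> alpha M"
    and impedance_ratio: "\<lbrakk>p \<in> {0<..sigma_max M * psat M}; q \<in> {pmin M..}\<rbrakk> \<Longrightarrow>
      0 < (vol (Liq M) q * cs (Vap M) p) / (vol (Vap M) p * cs (Liq M) q) \<and>
      (vol (Liq M) q * cs (Vap M) p) / (vol (Vap M) p * cs (Liq M) q) \<le> alpha M * beta M"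
    and tau_bound: "p \<in> {0<..sigma_max M * psat M} \<Longrightarrow>
      tau M * (1 - alpha M)\<^sup>2 * cs (Vap M) p ^ 3 < gamma (Vap M) p"
    and cond_I_or_II: "\<lbrakk>p \<in> {0<..sigma_max M * psat M}; q > 0\<rbrakk> \<Longrightarrow>
      cond_I M p q \<or> cond_II M p q"
    and phi_unique: "p \<in> {0<..sigma_max M * psat M} \<Longrightarrow> \<exists>!q. interface_pressure M p q"
    and pmax: "0 < pmax M" "pmax M \<le> sigma_max M * psat M"
    and vbar_deriv: "p \<in> {pmin M..pmax M} \<Longrightarrow>
      \<exists>D>0. (vbar M has_real_derivative D) (at p within {pmin M..pmax M})"
    and vbar_ends: "vbar M (pmin M) = vol (Liq M) (pmin M)"
      "vbar M (pmax M) = vol (Vap M) (pmax M)"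
    and pmax_eq: "0 = psat M * (vol (Vap M) (psat M) - vol (Liq M) (psat M))
      - integral {vol (Liq M) (psat M)..vol (Vap M) (psat M)} (p_of_v M)"


section \<open>The Riemann problem\<close>

text \<open>Within a phase density and pressure determine each other; a state is written as the pair
  of pressure and velocity.\<close>

type_synonym state = "real \<times> real"

definition mass_flux :: "phase \<Rightarrow> real \<Rightarrow> state \<Rightarrow> real" where
  "mass_flux K W w = - (density K (fst w) * (snd w - W))"

text \<open>The jump of \<open>g + u\<^sup>2/2\<close> across a discontinuity of speed \<open>W\<close>, where \<open>u\<close> is the velocity
  relative to the discontinuity. With the laboratory velocity the expression would not be
  invariant under Galilean transformations, and it would differ from \<open>h / tau\<close> at a phase
  boundary.\<close>

definition energy_jump :: "phase \<Rightarrow> state \<Rightarrow> phase \<Rightarrow> state \<Rightarrow> real \<Rightarrow> real" where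
  "energy_jump K\<^sub>l w\<^sub>l K\<^sub>r w\<^sub>r W =
     (gib K\<^sub>r (fst w\<^sub>r) + (snd w\<^sub>r - W)\<^sup>2 / 2) - (gib K\<^sub>l (fst w\<^sub>l) + (snd w\<^sub>l - W)\<^sup>2 / 2)"

definition jump_conditions :: "phase \<Rightarrow> state \<Rightarrow> phase \<Rightarrow> state \<Rightarrow> real \<Rightarrow> bool" where
  "jump_conditions K\<^sub>l w\<^sub>l K\<^sub>r w\<^sub>r W \<longleftrightarrow>
     mass_flux K\<^sub>l W w\<^sub>l = mass_flux K\<^sub>r W w\<^sub>r
     \<and> - mass_flux K\<^sub>l W w\<^sub>l * (snd w\<^sub>r - snd w\<^sub>l) + (fst w\<^sub>r - fst w\<^sub>l) = 0
     \<and> mass_flux K\<^sub>l W w\<^sub>l * energy_jump K\<^sub>l w\<^sub>l K\<^sub>r w\<^sub>r W \<ge> 0"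

text \<open>The isothermal Euler equations at the point \<open>(t, x)\<close>, in the classical sense.\<close>

definition euler_at ::
  "(real \<Rightarrow> real \<Rightarrow> real) \<Rightarrow> (real \<Rightarrow> real \<Rightarrow> real) \<Rightarrow> (real \<Rightarrow> real \<Rightarrow> real) \<Rightarrow> real \<Rightarrow> real \<Rightarrow> bool"
  where
  "euler_at \<rho> u p t x \<longleftrightarrow> (\<exists>\<rho>\<^sub>t m\<^sub>x m\<^sub>t f\<^sub>x.
     ((\<lambda>s. \<rho> s x) has_real_derivative \<rho>\<^sub>t) (at t)
     \<and> ((\<lambda>y. \<rho> t y * u t y) has_real_derivative m\<^sub>x) (at x)
     \<and> \<rho>\<^sub>t + m\<^sub>x = 0
     \<and> ((\<lambda>s. \<rho> s x * u s x) has_real_derivative m\<^sub>t) (at t)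
     \<and> ((\<lambda>y. \<rho> t y * (u t y)\<^sup>2 + p t y) has_real_derivative f\<^sub>x) (at x)
     \<and> m\<^sub>t + f\<^sub>x = 0)"

text \<open>Classical waves inside the phase \<open>K\<close>. The parameter \<open>e\<close> is the family: \<open>-1\<close> for the
  characteristic speed \<open>u - a\<close>, \<open>1\<close> for \<open>u + a\<close>. For shocks it is the sign of the mass flux,
  which is nonzero.\<close>

definition shock :: "phase \<Rightarrow> real \<Rightarrow> state \<Rightarrow> state \<Rightarrow> real \<Rightarrow> bool" where
  "shock K e w\<^sub>l w\<^sub>r s \<longleftrightarrow> w\<^sub>l \<noteq> w\<^sub>r \<and> jump_conditions K w\<^sub>l K w\<^sub>r s \<and> e * mass_flux K s w\<^sub>l > 0"

text \<open>\<open>w\<close> is the profile of the wave as a function of \<open>x / t\<close>. The case \<open>s\<^sub>1 = s\<^sub>2\<close> is the wave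
  of zero strength.\<close>

definition rarefaction ::
  "phase \<Rightarrow> real \<Rightarrow> state \<Rightarrow> state \<Rightarrow> real \<Rightarrow> real \<Rightarrow> (real \<Rightarrow> state) \<Rightarrow> bool" where
  "rarefaction K e w\<^sub>l w\<^sub>r s\<^sub>1 s\<^sub>2 w \<longleftrightarrow> s\<^sub>1 \<le> s\<^sub>2
     \<and> w s\<^sub>1 = w\<^sub>l \<and> w s\<^sub>2 = w\<^sub>r \<and> continuous_on {s\<^sub>1..s\<^sub>2} w
     \<and> (\<forall>\<xi>\<in>{s\<^sub>1..s\<^sub>2}. \<xi> = snd (w \<xi>) + e * cs K (fst (w \<xi>)))
     \<and> (\<forall>t>0. \<forall>x. s\<^sub>1 < x / t \<and> x / t < s\<^sub>2 \<longrightarrow>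
          euler_at (\<lambda>t x. density K (fst (w (x / t)))) (\<lambda>t x. snd (w (x / t)))
            (\<lambda>t x. fst (w (x / t))) t x)"

definition phase_transition :: "two_phase \<Rightarrow> state \<Rightarrow> state \<Rightarrow> real \<Rightarrow> bool" where
  "phase_transition M w\<^sub>V w\<^sub>L W \<longleftrightarrow>
     jump_conditions (Vap M) w\<^sub>V (Liq M) w\<^sub>L W
     \<and> (let z = mass_flux (Vap M) W w\<^sub>V in
          z = tau M * fst w\<^sub>V * energy_jump (Vap M) w\<^sub>V (Liq M) w\<^sub>L W
          \<and> - (cs (Vap M) (fst w\<^sub>V) / vol (Vap M) (fst w\<^sub>V)) \<le> z
          \<and> z \<le> cs (Liq M) (fst w\<^sub>L) / vol (Liq M) (fst w\<^sub>L))"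

text \<open>\<open>\<rho>\<close> and \<open>u\<close> (functions of \<open>t\<close> and \<open>x\<close>) are a (b)-type solution with phase transition for
  the initial states \<open>W\<^sub>V\<close>, \<open>W\<^sub>L\<close>. The phase boundary has speed \<open>W\<close>. The self-similar vapor
  profile \<open>w\<^sub>V\<close> is used for \<open>x / t \<le> W\<close> and the liquid profile \<open>w\<^sub>L\<close> for \<open>x / t \<ge> W\<close>, so that
  \<open>w\<^sub>V W\<close> and \<open>w\<^sub>L W\<close> are the states at the phase boundary. The waves occupy
  \<open>s\<^sub>1 \<le> x / t \<le> s\<^sub>2\<close> and \<open>s\<^sub>3 \<le> x / t \<le> s\<^sub>4\<close>. As usual the left one belongs to the first and
  the right one to the second family, as encoded in the functions \<open>f_K\<close> below. A rarefaction
  wave may touch the phase boundary: this happens if the bounds on \<open>z\<close> are attained.\<close>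

definition b_solution ::
  "two_phase \<Rightarrow> state \<Rightarrow> state \<Rightarrow> (real \<Rightarrow> real \<Rightarrow> real) \<Rightarrow> (real \<Rightarrow> real \<Rightarrow> real) \<Rightarrow> bool" where
  "b_solution M W\<^sub>V W\<^sub>L \<rho> u \<longleftrightarrow> (\<exists>w\<^sub>V w\<^sub>L W s\<^sub>1 s\<^sub>2 s\<^sub>3 s\<^sub>4.
     (\<forall>x<0. \<rho> 0 x = density (Vap M) (fst W\<^sub>V) \<and> u 0 x = snd W\<^sub>V)
     \<and> (\<forall>x>0. \<rho> 0 x = density (Liq M) (fst W\<^sub>L) \<and> u 0 x = snd W\<^sub>L)
     \<and> (\<forall>t>0. \<forall>x<W * t. \<rho> t x = density (Vap M) (fst (w\<^sub>V (x / t))) \<and> u t x = snd (w\<^sub>V (x / t)))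
     \<and> (\<forall>t>0. \<forall>x>W * t. \<rho> t x = density (Liq M) (fst (w\<^sub>L (x / t))) \<and> u t x = snd (w\<^sub>L (x / t)))
     \<and> (\<forall>\<xi>\<le>W. fst (w\<^sub>V \<xi>) \<in> {0<..pmax M})
     \<and> (\<forall>\<xi>\<ge>W. fst (w\<^sub>L \<xi>) \<in> prange (Liq M))
     \<and> (\<forall>\<xi><s\<^sub>1. w\<^sub>V \<xi> = W\<^sub>V) \<and> (\<forall>\<xi>\<in>{s\<^sub>2<..W}. w\<^sub>V \<xi> = w\<^sub>V W)
     \<and> (\<forall>\<xi>\<in>{W..<s\<^sub>3}. w\<^sub>L \<xi> = w\<^sub>L W) \<and> (\<forall>\<xi>>s\<^sub>4. w\<^sub>L \<xi> = W\<^sub>L)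
     \<and> (s\<^sub>1 = s\<^sub>2 \<and> s\<^sub>2 < W \<and> shock (Vap M) (-1) W\<^sub>V (w\<^sub>V W) s\<^sub>1
        \<or> s\<^sub>2 \<le> W \<and> rarefaction (Vap M) (-1) W\<^sub>V (w\<^sub>V W) s\<^sub>1 s\<^sub>2 w\<^sub>V)
     \<and> (s\<^sub>3 = s\<^sub>4 \<and> W < s\<^sub>3 \<and> shock (Liq M) 1 (w\<^sub>L W) W\<^sub>L s\<^sub>3
        \<or> W \<le> s\<^sub>3 \<and> rarefaction (Liq M) 1 (w\<^sub>L W) W\<^sub>L s\<^sub>3 s\<^sub>4 w\<^sub>L)
     \<and> phase_transition M (w\<^sub>V W) (w\<^sub>L W) W)"


section \<open>The function \<open>f_z\<close>\<close>

text \<open>In the second case the integral from \<open>p\<^sub>K = fst w\<close> to \<open>q\<close> has reversed orientation.\<close>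

definition f_K :: "phase \<Rightarrow> real \<Rightarrow> state \<Rightarrow> real" where
  "f_K K q w =
    (if q > fst w then sqrt (- ((q - fst w) * (vol K q - vol K (fst w))))
     else - integral {q..fst w} (\<lambda>\<zeta>. vol K \<zeta> / cs K \<zeta>))"

definition f_z :: "two_phase \<Rightarrow> real \<Rightarrow> state \<Rightarrow> state \<Rightarrow> real" where
  "f_z M p W\<^sub>V W\<^sub>L = f_K (Vap M) p W\<^sub>V + f_K (Liq M) (phi M p) W\<^sub>L
     + zflux M p * (vol (Liq M) (phi M p) - vol (Vap M) p) + snd W\<^sub>L - snd W\<^sub>V"

end

theory Submission
  imports Defs
begin

text \<open>The states next to the phase boundary are determined by the vapor pressure \<open>p\<close> there: the jump
  conditions and the kinetic relation force the liquid pressure \<open>phi M p\<close> and the mass flux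
  \<open>zflux M p\<close>, and matching the velocities through the two classical waves gives \<open>f_z p = 0\<close>.
  A root \<open>p\<close> yields a solution if both waves stay on their side of the phase boundary. For
  rarefaction waves this is the sonic bound on the flux, for the liquid shock it follows from the
  convexity of the isotherm, and for the vapor shock it is the condition on the flux at the root.

  Since \<open>f_z\<close> tends to \<open>-\<infinity>\<close> for \<open>p\<close> near 0 and is strictly increasing, there is exactly one root in
  \<open>{0<..pmax M}\<close> if \<open>f_z (pmax M) \<ge> 0\<close>, and none otherwise. Above the saturation pressure the flux
  is negative, \<open>phi\<close> may fail to be differentiable, and monotonicity is obtained by moving first the
  vapor and then the liquid pressure. Below it, \<open>phi\<close> is differentiated implicitly; its slope can be
  negative, but then it is dominated because the liquid has the larger impedance.\<close>

text \<open>Positivity of \<open>GG\<close> makes the acoustic impedance increase with pressure, so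
  both isotherms are strictly convex. This convexity gives the sign of the entropy production in
  shocks, the subsonic liquid side of the boundary and the monotonicity of \<open>h\<close> in the
  liquid pressure. The alternatives \<open>cond_I\<close> and \<open>cond_II\<close> contribute two
  inequalities for the vapor: \<open>gamma\<close> is at most 1, which makes \<open>f_z\<close>
  diverge logarithmically towards vacuum, and \<open>eps\<close> is at most
  \<open>- alpha M\<close>, which controls the slope of \<phi> below saturation. The two regimes
  differ because the denominator of that slope contains the factor \<open>1 + m * \<kappa>\<close>,
  where \<open>m\<close> is the flux divided by the vapor impedance. It is positive for a positive
  flux but can vanish for a negative one. Continuity of \<phi> therefore rests on uniqueness of the
  interface pressure and a closed graph, not on an implicit function theorem.\<close>

lemma increasing_by_derivative:
  fixes f :: "real \<Rightarrow> real"
  assumes "a < b" and "continuous_on {a..b} f"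
    and "\<And>x. a < x \<Longrightarrow> x < b \<Longrightarrow> (f has_real_derivative f' x) (at x)"
    and "\<And>x. a < x \<Longrightarrow> x < b \<Longrightarrow> f' x > 0"
  shows "f a < f b"
  by (rule DERIV_pos_imp_increasing_open[OF assms(1) _ assms(2)]) (use assms(3,4) in blast)

lemma nondecreasing_by_derivative:
  fixes f :: "real \<Rightarrow> real"
  assumes "a \<le> b" and "continuous_on {a..b} f"
    and "\<And>x. a < x \<Longrightarrow> x < b \<Longrightarrow> (f has_real_derivative f' x) (at x)"
    and "\<And>x. a < x \<Longrightarrow> x < b \<Longrightarrow> f' x \<ge> 0"
  shows "f a \<le> f b"
  by (rule DERIV_nonneg_imp_increasing_open[OF assms(1) _ assms(2)]) (use assms(3,4) in blast)

text \<open>Differentiability of \<open>F\<close> at one point suffices because \<open>g\<close> is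
  already known to be continuous. Expanding \<open>F\<close> along the graph gives \<open>\<bar>A *
  s + B * t\<bar> \<le> e' * (\<bar>s\<bar> + \<bar>t\<bar>)\<close> for the increments
  \<open>s\<close> and \<open>t\<close>, and this is solved for \<open>t\<close>.\<close>

lemma implicit_derivative:
  fixes g :: "real \<Rightarrow> real" and F :: "real \<times> real \<Rightarrow> real"
  assumes F: "(F has_derivative (\<lambda>(s, t). A * s + B * t)) (at (p, g p))"
    and B: "B \<noteq> 0" and g: "isCont g p"
    and root: "\<forall>\<^sub>F x in nhds p. F (x, g x) = 0"
  shows "(g has_real_derivative - A / B) (at p)"
proof -
  have F0: "F (p, g p) = 0"
    using eventually_nhds_x_imp_x[OF root] by simp
  have "(g has_derivative (*) (- A / B)) (at p)"
    unfolding has_derivative_at_alt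
  proof (intro conjI bounded_linear_mult_right allI impI)
    fix e :: real assume "e > 0"
    \<comment> \<open>The first entry of \<open>e'\<close> lets half of
      \<open>\<bar>B\<bar> * \<bar>t\<bar>\<close> be absorbed, which bounds \<open>t\<close> by
      \<open>C\<close> times \<open>s\<close>; the second entry then makes the error
      \<open>e' * (1 + C)\<close> at most \<open>e * \<bar>B\<bar>\<close>.\<close>
    define C where "C = 2 * (\<bar>A\<bar> + \<bar>B\<bar> / 2) / \<bar>B\<bar>"
    define e' where "e' = min (\<bar>B\<bar> / 2) (e * \<bar>B\<bar> / (1 + C))"
    have C: "C \<ge> 0" by (simp add: C_def)
    have e': "e' > 0" using B \<open>e > 0\<close> C by (simp add: e'_def)
    have e'B: "e' \<le> \<bar>B\<bar> / 2" unfolding e'_def by (rule min.cobounded1)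
    have "e' \<le> e * \<bar>B\<bar> / (1 + C)" unfolding e'_def by (rule min.cobounded2)
    hence e'C: "e' * (1 + C) \<le> e * \<bar>B\<bar>"
      using C by (simp add: pos_le_divide_eq)
    obtain d where "d > 0" and d: "\<And>y. norm (y - (p, g p)) < d \<Longrightarrow>
        norm (F y - F (p, g p) - (case y - (p, g p) of (s, t) \<Rightarrow> A * s + B * t))
          \<le> e' * norm (y - (p, g p))"
      using F e' unfolding has_derivative_at_alt by blast
    have "((\<lambda>x. (x, g x)) \<longlongrightarrow> (p, g p)) (nhds p)"
      using g unfolding isCont_def tendsto_at_iff_tendsto_nhds
      by (intro tendsto_Pair filterlim_ident)
    hence "\<forall>\<^sub>F x in nhds p. dist (x, g x) (p, g p) < d"
      using \<open>d > 0\<close> by (rule tendstoD)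
    with root have "\<forall>\<^sub>F x in nhds p. norm (g x - g p - (- A / B) * (x - p)) \<le> e * norm (x - p)"
    proof eventually_elim
      case (elim x)
      define s t where "s = x - p" and "t = g x - g p"
      have "\<bar>A * s + B * t\<bar> \<le> e' * norm (s, t)"
        using d[of "(x, g x)"] elim F0 by (auto simp: s_def t_def dist_norm)
      also have "\<dots> \<le> e' * (\<bar>s\<bar> + \<bar>t\<bar>)"
        using norm_Pair_le[of s t] e' by simp
      finally have 1: "\<bar>A * s + B * t\<bar> \<le> e' * (\<bar>s\<bar> + \<bar>t\<bar>)" .
      have "\<bar>B\<bar> * \<bar>t\<bar> \<le> \<bar>A * s + B * t\<bar> + \<bar>A\<bar> * \<bar>s\<bar>"
        by (metis abs_mult abs_triangle_ineq4 add_diff_cancel_left')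
      also have "\<dots> \<le> \<bar>B\<bar> / 2 * (\<bar>s\<bar> + \<bar>t\<bar>) + \<bar>A\<bar> * \<bar>s\<bar>"
        using 1 mult_right_mono[OF e'B, of "\<bar>s\<bar> + \<bar>t\<bar>"] by linarith
      finally have "\<bar>t\<bar> * \<bar>B\<bar> \<le> 2 * (\<bar>A\<bar> + \<bar>B\<bar> / 2) * \<bar>s\<bar>"
        by (simp add: algebra_simps add_divide_distrib)
      hence "\<bar>t\<bar> \<le> C * \<bar>s\<bar>"
        using B by (simp add: C_def pos_le_divide_eq)
      hence "e' * (\<bar>s\<bar> + \<bar>t\<bar>) \<le> e' * ((1 + C) * \<bar>s\<bar>)"
        using e' by (intro mult_left_mono) (auto simp: algebra_simps)
      also have "\<dots> \<le> e * \<bar>B\<bar> * \<bar>s\<bar>"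
        using mult_right_mono[OF e'C, of "\<bar>s\<bar>"] by (simp add: mult.assoc)
      finally have "\<bar>A * s + B * t\<bar> \<le> e * \<bar>B\<bar> * \<bar>s\<bar>" using 1 by simp
      hence "\<bar>(A * s + B * t) / B\<bar> \<le> e * \<bar>s\<bar>"
        using B by (simp add: abs_divide pos_divide_le_eq algebra_simps)
      moreover have "(A * s + B * t) / B = t - (- A / B) * s"
        using B by (simp add: field_simps)
      ultimately have "\<bar>t - (- A / B) * s\<bar> \<le> e * \<bar>s\<bar>" by simp
      thus ?case unfolding s_def t_def real_norm_def .
    qed
    thus "\<exists>d>0. \<forall>y. norm (y - p) < d \<longrightarrow> norm (g y - g p - - A / B * (y - p)) \<le> e * norm (y - p)"
      by (simp add: eventually_nhds_metric dist_norm)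
  qed
  thus ?thesis by (simp add: has_field_derivative_def)
qed

section \<open>A single phase\<close>

text \<open>The acoustic impedance, density times sound speed. The isotherm has slope
  \<open>- 1 / (impedance K p)\<^sup>2\<close>, so sonic bounds and shock fluxes can be compared as
  slopes of tangents and chords.\<close>

definition impedance :: "phase \<Rightarrow> real \<Rightarrow> real" where
  "impedance K p = cs K p / vol K p"

text \<open>The pressure part of the Riemann invariants. Some antiderivative is chosen because the
  vapor range has no left end point at which an integral could start; only its derivative and its
  differences matter.\<close>

definition rinv :: "phase \<Rightarrow> real \<Rightarrow> real" where
  "rinv K = (SOME I. \<forall>p\<in>prange K. (I has_real_derivative vol K p / cs K p) (at p within prange K))"

text \<open>Covers the vapor and the liquid range at once: upward closed, containing all positive
  pressures, with one-sided derivatives at most at the left end.\<close>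

locale half_line_phase = admissible_phase +
  assumes range_cases: "prange K = {0<..} \<or> (\<exists>l\<le>0. prange K = {l..})"
begin

lemma in_range_pos: "p > 0 \<Longrightarrow> p \<in> prange K"
  using range_cases by (elim disjE exE conjE) simp_all

lemma in_range_mono: "p \<in> prange K \<Longrightarrow> p \<le> q \<Longrightarrow> q \<in> prange K"
  using range_cases by (elim disjE exE conjE) simp_all

lemma segment_in_range: "p \<in> prange K \<Longrightarrow> {p..q} \<subseteq> prange K"
  using in_range_mono by auto

lemma at_within_range_right: "p \<in> prange K \<Longrightarrow> p < q \<Longrightarrow> at q within prange K = at q"
proof (rule at_within_interior)
  assume "p \<in> prange K" "p < q"
  hence "{p<..} \<subseteq> prange K" "q \<in> {p<..}"
    using in_range_mono by auto
  thus "q \<in> interior (prange K)"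
    by (meson interiorI open_greaterThan)
qed

lemma at_within_range_pos: "q > 0 \<Longrightarrow> at q within prange K = at q"
  using at_within_range_right[OF in_range_pos[of "q/2"], of q] by simp

lemma range_no_isolated: "p \<in> prange K \<Longrightarrow> at p within prange K \<noteq> bot"
proof -
  assume "p \<in> prange K"
  hence "at p within {p..p+1} \<le> at p within prange K"
    by (intro at_le segment_in_range)
  moreover have "at p within {p..p+1} \<noteq> bot"
    by (simp add: trivial_limit_within islimpt_Icc)
  ultimately show ?thesis by (metis bot.extremum_uniqueI)
qed

lemma impedance_pos: "p \<in> prange K \<Longrightarrow> impedance K p > 0"
  by (simp add: impedance_def vol_pos cs_pos)

lemma inverse_impedance: "vol K p / cs K p = 1 / impedance K p"
  by (simp add: impedance_def)

lemma vol_deriv_within: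
  "p \<in> prange K \<Longrightarrow> (vol K has_real_derivative - 1 / (impedance K p)\<^sup>2) (at p within prange K)"
  using vol_deriv[of p] by (simp add: impedance_def power_divide)

text \<open>Solving the defining relation of the sound speed gives
  \<open>cs = vol / sqrt (- vol')\<close>, so its smoothness is inherited from the second derivative
  of the volume.\<close>

lemma cs_differentiable:
  assumes p: "p \<in> prange K"
  shows "\<exists>D. (cs K has_real_derivative D) (at p within prange K)"
proof -
  obtain f' f'' where f': "\<And>x. x \<in> prange K \<Longrightarrow> (vol K has_real_derivative f' x) (at x within prange K)"
    and f'': "\<And>x. x \<in> prange K \<Longrightarrow> (f' has_real_derivative f'' x) (at x within prange K)"
    using vol_C2 unfolding C2_on_def by auto
  have eq: "f' x = - (vol K x)\<^sup>2 / (cs K x)\<^sup>2" if "x \<in> prange K" for x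
    using vector_derivative_unique_within[OF range_no_isolated[OF that]] f'[OF that] vol_deriv[OF that]
    unfolding has_real_derivative_iff_has_vector_derivative by blast
  have cs_eq: "vol K x / sqrt (- f' x) = cs K x" if "x \<in> prange K" for x
    using vol_pos[OF that] cs_pos[OF that] by (simp add: eq[OF that] real_sqrt_divide)
  have "- f' p > 0"
    using vol_pos[OF p] cs_pos[OF p] by (simp add: eq[OF p])
  hence "\<exists>D. ((\<lambda>x. vol K x / sqrt (- f' x)) has_real_derivative D) (at p within prange K)"
    using DERIV_divide[OF f'[OF p] DERIV_chain2[OF DERIV_real_sqrt DERIV_minus[OF f''[OF p]]]] by auto
  then obtain D where "((\<lambda>x. vol K x / sqrt (- f' x)) has_real_derivative D) (at p within prange K)" ..
  thus ?thesis
    using has_field_derivative_transform_within[OF _ zero_less_one p, of _ D "cs K"] cs_eq by blast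
qed

definition cs' :: "real \<Rightarrow> real" where
  "cs' p = vector_derivative (cs K) (at p within prange K)"

lemma cs_deriv_within:
  "p \<in> prange K \<Longrightarrow> (cs K has_real_derivative cs' p) (at p within prange K)"
  using cs_differentiable[of p] vector_derivative_within[OF range_no_isolated[of p], of "cs K"]
  unfolding cs'_def has_real_derivative_iff_has_vector_derivative by blast

lemma cs'_bound: "p \<in> prange K \<Longrightarrow> 1 + impedance K p * cs' p > 0"
  using GG_pos[of p] by (simp add: GG_def cs'_def impedance_def)

lemma continuous_vol: "continuous_on (prange K) (vol K)"
  using vol_deriv by (meson DERIV_continuous continuous_on_eq_continuous_within)

lemma continuous_cs: "continuous_on (prange K) (cs K)"
  using cs_deriv_within by (meson DERIV_continuous continuous_on_eq_continuous_within)

lemma continuous_gib: "continuous_on (prange K) (gib K)"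
  using gib_deriv by (meson DERIV_continuous continuous_on_eq_continuous_within)

lemma continuous_impedance: "continuous_on (prange K) (impedance K)"
  unfolding impedance_def using vol_pos by (intro continuous_intros continuous_vol continuous_cs) force

lemma vol_deriv_pos: "p > 0 \<Longrightarrow> (vol K has_real_derivative - 1 / (impedance K p)\<^sup>2) (at p)"
  using vol_deriv_within[OF in_range_pos, of p] at_within_range_pos[of p] by simp

lemma gib_deriv_pos: "p > 0 \<Longrightarrow> (gib K has_real_derivative vol K p) (at p)"
  using gib_deriv[OF in_range_pos, of p] at_within_range_pos[of p] by simp

section \<open>Strict convexity of the isotherm\<close>

text \<open>The derivative is \<open>GG K x / cs K x\<close>, positive by assumption; this is the
  genuine nonlinearity of the acoustic waves.\<close>

lemma impedance_strict_mono:
  assumes p: "p \<in> prange K" and "p < q"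
  shows "impedance K p < impedance K q"
proof (rule increasing_by_derivative[OF \<open>p < q\<close>])
  show "continuous_on {p..q} (impedance K)"
    using continuous_on_subset[OF continuous_impedance segment_in_range[OF p]] .
  fix x assume x: "p < x" "x < q"
  hence xr: "x \<in> prange K" using in_range_mono[OF p] by simp
  have 1: "(vol K has_real_derivative - 1 / (impedance K x)\<^sup>2) (at x)"
    "(cs K has_real_derivative cs' x) (at x)"
    using vol_deriv_within[OF xr] cs_deriv_within[OF xr] at_within_range_right[OF p x(1)] by auto
  show "(impedance K has_real_derivative (1 + impedance K x * cs' x) / cs K x) (at x)"
    unfolding impedance_def[abs_def]
    by (rule DERIV_cong[OF DERIV_divide[OF 1(2,1)]])
      (use vol_pos[OF xr] cs_pos[OF xr] in \<open>auto simp: impedance_def field_simps power2_eq_square\<close>)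
  show "(1 + impedance K x * cs' x) / cs K x > 0"
    using cs'_bound[OF xr] cs_pos[OF xr] by simp
qed

lemma impedance_mono: "p \<in> prange K \<Longrightarrow> p \<le> q \<Longrightarrow> impedance K p \<le> impedance K q"
  using impedance_strict_mono[of p q] by (cases "p = q") auto

lemma vol_mean_value:
  assumes p: "p \<in> prange K" and "p < q"
  obtains x where "p < x" "x < q" "vol K p - vol K q = (q - p) / (impedance K x)\<^sup>2"
proof -
  have d: "(vol K has_real_derivative - 1 / (impedance K x)\<^sup>2) (at x)" if "p < x" for x
    using vol_deriv_within[OF in_range_mono[OF p], of x] that
    unfolding at_within_range_right[OF p that] by simp
  obtain l x where x: "p < x" "x < q" "DERIV (vol K) x :> l" "vol K q - vol K p = (q - p) * l"
    using MVT[OF \<open>p < q\<close> continuous_on_subset[OF continuous_vol segment_in_range[OF p]]]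
    by (meson d real_differentiable_def)
  moreover have "l = - 1 / (impedance K x)\<^sup>2"
    using DERIV_unique[OF x(3) d[OF x(1)]] .
  ultimately show thesis using that[of x] by (simp add: algebra_simps)
qed

lemma inverse_square_impedance_less:
  "p \<in> prange K \<Longrightarrow> p < q \<Longrightarrow> 1 / (impedance K q)\<^sup>2 < 1 / (impedance K p)\<^sup>2"
  using impedance_strict_mono[of p q] impedance_pos[of p]
  by (intro divide_strict_left_mono) (auto intro!: power_strict_mono mult_pos_pos)

text \<open>A chord has the slope of the tangent at an intermediate point, and the slopes
  \<open>- 1 / (impedance K x)\<^sup>2\<close> increase strictly with pressure.\<close>

lemma chord_slope:
  assumes p: "p \<in> prange K" and "p < q"
  shows "(q - p) / (impedance K q)\<^sup>2 < vol K p - vol K q"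
    and "vol K p - vol K q < (q - p) / (impedance K p)\<^sup>2"
proof -
  obtain x where x: "p < x" "x < q" "vol K p - vol K q = (q - p) / (impedance K x)\<^sup>2"
    using vol_mean_value[OF assms] .
  have "(q - p) * (1 / (impedance K q)\<^sup>2) < (q - p) * (1 / (impedance K x)\<^sup>2)"
    using inverse_square_impedance_less[OF in_range_mono[OF p] x(2)] x(1) \<open>p < q\<close>
    by (intro mult_strict_left_mono) auto
  thus "(q - p) / (impedance K q)\<^sup>2 < vol K p - vol K q" using x by simp
  have "(q - p) * (1 / (impedance K x)\<^sup>2) < (q - p) * (1 / (impedance K p)\<^sup>2)"
    using inverse_square_impedance_less[OF p x(1)] \<open>p < q\<close>
    by (intro mult_strict_left_mono) auto
  thus "vol K p - vol K q < (q - p) / (impedance K p)\<^sup>2" using x by simp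
qed

lemma vol_above_tangent:
  assumes "p \<in> prange K" "q \<in> prange K"
  shows "vol K p \<ge> vol K q + (q - p) / (impedance K q)\<^sup>2"
  using chord_slope(1)[OF assms(1), of q] chord_slope(2)[OF assms(2), of p]
  by (cases p q rule: linorder_cases) (auto simp: diff_divide_distrib)

lemma vol_strict_antimono: "p \<in> prange K \<Longrightarrow> p < q \<Longrightarrow> vol K q < vol K p"
  using chord_slope(1)[of p q] by (smt (verit) divide_nonneg_nonneg zero_le_power2)

text \<open>The Gibbs difference is the integral of \<open>vol\<close>, and the trapezoidal rule
  overestimates a strictly convex integrand.\<close>

lemma gib_below_trapezoid:
  assumes p: "p \<in> prange K" and "p < q"
  shows "gib K q - gib K p < (q - p) * (vol K p + vol K q) / 2"
proof -
  let ?D = "\<lambda>x. (x - p) * (vol K p + vol K x) / 2 - gib K x"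
  have "?D p < ?D q"
  proof (rule increasing_by_derivative[OF \<open>p < q\<close>])
    show "continuous_on {p..q} ?D"
      by (intro continuous_intros continuous_on_subset[OF continuous_vol segment_in_range[OF p]]
          continuous_on_subset[OF continuous_gib segment_in_range[OF p]]) auto
    fix x assume x: "p < x" "x < q"
    have xr: "x \<in> prange K" using in_range_mono[OF p] x by simp
    note d = vol_deriv_within[OF xr, unfolded at_within_range_right[OF p x(1)]]
      gib_deriv[OF xr, unfolded at_within_range_right[OF p x(1)]]
    show "(?D has_real_derivative ((vol K p - vol K x) - (x - p) / (impedance K x)\<^sup>2) / 2) (at x)"
      by (rule DERIV_cong[OF DERIV_diff[OF DERIV_cdivide[OF DERIV_mult[OF DERIV_diff[OF
        DERIV_ident DERIV_const] DERIV_add[OF DERIV_const d(1)]]] d(2)]]) (simp add: field_simps)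
    show "((vol K p - vol K x) - (x - p) / (impedance K x)\<^sup>2) / 2 > 0"
      using chord_slope(1)[OF p x(1)] by simp
  qed
  thus ?thesis by simp
qed

section \<open>Riemann invariants\<close>

lemma rinv_deriv_within:
  assumes "p \<in> prange K"
  shows "(rinv K has_real_derivative 1 / impedance K p) (at p within prange K)"
proof -
  have "\<exists>I. \<forall>p\<in>prange K. (I has_real_derivative vol K p / cs K p) (at p within prange K)"
    using range_cases
  proof
    assume r: "prange K = {0<..}"
    have "isCont (\<lambda>p. vol K p / cs K p) x" if "0 < ereal x" for x
    proof -
      have "x \<in> prange K" using that r by simp
      thus ?thesis
        using continuous_vol continuous_cs cs_pos[of x] r 
        by (intro continuous_divide) (auto simp: continuous_on_eq_continuous_at)
    qed
    then obtain F where F: "\<And>x::real. 0 < ereal x \<Longrightarrow> (F has_vector_derivative vol K x / cs K x) (at x)"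
      using einterval_antiderivative[of 0 \<infinity> "\<lambda>p. vol K p / cs K p"] by auto
    show ?thesis
      by (intro exI[of _ F] ballI)
        (use F r in \<open>auto simp: has_real_derivative_iff_has_vector_derivative intro: has_vector_derivative_at_within\<close>)
  next
    assume "\<exists>l\<le>0. prange K = {l..}"
    then obtain l where r: "prange K = {l..}" by auto
    have "cs K (max l x) \<noteq> 0" for x
      using cs_pos[of "max l x"] by (simp add: r)
    \<comment> \<open>Composition with \<open>max l\<close> continues the integrand by a constant to
      the left of the closed end, so that an antiderivative on the whole line is available.\<close>
    hence "continuous_on UNIV ((\<lambda>p. vol K p / cs K p) \<circ> max l)"
      using continuous_vol continuous_cs unfolding r
      by (intro continuous_on_compose continuous_intros)
        (auto intro!: continuous_intros elim!: continuous_on_subset)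
    then obtain F where F: "\<And>x::real. (F has_vector_derivative ((\<lambda>p. vol K p / cs K p) \<circ> max l) x) (at x)"
      using einterval_antiderivative[of "-\<infinity>" \<infinity> "(\<lambda>p. vol K p / cs K p) \<circ> max l"]
      by (auto simp: continuous_on_eq_continuous_at simp del: o_apply)
    have "(F has_real_derivative vol K p / cs K p) (at p within prange K)" if "p \<in> prange K" for p
      using has_vector_derivative_at_within[OF F[of p]] that
      by (simp add: has_real_derivative_iff_has_vector_derivative r max_def)
    thus ?thesis by blast
  qed
  from someI_ex[OF this] show ?thesis
    using assms unfolding rinv_def[symmetric] by (simp add: impedance_def)
qed

lemma continuous_rinv: "continuous_on (prange K) (rinv K)"
  using rinv_deriv_within by (meson DERIV_continuous continuous_on_eq_continuous_within)

lemma integral_inverse_impedance: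
  assumes "p \<in> prange K" "p \<le> q"
  shows "integral {p..q} (\<lambda>\<zeta>. vol K \<zeta> / cs K \<zeta>) = rinv K q - rinv K p"
proof (rule integral_unique, rule fundamental_theorem_of_calculus[OF assms(2)])
  fix x assume "x \<in> {p..q}"
  thus "(rinv K has_vector_derivative vol K x / cs K x) (at x within {p..q})"
    using rinv_deriv_within[of x] segment_in_range[OF assms(1), of q]
    unfolding inverse_impedance has_real_derivative_iff_has_vector_derivative[symmetric]
    by (blast intro: DERIV_subset)
qed

text \<open>The derivative is \<open>GG\<close> divided by the impedance. Up to sign and a constant
  the sum is the characteristic speed along a simple wave, so its monotonicity fixes the direction
  of rarefactions and makes their profiles invertible.\<close>

lemma rinv_plus_cs_strict_mono:
  assumes p: "p \<in> prange K" and "p < q"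
  shows "rinv K p + cs K p < rinv K q + cs K q"
proof (rule increasing_by_derivative[OF \<open>p < q\<close>])
  show "continuous_on {p..q} (\<lambda>p. rinv K p + cs K p)"
    by (intro continuous_intros continuous_on_subset[OF continuous_rinv segment_in_range[OF p]]
        continuous_on_subset[OF continuous_cs segment_in_range[OF p]])
  fix x assume x: "p < x" "x < q"
  hence xr: "x \<in> prange K" using in_range_mono[OF p] by simp
  show "((\<lambda>p. rinv K p + cs K p) has_real_derivative 1 / impedance K x + cs' x) (at x)"
    using DERIV_add[OF rinv_deriv_within[OF xr] cs_deriv_within[OF xr]]
      at_within_range_right[OF p x(1)] by simp
  show "1 / impedance K x + cs' x > 0"
    using cs'_bound[OF xr] impedance_pos[OF xr] by (simp add: field_simps)
qed

section \<open>The wave functions \<open>f_K\<close>\<close>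

lemma f_K_below: "p \<in> prange K \<Longrightarrow> p \<le> fst w \<Longrightarrow> f_K K p w = rinv K p - rinv K (fst w)"
  by (simp add: f_K_def integral_inverse_impedance)

text \<open>On the rarefaction branch the derivative is \<open>1 / i\<close>; on the shock branch it
  is the mean of \<open>1 / j\<close> and \<open>j / i\<^sup>2\<close>, with \<open>j\<close> the
  impedance of the chord. The lower bound serves the vapor wave; the upper bound limits the loss
  from the liquid wave where \<phi> decreases. The pressure \<open>l\<close> guarantees room to the
  left of \<open>q\<close> inside the range.\<close>

lemma f_K_deriv:
  assumes w: "fst w \<in> prange K" and l: "l \<in> prange K" "l < q"
  obtains D where "((\<lambda>q. f_K K q w) has_real_derivative D) (at q)"
    and "1 / impedance K q \<le> D" and "D \<le> 1 / impedance K (min q (fst w))"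
proof -
  define p where "p = fst w"
  have p: "p \<in> prange K" using w by (simp add: p_def)
  have qr: "q \<in> prange K" using in_range_mono[of l q] l by simp
  have rinv_q: "(rinv K has_real_derivative 1 / impedance K q) (at q)"
    using rinv_deriv_within[OF qr] unfolding at_within_range_right[OF l] .
  have vol_q: "(vol K has_real_derivative - 1 / (impedance K q)\<^sup>2) (at q)"
    using vol_deriv_within[OF qr] unfolding at_within_range_right[OF l] .
  have below: "\<forall>\<^sub>F x in at q. x \<le> p \<longrightarrow> f_K K x w = rinv K x - rinv K p"
  proof -
    have "\<forall>\<^sub>F x in at q. l < x" using order_tendstoD(1)[OF tendsto_ident_at l(2)] .
    thus ?thesis
      by eventually_elim (use f_K_below in_range_mono[OF l(1)] in \<open>auto simp: p_def\<close>)
  qed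
  consider "q < p" | "q = p" | "q > p" by linarith
  thus thesis
  proof cases
    case 1
    have "\<forall>\<^sub>F x in at q. f_K K x w = rinv K x - rinv K p"
      using below order_tendstoD(2)[OF tendsto_ident_at 1] by eventually_elim auto
    hence ev: "\<forall>\<^sub>F x in nhds q. f_K K x w = rinv K x - rinv K p"
      unfolding eventually_nhds_conv_at using f_K_below[OF qr, of w] 1 by (simp add: p_def)
    have "((\<lambda>q. f_K K q w) has_real_derivative 1 / impedance K q) (at q)"
      unfolding DERIV_cong_ev[OF refl ev refl]
      using DERIV_diff[OF rinv_q DERIV_const[of "rinv K p"]] by simp
    thus thesis using that 1 by (simp add: p_def)
  next
    case 3
    define X Y i where "X = q - p" and "Y = vol K p - vol K q" and "i = impedance K q"
    \<comment> \<open>The absolute mass flux of the shock; by convexity it lies strictly between the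
      impedances at \<open>p\<close> and at \<open>q\<close>.\<close>
    define j where "j = sqrt (X / Y)"
    have X: "X > 0" and i: "i > 0" using 3 impedance_pos[OF qr] by (auto simp: X_def i_def)
    have Y: "X / i\<^sup>2 < Y" "Y < X / (impedance K p)\<^sup>2"
      using chord_slope[OF p 3] by (auto simp: X_def Y_def i_def)
    have Y0: "Y > 0" using Y(1) X i by (smt (verit) divide_nonneg_nonneg zero_le_power2)
    have j0: "j > 0" using X Y0 by (simp add: j_def)
    have j2: "Y = X / j\<^sup>2" using X Y0 by (simp add: j_def)
    have "i\<^sup>2 > X / Y" "X / Y > (impedance K p)\<^sup>2"
      using Y Y0 i impedance_pos[OF p] by (auto simp: field_simps)
    hence j: "impedance K p < j" "j < i"
      using i impedance_pos[OF p] by (auto simp: j_def real_less_rsqrt intro!: real_less_lsqrt)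
    let ?D = "(1 / j + j / i\<^sup>2) / 2"
    have S: "sqrt (X * Y) = X / j"
      using X j0 by (simp add: j2 real_sqrt_divide power2_eq_square real_sqrt_mult)
    have "((\<lambda>q. sqrt ((q - p) * (vol K p - vol K q))) has_real_derivative
        inverse (sqrt (X * Y)) / 2 * (1 * Y + (0 - - 1 / i\<^sup>2) * X)) (at q)"
      unfolding X_def Y_def i_def
    proof (rule DERIV_chain2[OF DERIV_real_sqrt])
      show "0 < (q - p) * (vol K p - vol K q)" using X Y0 by (simp add: X_def Y_def)
      show "((\<lambda>q. (q - p) * (vol K p - vol K q)) has_real_derivative
          1 * (vol K p - vol K q) + (0 - - 1 / (impedance K q)\<^sup>2) * (q - p)) (at q)"
        by (rule DERIV_cong[OF DERIV_mult[OF DERIV_diff[OF DERIV_ident DERIV_const]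
              DERIV_diff[OF DERIV_const vol_q]]]) simp
    qed
    moreover have "inverse (sqrt (X * Y)) / 2 * (1 * Y + (0 - - 1 / i\<^sup>2) * X) = ?D"
      using X i j0 unfolding S by (simp add: j2 field_simps power2_eq_square)
    ultimately have "((\<lambda>q. sqrt ((q - p) * (vol K p - vol K q))) has_real_derivative ?D) (at q)"
      by simp
    moreover have ev: "\<forall>\<^sub>F x in nhds q. f_K K x w = sqrt ((x - p) * (vol K p - vol K x))"
      using eventually_nhds_in_open[OF open_greaterThan[of p], of q] 3
      by (auto elim!: eventually_mono simp: f_K_def p_def algebra_simps)
    ultimately have "((\<lambda>q. f_K K q w) has_real_derivative ?D) (at q)"
      unfolding DERIV_cong_ev[OF refl ev refl] by blast
    moreover have "?D \<ge> 1 / i"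
    proof -
      \<comment> \<open>The arithmetic mean of \<open>1 / j\<close> and \<open>j / i\<^sup>2\<close>
        exceeds their geometric mean \<open>1 / i\<close> by a multiple of a square.\<close>
      have "?D - 1 / i = j * (1 / j - 1 / i)\<^sup>2 / 2"
        using i j0 by (simp add: field_simps power2_eq_square)
      thus ?thesis using j0 by (smt (verit) divide_nonneg_nonneg mult_nonneg_nonneg zero_le_power2)
    qed
    moreover have "?D \<le> 1 / impedance K p"
    proof -
      have "1 / j \<le> 1 / impedance K p" using j impedance_pos[OF p] by (simp add: frac_le)
      moreover have "j / i\<^sup>2 \<le> 1 / i" using j i by (simp add: field_simps power2_eq_square)
      moreover have "1 / i \<le> 1 / j" using j j0 by (simp add: frac_le)
      ultimately have "1 / j + j / i\<^sup>2 \<le> 1 / impedance K p + 1 / impedance K p"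
        by (meson add_mono order_trans)
      thus ?thesis by simp
    qed
    ultimately show thesis using that 3 by (simp add: p_def i_def)
  next
    case 2
    have fq: "f_K K q w = 0" using f_K_below[OF qr, of w] 2 by (simp add: p_def)
    let ?Q = "\<lambda>x. (f_K K x w - f_K K q w) / (x - q)"
    have "(?Q \<longlongrightarrow> 1 / impedance K q) (at_left q)"
    proof (rule Lim_transform_eventually)
      show "((\<lambda>x. (rinv K x - rinv K q) / (x - q)) \<longlongrightarrow> 1 / impedance K q) (at_left q)"
        using has_field_derivative_at_within[OF rinv_q] unfolding has_field_derivative_iff .
      have "\<forall>\<^sub>F x in at_left q. x < q" by (simp add: eventually_at_filter)
      moreover have "\<forall>\<^sub>F x in at_left q. x \<le> p \<longrightarrow> f_K K x w = rinv K x - rinv K p"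
        using below by (simp add: eventually_at_split)
      ultimately show "\<forall>\<^sub>F x in at_left q. (rinv K x - rinv K q) / (x - q) = ?Q x"
        by eventually_elim (simp add: fq[unfolded 2] 2)
    qed
    moreover have "(?Q \<longlongrightarrow> 1 / impedance K q) (at_right q)"
    proof (rule Lim_transform_eventually)
      \<comment> \<open>To the right of \<open>q\<close> the difference quotient is the square root
        of the negated chord slope of \<open>vol\<close>, which has the same limit as the quotient
        on the rarefaction side.\<close>
      have "((\<lambda>x. (vol K x - vol K q) / (x - q)) \<longlongrightarrow> - 1 / (impedance K q)\<^sup>2) (at_right q)"
        using has_field_derivative_at_within[OF vol_q] unfolding has_field_derivative_iff .
      hence "((\<lambda>x. sqrt (- ((vol K x - vol K q) / (x - q)))) \<longlongrightarrow> sqrt (- (- 1 / (impedance K q)\<^sup>2))) (at_right q)"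
        by (intro tendsto_real_sqrt tendsto_minus)
      thus "((\<lambda>x. sqrt (- ((vol K x - vol K q) / (x - q)))) \<longlongrightarrow> 1 / impedance K q) (at_right q)"
        using impedance_pos[OF qr] by (simp add: real_sqrt_divide)
      have "\<forall>\<^sub>F x in at_right q. x > q" by (simp add: eventually_at_filter)
      thus "\<forall>\<^sub>F x in at_right q. sqrt (- ((vol K x - vol K q) / (x - q))) = ?Q x"
      proof eventually_elim
        case (elim x)
        have "?Q x = sqrt (- ((x - q) * (vol K x - vol K q))) / (x - q)"
          using elim 2 by (simp add: fq f_K_def p_def)
        also have "\<dots> = sqrt (- ((x - q) * (vol K x - vol K q)) / (x - q)\<^sup>2)"
        proof -
          have "sqrt ((x - q)\<^sup>2) = x - q" using elim by simp
          thus ?thesis by (simp only: real_sqrt_divide)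
        qed
        also have "- ((x - q) * (vol K x - vol K q)) / (x - q)\<^sup>2 = - ((vol K x - vol K q) / (x - q))"
          using elim by (simp add: power2_eq_square)
        finally show ?case by simp
      qed
    qed
    ultimately have "((\<lambda>q. f_K K q w) has_real_derivative 1 / impedance K q) (at q)"
      unfolding has_field_derivative_iff by (rule filterlim_split_at)
    thus thesis using that 2 by (simp add: p_def)
  qed
qed

lemma continuous_f_K: "fst w \<in> prange K \<Longrightarrow> continuous_on {0<..} (\<lambda>q. f_K K q w)"
proof (rule continuous_at_imp_continuous_on, rule ballI)
  fix q :: real assume "fst w \<in> prange K" "q \<in> {0<..}"
  thus "isCont (\<lambda>q. f_K K q w) q"
    using f_K_deriv[of w "q/2" q] in_range_pos[of "q/2"] DERIV_isCont by (metis field_sum_of_halves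
        greaterThan_iff half_gt_zero less_add_same_cancel1)
qed

lemma f_K_strict_mono:
  assumes w: "fst w \<in> prange K" and "0 < p" "p < q"
  shows "f_K K p w < f_K K q w"
proof (rule DERIV_pos_imp_increasing[OF \<open>p < q\<close>])
  fix x assume "p \<le> x"
  hence "x/2 \<in> prange K" "x/2 < x" "x \<in> prange K"
    using \<open>0 < p\<close> by (auto intro: in_range_pos)
  from f_K_deriv[OF w this(1,2)] impedance_pos[OF this(3)]
  show "\<exists>y. ((\<lambda>q. f_K K q w) has_real_derivative y) (at x) \<and> 0 < y"
    by (smt (verit) divide_pos_pos)
qed

lemma f_K_mono:
  "fst w \<in> prange K \<Longrightarrow> 0 < p \<Longrightarrow> p \<le> q \<Longrightarrow> f_K K p w \<le> f_K K q w"
  using f_K_strict_mono[of w p q] by (cases "p = q") auto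

end

section \<open>Waves\<close>

lemma mass_flux_iff: "vol K p > 0 \<Longrightarrow> mass_flux K W (p, u) = Z \<longleftrightarrow> u = W - Z * vol K p"
  by (auto simp: mass_flux_def density_def field_simps)

text \<open>The velocities relative to the discontinuity are \<open>- Z * vol\<close>. By the
  momentum balance the jump of their squares is, up to sign, the pressure jump times the sum of the
  volumes, so the kinetic energy becomes the trapezoidal term of \<open>h\<close>.\<close>

lemma energy_jump_eq:
  assumes "u\<^sub>l = W - Z * vol K\<^sub>l p\<^sub>l" "u\<^sub>r = W - Z * vol K\<^sub>r p\<^sub>r"
    and "p\<^sub>r - p\<^sub>l + Z\<^sup>2 * (vol K\<^sub>r p\<^sub>r - vol K\<^sub>l p\<^sub>l) = 0"
  shows "energy_jump K\<^sub>l (p\<^sub>l, u\<^sub>l) K\<^sub>r (p\<^sub>r, u\<^sub>r) W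
    = gib K\<^sub>r p\<^sub>r - gib K\<^sub>l p\<^sub>l - (p\<^sub>r - p\<^sub>l) * (vol K\<^sub>r p\<^sub>r + vol K\<^sub>l p\<^sub>l) / 2"
proof -
  have p: "p\<^sub>r - p\<^sub>l = - (Z\<^sup>2 * (vol K\<^sub>r p\<^sub>r - vol K\<^sub>l p\<^sub>l))" using assms(3) by linarith
  have "(p\<^sub>r - p\<^sub>l) * (vol K\<^sub>r p\<^sub>r + vol K\<^sub>l p\<^sub>l) = (Z * vol K\<^sub>l p\<^sub>l)\<^sup>2 - (Z * vol K\<^sub>r p\<^sub>r)\<^sup>2"
    unfolding p by (simp add: power2_eq_square algebra_simps)
  thus ?thesis
    unfolding energy_jump_def assms(1,2) by (simp add: diff_divide_distrib)
qed

text \<open>Naming the flux \<open>Z\<close> eliminates the velocities from momentum and entropy,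
  leaving relations between pressures and volumes. The same form serves shocks and the phase
  boundary.\<close>

lemma jump_conditions_iff:
  assumes "vol K\<^sub>l p\<^sub>l > 0" "vol K\<^sub>r p\<^sub>r > 0" "mass_flux K\<^sub>l W (p\<^sub>l, u\<^sub>l) = Z"
  shows "jump_conditions K\<^sub>l (p\<^sub>l, u\<^sub>l) K\<^sub>r (p\<^sub>r, u\<^sub>r) W \<longleftrightarrow>
    u\<^sub>r = W - Z * vol K\<^sub>r p\<^sub>r
    \<and> p\<^sub>r - p\<^sub>l + Z\<^sup>2 * (vol K\<^sub>r p\<^sub>r - vol K\<^sub>l p\<^sub>l) = 0
    \<and> Z * (gib K\<^sub>r p\<^sub>r - gib K\<^sub>l p\<^sub>l - (p\<^sub>r - p\<^sub>l) * (vol K\<^sub>r p\<^sub>r + vol K\<^sub>l p\<^sub>l) / 2) \<ge> 0"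
proof -
  have l: "u\<^sub>l = W - Z * vol K\<^sub>l p\<^sub>l" using mass_flux_iff assms by blast
  have "- Z * (u\<^sub>r - u\<^sub>l) + (p\<^sub>r - p\<^sub>l) = p\<^sub>r - p\<^sub>l + Z\<^sup>2 * (vol K\<^sub>r p\<^sub>r - vol K\<^sub>l p\<^sub>l)"
    if "u\<^sub>r = W - Z * vol K\<^sub>r p\<^sub>r"
    unfolding that l by (simp add: power2_eq_square algebra_simps)
  thus ?thesis
    unfolding jump_conditions_def assms(3) fst_conv snd_conv
    using mass_flux_iff[OF assms(2), of W u\<^sub>r Z] energy_jump_eq[OF l] by metis
qed

context half_line_phase
begin

text \<open>The sign of \<open>Z\<close> in the entropy condition selects compressive shocks because the isotherm
  is strictly convex (\<open>gib_below_trapezoid\<close>).\<close>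

lemma shockD:
  assumes s: "shock K e (p\<^sub>l, u\<^sub>l) (p\<^sub>r, u\<^sub>r) s" and e: "e = 1 \<or> e = -1"
    and r: "p\<^sub>l \<in> prange K" "p\<^sub>r \<in> prange K"
  defines "Z \<equiv> mass_flux K s (p\<^sub>l, u\<^sub>l)"
  shows "e * (p\<^sub>l - p\<^sub>r) > 0" and "Z = e * sqrt ((p\<^sub>l - p\<^sub>r) / (vol K p\<^sub>r - vol K p\<^sub>l))"
    and "u\<^sub>r - u\<^sub>l = - sqrt ((p\<^sub>l - p\<^sub>r) * (vol K p\<^sub>r - vol K p\<^sub>l))"
    and "u\<^sub>l = s - Z * vol K p\<^sub>l" and "u\<^sub>r = s - Z * vol K p\<^sub>r"
proof -
  let ?v = "vol K p\<^sub>r - vol K p\<^sub>l" and ?w = "vol K p\<^sub>r + vol K p\<^sub>l"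
  note pos = vol_pos[OF r(1)] vol_pos[OF r(2)]
  have flux: "mass_flux K s (p\<^sub>l, u\<^sub>l) = Z" by (simp add: Z_def)
  show ul: "u\<^sub>l = s - Z * vol K p\<^sub>l"
    using flux mass_flux_iff[OF pos(1)] by blast
  have j: "u\<^sub>r = s - Z * vol K p\<^sub>r" "p\<^sub>r - p\<^sub>l + Z\<^sup>2 * ?v = 0"
    "Z * (gib K p\<^sub>r - gib K p\<^sub>l - (p\<^sub>r - p\<^sub>l) * ?w / 2) \<ge> 0"
    using s jump_conditions_iff[OF pos flux] unfolding shock_def by auto
  show ur: "u\<^sub>r = s - Z * vol K p\<^sub>r" by (fact j)
  have eZ: "e * Z > 0" and ne: "(p\<^sub>l, u\<^sub>l) \<noteq> (p\<^sub>r, u\<^sub>r)"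
    using s by (auto simp: shock_def Z_def)
  have "p\<^sub>l \<noteq> p\<^sub>r" using ne ul ur by auto
  hence sgn: "e * (p\<^sub>l - p\<^sub>r) > 0 \<and> e * ?v > 0"
  proof (rule linorder_neqE_linordered_idom)
    assume lt: "p\<^sub>l < p\<^sub>r"
    have "gib K p\<^sub>r - gib K p\<^sub>l - (p\<^sub>r - p\<^sub>l) * ?w / 2 < 0"
      using gib_below_trapezoid[OF r(1) lt] by (simp add: add.commute)
    hence "Z \<le> 0" using j(3) by (simp add: zero_le_mult_iff)
    hence "e = -1" using e eZ by auto
    thus ?thesis using lt vol_strict_antimono[OF r(1) lt] by simp
  next
    assume lt: "p\<^sub>r < p\<^sub>l"
    have "gib K p\<^sub>r - gib K p\<^sub>l - (p\<^sub>r - p\<^sub>l) * ?w / 2 > 0"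
      using gib_below_trapezoid[OF r(2) lt] by (simp add: algebra_simps diff_divide_distrib add_divide_distrib)
    hence "Z \<ge> 0" using j(3) by (simp add: zero_le_mult_iff)
    hence "e = 1" using e eZ by auto
    thus ?thesis using lt vol_strict_antimono[OF r(2) lt] by simp
  qed
  thus "e * (p\<^sub>l - p\<^sub>r) > 0" ..
  have v0: "?v \<noteq> 0" using sgn by auto
  have pZ: "p\<^sub>l - p\<^sub>r = Z\<^sup>2 * ?v" using j(2) by linarith
  have "(p\<^sub>l - p\<^sub>r) / ?v = Z\<^sup>2" using v0 by (simp add: pZ)
  thus "Z = e * sqrt ((p\<^sub>l - p\<^sub>r) / ?v)" using e eZ by auto
  have "(p\<^sub>l - p\<^sub>r) * ?v = (Z * ?v)\<^sup>2" by (simp add: pZ power2_eq_square)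
  moreover have "Z * ?v > 0" using e eZ sgn by (auto simp: mult_neg_neg)
  ultimately have "sqrt ((p\<^sub>l - p\<^sub>r) * ?v) = Z * ?v" by simp
  thus "u\<^sub>r - u\<^sub>l = - sqrt ((p\<^sub>l - p\<^sub>r) * ?v)"
    unfolding ul ur by (simp add: algebra_simps)
qed

lemma shockI:
  assumes e: "e = 1 \<or> e = -1" and r: "p\<^sub>l \<in> prange K" "p\<^sub>r \<in> prange K"
    and c: "e * (p\<^sub>l - p\<^sub>r) > 0"
    and u: "u\<^sub>r - u\<^sub>l = - sqrt ((p\<^sub>l - p\<^sub>r) * (vol K p\<^sub>r - vol K p\<^sub>l))"
  defines "Z \<equiv> e * sqrt ((p\<^sub>l - p\<^sub>r) / (vol K p\<^sub>r - vol K p\<^sub>l))"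
  shows "shock K e (p\<^sub>l, u\<^sub>l) (p\<^sub>r, u\<^sub>r) (u\<^sub>l + Z * vol K p\<^sub>l)"
    and "u\<^sub>l + Z * vol K p\<^sub>l = u\<^sub>r + Z * vol K p\<^sub>r"
proof -
  let ?v = "vol K p\<^sub>r - vol K p\<^sub>l" and ?w = "vol K p\<^sub>r + vol K p\<^sub>l"
  note pos = vol_pos[OF r(1)] vol_pos[OF r(2)]
  have sgn: "e * ?v > 0" "e * (gib K p\<^sub>r - gib K p\<^sub>l - (p\<^sub>r - p\<^sub>l) * ?w / 2) > 0"
    using e c vol_strict_antimono[OF r(1), of p\<^sub>r] vol_strict_antimono[OF r(2), of p\<^sub>l]
      gib_below_trapezoid[OF r(1), of p\<^sub>r] gib_below_trapezoid[OF r(2), of p\<^sub>l]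
    by (auto simp: algebra_simps diff_divide_distrib add_divide_distrib)
  have q: "(p\<^sub>l - p\<^sub>r) / ?v > 0"
    using e c sgn(1) by (auto simp: zero_less_divide_iff)
  have eZ: "e * Z > 0" using e q by (auto simp: Z_def)
  have Z2: "Z\<^sup>2 = (p\<^sub>l - p\<^sub>r) / ?v" using e q by (auto simp: Z_def)
  hence pZ: "p\<^sub>l - p\<^sub>r = Z\<^sup>2 * ?v" using sgn(1) by auto
  have "(p\<^sub>l - p\<^sub>r) * ?v = (Z * ?v)\<^sup>2" by (simp add: pZ power2_eq_square)
  moreover have "Z * ?v > 0" using e eZ sgn(1) by (auto simp: mult_neg_neg)
  ultimately have "sqrt ((p\<^sub>l - p\<^sub>r) * ?v) = Z * ?v" by simp
  thus ur: "u\<^sub>l + Z * vol K p\<^sub>l = u\<^sub>r + Z * vol K p\<^sub>r"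
    using u by (simp add: algebra_simps)
  let ?s = "u\<^sub>l + Z * vol K p\<^sub>l"
  have flux: "mass_flux K ?s (p\<^sub>l, u\<^sub>l) = Z"
    unfolding mass_flux_iff[OF pos(1)] by simp
  have "Z * (gib K p\<^sub>r - gib K p\<^sub>l - (p\<^sub>r - p\<^sub>l) * ?w / 2) \<ge> 0"
    using e eZ sgn(2) by (auto simp: zero_le_mult_iff)
  hence "jump_conditions K (p\<^sub>l, u\<^sub>l) K (p\<^sub>r, u\<^sub>r) ?s"
    unfolding jump_conditions_iff[OF pos flux] using ur pZ by simp
  moreover have "p\<^sub>l \<noteq> p\<^sub>r" using c by auto
  ultimately show "shock K e (p\<^sub>l, u\<^sub>l) (p\<^sub>r, u\<^sub>r) ?s"
    unfolding shock_def flux using eZ by simp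
qed

text \<open>\<open>u - e * rinv K p\<close> is the Riemann invariant of a wave of family \<open>e\<close>. At \<open>\<xi> = 0\<close> the
  time derivative in \<open>euler_at\<close> carries no information on the profile; this exceptional point is
  harmless because the profile is continuous.\<close>

lemma euler_profile:
  assumes E: "euler_at (\<lambda>t x. density K (fst (w (x / t)))) (\<lambda>t x. snd (w (x / t)))
      (\<lambda>t x. fst (w (x / t))) 1 \<xi>"
    and \<xi>: "\<xi> \<noteq> 0" "a < \<xi>" "\<xi> < b"
    and r: "\<And>x. x \<in> {a..b} \<Longrightarrow> fst (w x) \<in> prange K"
    and fam: "\<xi> = snd (w \<xi>) + e * cs K (fst (w \<xi>))" and e: "e = 1 \<or> e = -1"
  shows "((\<lambda>x. snd (w x) - e * rinv K (fst (w x))) has_real_derivative 0) (at \<xi> within {a..b})"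
proof -
  define R U P where "R = (\<lambda>x. density K (fst (w x)))" and "U = (\<lambda>x. snd (w x))"
    and "P = (\<lambda>x. fst (w x))"
  have \<xi>ab: "\<xi> \<in> {a..b}" using \<xi> by simp
  have pos: "vol K (P \<xi>) > 0" "cs K (P \<xi>) > 0"
    using r[OF \<xi>ab] vol_pos cs_pos by (auto simp: P_def)
  have Rpos: "R x > 0" if "x \<in> {a..b}" for x
    using vol_pos[OF r[OF that]] by (simp add: R_def density_def)
  obtain rt mx mt fx where
    rt: "((\<lambda>s. R (\<xi> / s)) has_real_derivative rt) (at 1)" and
    mx: "((\<lambda>y. R y * U y) has_real_derivative mx) (at \<xi>)" and
    mt: "((\<lambda>s. R (\<xi> / s) * U (\<xi> / s)) has_real_derivative mt) (at 1)" and
    fx: "((\<lambda>y. R y * (U y)\<^sup>2 + P y) has_real_derivative fx) (at \<xi>)" and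
    eq: "rt + mx = 0" "mt + fx = 0"
    using E unfolding euler_at_def R_def U_def P_def by auto
  have near: "\<forall>\<^sub>F y in nhds \<xi>. y \<in> {a<..<b} \<and> y \<noteq> 0"
    using \<xi> by (intro eventually_conj eventually_nhds_in_open t1_space_nhds) auto
  have inv: "((\<lambda>y. \<xi> / y) has_real_derivative - 1 / \<xi>) (at \<xi>)"
    by (rule DERIV_cong[OF DERIV_divide[OF DERIV_const DERIV_ident]])
      (use \<xi>(1) in \<open>auto simp: power2_eq_square\<close>)
  \<comment> \<open>\<open>euler_at\<close> provides a derivative of the density in time only.
    Substituting \<open>s = \<xi> / y\<close> at time 1 turns it into a derivative of the
    profile.\<close>
  have dR: "(R has_real_derivative rt * (- 1 / \<xi>)) (at \<xi>)"
  proof -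
    have "((\<lambda>y. R (\<xi> / (\<xi> / y))) has_real_derivative rt * (- 1 / \<xi>)) (at \<xi>)"
      by (rule DERIV_chain2[OF _ inv]) (use rt \<xi>(1) in simp)
    moreover have ev: "\<forall>\<^sub>F y in nhds \<xi>. R (\<xi> / (\<xi> / y)) = R y"
      using near by eventually_elim (use \<xi>(1) in simp)
    ultimately show ?thesis unfolding DERIV_cong_ev[OF refl ev refl] by blast
  qed
  define r' where "r' = rt * (- 1 / \<xi>)"
  have R\<xi>: "R \<xi> > 0" using Rpos[OF \<xi>ab] .
  \<comment> \<open>The velocity is differentiable as momentum divided by density; further down the
    pressure is differentiable as momentum flux minus \<open>R * U\<^sup>2\<close>.\<close>
  define u' where "u' = (mx * R \<xi> - R \<xi> * U \<xi> * r') / (R \<xi> * R \<xi>)"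
  have dU: "(U has_real_derivative u') (at \<xi>)"
  proof -
    have "((\<lambda>y. R y * U y / R y) has_real_derivative u') (at \<xi>)"
      unfolding u'_def r'_def using R\<xi> by (intro DERIV_divide mx dR) simp
    moreover have ev: "\<forall>\<^sub>F y in nhds \<xi>. R y * U y / R y = U y"
      using near
    proof eventually_elim
      case (elim y)
      hence "R y > 0" by (intro Rpos) simp
      thus ?case by simp
    qed
    ultimately show ?thesis unfolding DERIV_cong_ev[OF refl ev refl] by blast
  qed
  have m: "mx = r' * U \<xi> + u' * R \<xi>"
    using DERIV_unique[OF mx DERIV_mult[OF dR dU]] by (simp add: r'_def)
  have "((\<lambda>s. \<xi> / s) has_real_derivative - \<xi>) (at 1)"
    by (rule DERIV_cong[OF DERIV_divide[OF DERIV_const DERIV_ident]]) auto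
  note ds = this
  have rt': "((\<lambda>s. R (\<xi> / s)) has_real_derivative r' * (- \<xi>)) (at 1)"
    by (rule DERIV_chain2[OF _ ds]) (use dR in \<open>simp add: r'_def\<close>)
  have ut': "((\<lambda>s. U (\<xi> / s)) has_real_derivative u' * (- \<xi>)) (at 1)"
    by (rule DERIV_chain2[OF _ ds]) (use dU in simp)
  have mass: "(U \<xi> - \<xi>) * r' + R \<xi> * u' = 0"
    using eq(1) DERIV_unique[OF rt rt'] by (simp add: m algebra_simps)
  have mt': "mt = - \<xi> * (r' * U \<xi> + u' * R \<xi>)"
    using DERIV_unique[OF mt DERIV_mult[OF rt' ut']] by (simp add: algebra_simps)
  define p' where "p' = fx - (r' * (U \<xi>)\<^sup>2 + 2 * U \<xi> * u' * R \<xi>)"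
  have dP: "(P has_real_derivative p') (at \<xi>)"
  proof -
    have "((\<lambda>y. R y * (U y)\<^sup>2) has_real_derivative r' * (U \<xi>)\<^sup>2 + 2 * U \<xi> * u' * R \<xi>) (at \<xi>)"
      by (rule DERIV_cong[OF DERIV_mult[OF dR DERIV_power[OF dU]]]) (simp add: r'_def)
    from DERIV_diff[OF fx this] show ?thesis by (simp add: p'_def)
  qed
  have "p' = - R \<xi> * (U \<xi> - \<xi>) * u'"
  proof -
    have "fx = \<xi> * (r' * U \<xi> + u' * R \<xi>)" using eq(2) mt' by simp
    hence "p' + R \<xi> * (U \<xi> - \<xi>) * u' = - U \<xi> * ((U \<xi> - \<xi>) * r' + R \<xi> * u')"
      unfolding p'_def by (simp add: power2_eq_square algebra_simps)
    thus ?thesis using mass by simp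
  qed
  moreover have "U \<xi> - \<xi> = - (e * cs K (P \<xi>))" using fam by (simp add: U_def P_def)
  moreover have "R \<xi> = 1 / vol K (P \<xi>)" by (simp add: R_def P_def density_def)
  \<comment> \<open>The two conservation laws combine to a relation between \<open>p'\<close> and
    \<open>u'\<close>, in which the family condition replaces \<open>U \<xi> - \<xi>\<close> by the
    signed sound speed.\<close>
  ultimately have p': "p' = e * impedance K (P \<xi>) * u'"
    by (simp add: impedance_def)
  have dP': "(P has_real_derivative p') (at \<xi> within {a..b})"
    by (rule has_field_derivative_at_within[OF dP])
  have "P ` {a..b} \<subseteq> prange K" using r by (auto simp: P_def)
  hence "(rinv K has_real_derivative 1 / impedance K (P \<xi>)) (at (P \<xi>) within P ` {a..b})"
    using DERIV_subset[OF rinv_deriv_within] r[OF \<xi>ab] by (simp add: P_def)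
  from DERIV_diff[OF has_field_derivative_at_within[OF dU]
      DERIV_cmult[OF DERIV_image_chain[OF this dP'], of e]]
  have "((\<lambda>x. U x - e * rinv K (P x)) has_real_derivative
      u' - e * (1 / impedance K (P \<xi>) * p')) (at \<xi> within {a..b})"
    by simp
  moreover have "u' - e * (1 / impedance K (P \<xi>) * p') = 0"
    using e pos by (auto simp: p' impedance_def)
  ultimately show ?thesis by (simp add: U_def P_def)
qed

text \<open>The Riemann invariant is constant across the fan, which gives the velocity jump; the
  order of the edge speeds then decides the sign of the pressure change through
  \<open>rinv_plus_cs_strict_mono\<close>.\<close>

lemma rarefactionD:
  assumes rf: "rarefaction K e (p\<^sub>l, u\<^sub>l) (p\<^sub>r, u\<^sub>r) s\<^sub>1 s\<^sub>2 w" and e: "e = 1 \<or> e = -1"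
    and r: "\<And>\<xi>. \<xi> \<in> {s\<^sub>1..s\<^sub>2} \<Longrightarrow> fst (w \<xi>) \<in> prange K"
  shows "e * (p\<^sub>r - p\<^sub>l) \<ge> 0" and "u\<^sub>r - u\<^sub>l = e * (rinv K p\<^sub>r - rinv K p\<^sub>l)"
    and "s\<^sub>1 = u\<^sub>l + e * cs K p\<^sub>l" and "s\<^sub>2 = u\<^sub>r + e * cs K p\<^sub>r"
proof -
  have s: "s\<^sub>1 \<le> s\<^sub>2" and w: "w s\<^sub>1 = (p\<^sub>l, u\<^sub>l)" "w s\<^sub>2 = (p\<^sub>r, u\<^sub>r)"
    and cw: "continuous_on {s\<^sub>1..s\<^sub>2} w"
    and fam: "\<And>\<xi>. \<xi> \<in> {s\<^sub>1..s\<^sub>2} \<Longrightarrow> \<xi> = snd (w \<xi>) + e * cs K (fst (w \<xi>))"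
    and E: "\<And>t x. t > 0 \<Longrightarrow> s\<^sub>1 < x / t \<Longrightarrow> x / t < s\<^sub>2 \<Longrightarrow>
      euler_at (\<lambda>t x. density K (fst (w (x / t)))) (\<lambda>t x. snd (w (x / t)))
        (\<lambda>t x. fst (w (x / t))) t x"
    using rf unfolding rarefaction_def by auto
  show s1: "s\<^sub>1 = u\<^sub>l + e * cs K p\<^sub>l" and s2: "s\<^sub>2 = u\<^sub>r + e * cs K p\<^sub>r"
    using fam[of s\<^sub>1] fam[of s\<^sub>2] s w by auto
  have pr: "p\<^sub>l \<in> prange K" "p\<^sub>r \<in> prange K"
    using r[of s\<^sub>1] r[of s\<^sub>2] s w by auto
  let ?I = "\<lambda>x. snd (w x) - e * rinv K (fst (w x))"
  have "?I s\<^sub>2 = ?I s\<^sub>1"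
  \<comment> \<open>At the edges \<open>euler_at\<close> is not demanded, and 0 is the exceptional
    point of \<open>euler_profile\<close>; continuity bridges this finite set.\<close>
  proof (rule has_derivative_zero_unique_strong_interval[of "{s\<^sub>1, s\<^sub>2, 0}" s\<^sub>1 s\<^sub>2 ?I])
    show "continuous_on {s\<^sub>1..s\<^sub>2} ?I"
      by (intro continuous_intros cw continuous_on_compose2[OF continuous_rinv]) (use r in auto)
    fix x assume x: "x \<in> {s\<^sub>1..s\<^sub>2} - {s\<^sub>1, s\<^sub>2, 0}"
    hence "(?I has_real_derivative 0) (at x within {s\<^sub>1..s\<^sub>2})"
      by (intro euler_profile E) (use e r fam in auto)
    thus "(?I has_derivative (\<lambda>h. 0)) (at x within {s\<^sub>1..s\<^sub>2})"
      by (simp add: has_field_derivative_def lambda_zero)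
  qed (use s in auto)
  thus u: "u\<^sub>r - u\<^sub>l = e * (rinv K p\<^sub>r - rinv K p\<^sub>l)"
    using w by (simp add: algebra_simps)
  have "e * ((rinv K p\<^sub>r + cs K p\<^sub>r) - (rinv K p\<^sub>l + cs K p\<^sub>l)) \<ge> 0"
    using s s1 s2 u by (simp add: algebra_simps)
  thus "e * (p\<^sub>r - p\<^sub>l) \<ge> 0"
    using e rinv_plus_cs_strict_mono[OF pr(1), of p\<^sub>r] rinv_plus_cs_strict_mono[OF pr(2), of p\<^sub>l]
    by (cases p\<^sub>l p\<^sub>r rule: linorder_cases) auto
qed

section \<open>Construction of rarefaction waves\<close>

text \<open>Self-similarity reduces both equations to relations between derivatives in
  \<open>x / t\<close>; \<open>momentum\<close> is what remains of the second one after subtracting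
  \<open>U\<close> times the first.\<close>

lemma euler_atI:
  assumes "t > 0"
    and R: "(R has_real_derivative r') (at (x / t))"
    and U: "(U has_real_derivative u') (at (x / t))"
    and P: "(P has_real_derivative p') (at (x / t))"
    and mass: "(U (x / t) - x / t) * r' + R (x / t) * u' = 0"
    and momentum: "R (x / t) * (U (x / t) - x / t) * u' + p' = 0"
  shows "euler_at (\<lambda>t x. R (x / t)) (\<lambda>t x. U (x / t)) (\<lambda>t x. P (x / t)) t x"
proof -
  let ?\<xi> = "x / t"
  have ds: "((\<lambda>s. x / s) has_real_derivative - ?\<xi> / t) (at t)"
    by (rule DERIV_cong[OF DERIV_divide[OF DERIV_const DERIV_ident]])
      (use \<open>t > 0\<close> in \<open>auto simp: field_simps\<close>)
  have dy: "((\<lambda>y. y / t) has_real_derivative 1 / t) (at x)"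
    by (rule DERIV_cdivide[OF DERIV_ident])
  note Rt = DERIV_chain2[OF R ds] and Ut = DERIV_chain2[OF U ds]
  note Rx = DERIV_chain2[OF R dy] and Ux = DERIV_chain2[OF U dy] and Px = DERIV_chain2[OF P dy]
  have mx: "((\<lambda>y. R (y / t) * U (y / t)) has_real_derivative (r' * U ?\<xi> + u' * R ?\<xi>) / t) (at x)"
    by (rule DERIV_cong[OF DERIV_mult[OF Rx Ux]]) (simp add: add_divide_distrib)
  have mt: "((\<lambda>s. R (x / s) * U (x / s)) has_real_derivative - ?\<xi> * (r' * U ?\<xi> + u' * R ?\<xi>) / t) (at t)"
    by (rule DERIV_cong[OF DERIV_mult[OF Rt Ut]]) (simp add: algebra_simps add_divide_distrib diff_divide_distrib)
  have fx: "((\<lambda>y. R (y / t) * (U (y / t))\<^sup>2 + P (y / t)) has_real_derivative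
      (r' * (U ?\<xi>)\<^sup>2 + 2 * R ?\<xi> * U ?\<xi> * u' + p') / t) (at x)"
    by (rule DERIV_cong[OF DERIV_add[OF DERIV_mult[OF Rx DERIV_power[OF Ux]] Px]])
      (simp add: add_divide_distrib algebra_simps)
  have "r' * (- ?\<xi> / t) + (r' * U ?\<xi> + u' * R ?\<xi>) / t = 0"
    using mass \<open>t > 0\<close> by (simp add: field_simps)
  moreover have "- ?\<xi> * (r' * U ?\<xi> + u' * R ?\<xi>) / t
      + (r' * (U ?\<xi>)\<^sup>2 + 2 * R ?\<xi> * U ?\<xi> * u' + p') / t = 0"
  proof -
    have "- ?\<xi> * (r' * U ?\<xi> + u' * R ?\<xi>) + (r' * (U ?\<xi>)\<^sup>2 + 2 * R ?\<xi> * U ?\<xi> * u' + p')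
      = U ?\<xi> * ((U ?\<xi> - ?\<xi>) * r' + R ?\<xi> * u') + (R ?\<xi> * (U ?\<xi> - ?\<xi>) * u' + p')"
      by (simp add: power2_eq_square algebra_simps)
    also have "\<dots> = 0" using mass momentum by simp
    finally show ?thesis by (simp add: add_divide_distrib[symmetric])
  qed
  ultimately show ?thesis
    unfolding euler_at_def using Rt mx mt fx by blast
qed

text \<open>A constant Riemann invariant together with \<open>\<xi> = u + e * a\<close> makes
  \<open>rinv + cs\<close> an affine function of \<xi>. Inverting this strictly increasing function
  of the pressure yields the profile.\<close>

lemma rarefactionI:
  assumes e: "e = 1 \<or> e = -1" and pr: "p\<^sub>l \<in> prange K" "p\<^sub>r \<in> prange K"
    and c: "e * (p\<^sub>r - p\<^sub>l) \<ge> 0" and u: "u\<^sub>r - u\<^sub>l = e * (rinv K p\<^sub>r - rinv K p\<^sub>l)"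
  obtains w where
    "rarefaction K e (p\<^sub>l, u\<^sub>l) (p\<^sub>r, u\<^sub>r) (u\<^sub>l + e * cs K p\<^sub>l) (u\<^sub>r + e * cs K p\<^sub>r) w"
    and "\<And>\<xi>. \<xi> \<in> {u\<^sub>l + e * cs K p\<^sub>l..u\<^sub>r + e * cs K p\<^sub>r} \<Longrightarrow>
      fst (w \<xi>) \<in> {min p\<^sub>l p\<^sub>r..max p\<^sub>l p\<^sub>r}"
proof -
  define lo hi where "lo = min p\<^sub>l p\<^sub>r" and "hi = max p\<^sub>l p\<^sub>r"
  have lohi: "lo \<le> hi" "lo \<in> prange K" using pr by (auto simp: lo_def hi_def min_def)
  have sub: "{lo..hi} \<subseteq> prange K" by (rule segment_in_range[OF lohi(2)])
  define Q where "Q = (\<lambda>p. rinv K p + cs K p)"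
  define G where "G = inv_into {lo..hi} Q"
  define s\<^sub>1 s\<^sub>2 where "s\<^sub>1 = u\<^sub>l + e * cs K p\<^sub>l" and "s\<^sub>2 = u\<^sub>r + e * cs K p\<^sub>r"
  have Qmono: "Q p < Q q" if "p \<in> prange K" "p < q" for p q
    using rinv_plus_cs_strict_mono[OF that] by (simp add: Q_def)
  have Qinj: "inj_on Q {lo..hi}"
  proof (rule strict_mono_on_imp_inj_on, rule strict_mono_onI)
    fix p q assume "p \<in> {lo..hi}" "p < q"
    thus "Q p < Q q" using Qmono[of p q] sub by blast
  qed
  have Qcont: "continuous_on {lo..hi} Q"
    unfolding Q_def
    by (intro continuous_intros continuous_on_subset[OF continuous_rinv sub]
        continuous_on_subset[OF continuous_cs sub])
  have Qimg: "{Q lo..Q hi} \<subseteq> Q ` {lo..hi}"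
  proof
    fix y assume "y \<in> {Q lo..Q hi}"
    hence "\<exists>x\<ge>lo. x \<le> hi \<and> Q x = y" by (intro IVT' lohi Qcont) simp_all
    thus "y \<in> Q ` {lo..hi}" by fastforce
  qed
  have GQ: "G (Q p) = p" if "p \<in> {lo..hi}" for p
    unfolding G_def by (rule inv_into_f_f[OF Qinj that])
  have QG: "Q (G y) = y" "G y \<in> {lo..hi}" if "y \<in> {Q lo..Q hi}" for y
  proof -
    have "y \<in> Q ` {lo..hi}" using Qimg that by blast
    thus "Q (G y) = y" "G y \<in> {lo..hi}"
      unfolding G_def by (rule f_inv_into_f, rule inv_into_into)
  qed
  have Gcont: "continuous_on {Q lo..Q hi} G"
    by (rule continuous_on_subset[OF continuous_on_inv[OF Qcont compact_Icc] Qimg]) (use GQ in blast)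
  define y where "y = (\<lambda>\<xi>. Q p\<^sub>l + e * (\<xi> - s\<^sub>1))"
  define P where "P = (\<lambda>\<xi>. G (y \<xi>))"
  define U where "U = (\<lambda>\<xi>. u\<^sub>l + e * (rinv K (P \<xi>) - rinv K p\<^sub>l))"
  have y1: "y s\<^sub>1 = Q p\<^sub>l" by (simp add: y_def)
  have y2: "y s\<^sub>2 = Q p\<^sub>r"
    using e u by (auto simp: y_def s\<^sub>1_def s\<^sub>2_def Q_def algebra_simps)
  have s12: "s\<^sub>1 \<le> s\<^sub>2"
  proof -
    have "e * (Q p\<^sub>r - Q p\<^sub>l) \<ge> 0"
      using e c Qmono[OF pr(1), of p\<^sub>r] Qmono[OF pr(2), of p\<^sub>l]
      by (cases p\<^sub>l p\<^sub>r rule: linorder_cases) auto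
    thus ?thesis using y2 e by (auto simp: y_def algebra_simps)
  qed
  have ends: "lo = p\<^sub>l \<and> hi = p\<^sub>r \<and> e = 1 \<or> lo = p\<^sub>r \<and> hi = p\<^sub>l \<and> e = -1"
    using e c by (auto simp: lo_def hi_def)
  have yin: "y \<xi> \<in> {Q lo..Q hi}" if "\<xi> \<in> {s\<^sub>1..s\<^sub>2}" for \<xi>
    using that ends y1 y2 by (auto simp: y_def)
  have yin': "y \<xi> \<in> {Q lo<..<Q hi}" if "s\<^sub>1 < \<xi>" "\<xi> < s\<^sub>2" for \<xi>
    using that ends y1 y2 by (auto simp: y_def)
  have fam: "\<xi> = U \<xi> + e * cs K (P \<xi>)" if "\<xi> \<in> {s\<^sub>1..s\<^sub>2}" for \<xi>
  proof -
    have "rinv K (P \<xi>) + cs K (P \<xi>) = rinv K p\<^sub>l + cs K p\<^sub>l + e * (\<xi> - s\<^sub>1)"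
      using QG(1)[OF yin[OF that]] by (simp add: P_def Q_def y_def)
    hence "cs K (P \<xi>) = rinv K p\<^sub>l + cs K p\<^sub>l + e * (\<xi> - s\<^sub>1) - rinv K (P \<xi>)" by linarith
    thus ?thesis using e by (auto simp: U_def s\<^sub>1_def algebra_simps)
  qed
  have cont: "continuous_on {s\<^sub>1..s\<^sub>2} P"
    unfolding P_def
    by (rule continuous_on_compose2[OF Gcont]) (use yin in \<open>auto simp: y_def intro!: continuous_intros\<close>)
  have Prange: "P \<xi> \<in> {lo..hi}" if "\<xi> \<in> {s\<^sub>1..s\<^sub>2}" for \<xi>
    using QG(2)[OF yin[OF that]] by (simp add: P_def)
  have "rarefaction K e (p\<^sub>l, u\<^sub>l) (p\<^sub>r, u\<^sub>r) s\<^sub>1 s\<^sub>2 (\<lambda>\<xi>. (P \<xi>, U \<xi>))"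
    unfolding rarefaction_def fst_conv snd_conv
  proof (intro conjI ballI allI impI)
    have P12: "P s\<^sub>1 = p\<^sub>l" "P s\<^sub>2 = p\<^sub>r"
      using ends lohi(1) by (auto simp: P_def y1 y2 intro!: GQ)
    thus "(P s\<^sub>1, U s\<^sub>1) = (p\<^sub>l, u\<^sub>l)" "(P s\<^sub>2, U s\<^sub>2) = (p\<^sub>r, u\<^sub>r)"
      using u by (auto simp: U_def)
    show "continuous_on {s\<^sub>1..s\<^sub>2} (\<lambda>\<xi>. (P \<xi>, U \<xi>))"
      unfolding U_def
      by (intro continuous_intros cont continuous_on_compose2[OF continuous_rinv cont])
        (use Prange sub in auto)
    fix t x :: real assume t: "t > 0" and x: "s\<^sub>1 < x / t \<and> x / t < s\<^sub>2"
    define \<xi> where "\<xi> = x / t"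
    have \<xi>: "\<xi> \<in> {s\<^sub>1..s\<^sub>2}" using x by (simp add: \<xi>_def)
    have Py: "lo < P \<xi>"
    proof -
      have "Q lo < Q (P \<xi>)" using yin'[of \<xi>] x QG(1)[OF yin[OF \<xi>]] by (simp add: P_def \<xi>_def)
      thus ?thesis using Prange[OF \<xi>] by (cases "lo = P \<xi>") auto
    qed
    have Pr: "P \<xi> \<in> prange K" using Prange[OF \<xi>] sub by blast
    note at_eq = at_within_range_right[OF lohi(2) Py]
    define i where "i = impedance K (P \<xi>)"
    have pos: "vol K (P \<xi>) > 0" "cs K (P \<xi>) > 0" "i > 0"
      using Pr vol_pos cs_pos impedance_pos by (auto simp: i_def)
    have dI: "(rinv K has_real_derivative 1 / i) (at (P \<xi>))"
      and dv: "(vol K has_real_derivative - 1 / i\<^sup>2) (at (P \<xi>))"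
      and dc: "(cs K has_real_derivative cs' (P \<xi>)) (at (P \<xi>))"
      using rinv_deriv_within[OF Pr] vol_deriv_within[OF Pr] cs_deriv_within[OF Pr]
      unfolding at_eq i_def by auto
    define q' where "q' = 1 / i + cs' (P \<xi>)"
    have q': "q' > 0" using cs'_bound[OF Pr] pos(3) by (simp add: q'_def i_def field_simps)
    have dG: "(G has_real_derivative inverse q') (at (y \<xi>))"
    proof (rule DERIV_inverse_function[where f = Q and a = "Q lo" and b = "Q hi"])
      show "(Q has_real_derivative q') (at (G (y \<xi>)))"
        using DERIV_add[OF dI dc] by (simp add: Q_def q'_def P_def)
      have "y \<xi> \<in> {Q lo<..<Q hi}" using yin'[of \<xi>] x by (simp add: \<xi>_def)
      thus "Q lo < y \<xi>" "y \<xi> < Q hi" "isCont G (y \<xi>)"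
        using continuous_on_interior[OF Gcont, of "y \<xi>"] by auto
    qed (use q' QG in auto)
    define p' where "p' = inverse q' * e"
    have dP: "(P has_real_derivative p') (at \<xi>)"
      unfolding P_def p'_def
    proof (rule DERIV_chain2[of G _ y, OF dG])
      show "(y has_real_derivative e) (at \<xi>)"
        unfolding y_def
        by (rule DERIV_cong[OF DERIV_add[OF DERIV_const DERIV_cmult[OF DERIV_diff[OF
            DERIV_ident DERIV_const]]]]) simp
    qed
    have dU: "(U has_real_derivative e * (p' / i)) (at \<xi>)"
      unfolding U_def
      by (rule DERIV_cong[OF DERIV_add[OF DERIV_const DERIV_cmult[OF DERIV_diff[OF
          DERIV_chain2[OF dI dP] DERIV_const]]]]) simp
    have dR: "((\<lambda>\<xi>. density K (P \<xi>)) has_real_derivative p' / (cs K (P \<xi>))\<^sup>2) (at \<xi>)"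
      unfolding density_def
      by (rule DERIV_cong[OF DERIV_divide[OF DERIV_const DERIV_chain2[OF dv dP]]])
        (use pos in \<open>auto simp: i_def impedance_def power2_eq_square\<close>)
    have f: "U \<xi> - \<xi> = - (e * cs K (P \<xi>))" using fam[OF \<xi>] by linarith
    have i': "i = cs K (P \<xi>) / vol K (P \<xi>)" by (simp add: i_def impedance_def)
    show "euler_at (\<lambda>t x. density K (P (x / t))) (\<lambda>t x. U (x / t)) (\<lambda>t x. P (x / t)) t x"
    proof (rule euler_atI[where R = "\<lambda>\<xi>. density K (P \<xi>)"])
      show "(U (x / t) - x / t) * (p' / (cs K (P \<xi>))\<^sup>2) + density K (P (x / t)) * (e * (p' / i)) = 0"
        "density K (P (x / t)) * (U (x / t) - x / t) * (e * (p' / i)) + p' = 0"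
        unfolding \<xi>_def[symmetric] f i' density_def
        using e pos by (auto simp: power2_eq_square)
    qed (use t dR dU dP in \<open>auto simp: \<xi>_def\<close>)
  qed (use s12 fam in auto)
  moreover have "fst (P \<xi>, U \<xi>) \<in> {min p\<^sub>l p\<^sub>r..max p\<^sub>l p\<^sub>r}" if "\<xi> \<in> {s\<^sub>1..s\<^sub>2}" for \<xi>
    using Prange[OF that] by (simp add: lo_def hi_def)
  ultimately show thesis
    by (intro that[of "\<lambda>\<xi>. (P \<xi>, U \<xi>)"]) (auto simp: s\<^sub>1_def s\<^sub>2_def)
qed

end

section \<open>The interface\<close>

sublocale two_phase_setting \<subseteq> V: half_line_phase "Vap M" + L: half_line_phase "Liq M"
  by unfold_locales (use prange_Vap prange_Liq pmin in auto)

context two_phase_setting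
begin

abbreviation "v\<^sub>V \<equiv> vol (Vap M)"
abbreviation "v\<^sub>L \<equiv> vol (Liq M)"
abbreviation "i\<^sub>V \<equiv> impedance (Vap M)"
abbreviation "i\<^sub>L \<equiv> impedance (Liq M)"
abbreviation "z \<equiv> zflux M"
abbreviation "\<phi> \<equiv> phi M"

text \<open>\<open>S p q\<close> is the mass flux that the kinetic relation prescribes for a trial liquid pressure
  \<open>q\<close>; \<open>interface_pressure\<close> also requires that it balances the jump of momentum.\<close>

definition S :: "real \<Rightarrow> real \<Rightarrow> real" where "S p q = p * h M p q"

definition dom :: "real set" where "dom = {0<..sigma_max M * psat M}"

lemma dom_pos: "p \<in> dom \<Longrightarrow> p > 0" by (simp add: dom_def)

lemma dom_range:
  assumes "p \<in> dom"
  shows "p \<in> prange (Vap M)" "p \<in> prange (Liq M)" "pmin M < p"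
  using assms pmin by (auto simp: dom_def prange_Vap prange_Liq)

lemma in_Liq: "q \<in> prange (Liq M) \<longleftrightarrow> pmin M \<le> q"
  by (simp add: prange_Liq)

lemma pos_in_Liq: "0 \<le> q \<Longrightarrow> q \<in> prange (Liq M)"
  using pmin by (simp add: prange_Liq)

lemma psat_in_dom: "psat M \<in> dom"
proof -
  have "sqrt 1 \<le> sqrt (11 - 6 * alpha M)"
    using alpha by (intro real_sqrt_le_mono) linarith
  hence "sigma_max M \<ge> 1" by (simp add: sigma_max_def)
  thus ?thesis using psat_pos by (simp add: dom_def)
qed

lemma dom_below: "p \<in> dom \<Longrightarrow> 0 < x \<Longrightarrow> x \<le> p \<Longrightarrow> x \<in> dom"
  by (simp add: dom_def)

section \<open>Inequalities drawn from the constitutive assumptions\<close>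

lemma v\<^sub>V_pos: "p > 0 \<Longrightarrow> v\<^sub>V p > 0" and v\<^sub>L_pos: "q \<in> prange (Liq M) \<Longrightarrow> v\<^sub>L q > 0"
  and i\<^sub>V_pos: "p > 0 \<Longrightarrow> i\<^sub>V p > 0" and i\<^sub>L_pos: "q \<in> prange (Liq M) \<Longrightarrow> i\<^sub>L q > 0"
  using V.vol_pos L.vol_pos V.impedance_pos L.impedance_pos by (auto simp: prange_Vap)

lemma v\<^sub>L_le:
  assumes "p \<in> dom" "q \<in> prange (Liq M)"
  shows "v\<^sub>L q \<le> alpha M * v\<^sub>V p"
  using vol_ratio[of p q] assms v\<^sub>V_pos[of p] by (auto simp: dom_def prange_Liq pos_divide_le_eq)

lemma v\<^sub>L_less:
  assumes "p \<in> dom" "q \<in> prange (Liq M)"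
  shows "v\<^sub>L q < v\<^sub>V p"
proof -
  have "alpha M * v\<^sub>V p < 1 * v\<^sub>V p"
    using alpha v\<^sub>V_pos dom_pos assms(1) by (intro mult_strict_right_mono) auto
  thus ?thesis using v\<^sub>L_le[OF assms] by simp
qed

lemma i\<^sub>V_le_i\<^sub>L:
  assumes "p \<in> dom" "q \<in> prange (Liq M)"
  shows "i\<^sub>V p \<le> i\<^sub>L q"
proof -
  have "i\<^sub>V p / i\<^sub>L q \<le> alpha M * beta M"
    using impedance_ratio[of p q] assms
    by (simp add: dom_def prange_Liq impedance_def mult.commute)
  hence "i\<^sub>V p / i\<^sub>L q \<le> 1" using beta(2) by linarith
  thus ?thesis using i\<^sub>L_pos[OF assms(2)] by simp
qed

text \<open>Both alternatives contain this bound, so evaluating at any positive liquid pressure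
  extracts it.\<close>

lemma gamma\<^sub>V_le: "p \<in> dom \<Longrightarrow> gamma (Vap M) p \<le> 1"
  using cond_I_or_II[of p 1] by (auto simp: dom_def cond_I_def cond_II_def)

lemma gamma\<^sub>V_eq: "p > 0 \<Longrightarrow> gamma (Vap M) p = (i\<^sub>V p)\<^sup>2 * v\<^sub>V p / p"
  using v\<^sub>V_pos[of p] by (simp add: gamma_def impedance_def field_simps power2_eq_square)

text \<open>The form in which \<open>gamma \<le> 1\<close> is used: it bounds the momentum exchanged
  by a subsonic flux and makes \<open>p * v\<^sub>V p\<close> nonincreasing.\<close>

lemma i\<^sub>V_v\<^sub>V_le: "p \<in> dom \<Longrightarrow> (i\<^sub>V p)\<^sup>2 * v\<^sub>V p \<le> p"
  using gamma\<^sub>V_le[of p] dom_pos[of p] by (simp add: gamma\<^sub>V_eq)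

text \<open>Since \<open>gamma (Liq M) q\<close> is unbounded for \<open>q\<close> near 0, \<open>cond_I\<close> must hold there, and its
  last inequality becomes \<open>eps M p \<le> - alpha M\<close> in the limit.\<close>

lemma eps_le:
  assumes "p \<in> dom"
  shows "eps M p \<le> - alpha M"
proof -
  have 0: "0 \<in> prange (Liq M)" by (simp add: pos_in_Liq)
  have "((\<lambda>q. q * v\<^sub>L q / (cs (Liq M) q)\<^sup>2) \<longlongrightarrow> 0 * v\<^sub>L 0 / (cs (Liq M) 0)\<^sup>2) (at 0 within prange (Liq M))"
    using L.continuous_vol L.continuous_cs L.cs_pos[OF 0] 0
    by (intro tendsto_intros) (auto simp: continuous_on)
  hence lim: "((\<lambda>q. q * v\<^sub>L q / (cs (Liq M) q)\<^sup>2) \<longlongrightarrow> 0) (at_right 0)"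
    by (intro tendsto_within_subset[where S = "prange (Liq M)" and T = "{0<..}"])
      (auto intro: pos_in_Liq)
  have "\<forall>\<^sub>F q in at_right 0. q * v\<^sub>L q / (cs (Liq M) q)\<^sup>2 < 1"
    using order_tendstoD(2)[OF lim zero_less_one] .
  moreover have "\<forall>\<^sub>F q::real in at_right 0. q > 0"
    by (simp add: eventually_at_filter)
  ultimately have "\<forall>\<^sub>F q in at_right 0. 1 + eps M p / alpha M \<le> q * v\<^sub>L q / (cs (Liq M) q)\<^sup>2"
  proof eventually_elim
    case (elim q)
    have q: "q \<in> prange (Liq M)" using elim by (simp add: pos_in_Liq)
    have g: "q * v\<^sub>L q / (cs (Liq M) q)\<^sup>2 = 1 / gamma (Liq M) q" by (simp add: gamma_def)
    have "gamma (Liq M) q > 0"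
      using elim L.cs_pos[OF q] v\<^sub>L_pos[OF q] by (simp add: gamma_def)
    hence "gamma (Liq M) q > 1" using elim(1) unfolding g by simp
    hence "cond_I M p q"
      using cond_I_or_II[of p q] assms elim by (auto simp: dom_def cond_II_def)
    thus ?case unfolding g by (simp add: cond_I_def)
  qed
  hence "1 + eps M p / alpha M \<le> 0"
    by (intro tendsto_lowerbound[OF lim]) auto
  thus ?thesis using alpha by (simp add: field_simps)
qed

text \<open>With \<open>k\<close> the term subtracted on the left, the \<open>tau\<close> term of
  \<open>eps\<close> carries the factor \<open>k / gamma\<close>. Multiplying \<open>eps_le\<close>
  by \<open>gamma\<close> and bounding \<open>1 - (alpha M * beta M)\<^sup>2\<close> by 1 gives the
  claim. It is the source of the second inequality \<open>G\<close> in
  \<open>slope_positive\<close>.\<close>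

lemma one_minus_k_le:
  assumes "p \<in> dom"
  shows "1 - tau M * p * i\<^sub>V p * ((1 - alpha M) * v\<^sub>V p)\<^sup>2 \<le> (1 - alpha M) * gamma (Vap M) p"
proof -
  define g where "g = gamma (Vap M) p"
  define k where "k = tau M * p * i\<^sub>V p * ((1 - alpha M) * v\<^sub>V p)\<^sup>2"
  have pos: "p > 0" "v\<^sub>V p > 0" "i\<^sub>V p > 0" using assms dom_pos v\<^sub>V_pos i\<^sub>V_pos by auto
  hence g: "g > 0" by (simp add: g_def gamma\<^sub>V_eq)
  have k: "k \<ge> 0" using pos tau by (simp add: k_def)
  have cs: "cs (Vap M) p = i\<^sub>V p * v\<^sub>V p" using pos by (simp add: impedance_def)
  have "tau M * cs (Vap M) p ^ 3 * (1 - alpha M)\<^sup>2 = k * g"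
    unfolding cs k_def g_def gamma\<^sub>V_eq[OF pos(1)] using pos
    by (simp add: power2_eq_square power3_eq_cube field_simps)
  hence "tau M * cs (Vap M) p ^ 3 / g\<^sup>2 * (1 - alpha M)\<^sup>2 = k / g"
    using g by (simp add: power2_eq_square)
  hence "eps M p = 1 / g - 1 - k / g * (1 - (alpha M * beta M)\<^sup>2)"
    by (simp add: eps_def g_def)
  hence "g * (1 / g - 1 - k / g * (1 - (alpha M * beta M)\<^sup>2)) \<le> g * (- alpha M)"
    using eps_le[OF assms] g by (intro mult_left_mono) auto
  hence "1 - g - k * (1 - (alpha M * beta M)\<^sup>2) \<le> - (alpha M * g)"
    using g by (simp add: algebra_simps)
  moreover have "k * (1 - (alpha M * beta M)\<^sup>2) \<le> k"
    using k by (simp add: mult_left_le)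
  ultimately show ?thesis by (simp add: g_def k_def algebra_simps)
qed

section \<open>The function \<open>h\<close> and its sign on the diagonal\<close>

text \<open>Up to the factor \<open>tau M / 2\<close> this is the derivative of \<open>h\<close> in
  the liquid pressure. The tangent to the liquid isotherm at \<open>q\<close>, evaluated at
  \<open>p\<close>, lies at or below \<open>v\<^sub>L p\<close> and hence below
  \<open>v\<^sub>V p\<close>.\<close>

lemma H_neg:
  assumes "p \<in> dom" "q \<in> prange (Liq M)"
  shows "v\<^sub>L q - v\<^sub>V p + (q - p) / (i\<^sub>L q)\<^sup>2 < 0"
  using L.vol_above_tangent[OF dom_range(2)[OF assms(1)] assms(2)]
    v\<^sub>L_less[OF assms(1) dom_range(2)[OF assms(1)]] by linarith

lemma h_deriv_liquid:
  assumes "pmin M < q"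
  shows "(h M p has_real_derivative tau M / 2 * (v\<^sub>L q - v\<^sub>V p + (q - p) / (i\<^sub>L q)\<^sup>2)) (at q)"
proof -
  have q: "q \<in> prange (Liq M)" "pmin M \<in> prange (Liq M)" using assms by (auto simp: in_Liq)
  note at = L.at_within_range_right[OF q(2) assms]
  note d = L.vol_deriv_within[OF q(1), unfolded at] L.gib_deriv[OF q(1), unfolded at]
  show ?thesis
    unfolding h_def[abs_def]
    by (rule DERIV_cong[OF DERIV_cmult[OF DERIV_diff[OF DERIV_diff[OF d(2) DERIV_const]
      DERIV_cdivide[OF DERIV_mult[OF DERIV_diff[OF DERIV_ident DERIV_const]
        DERIV_add[OF d(1) DERIV_const]]]]]])
      (simp add: algebra_simps add_divide_distrib diff_divide_distrib)
qed

lemma h_deriv_vapor: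
  assumes "0 < p"
  shows "((\<lambda>p. h M p q) has_real_derivative tau M / 2 * (v\<^sub>L q - v\<^sub>V p + (q - p) / (i\<^sub>V p)\<^sup>2)) (at p)"
proof -
  note d = V.vol_deriv_pos[OF assms] V.gib_deriv_pos[OF assms]
  show ?thesis
    unfolding h_def[abs_def]
    by (rule DERIV_cong[OF DERIV_cmult[OF DERIV_diff[OF DERIV_diff[OF DERIV_const d(2)]
      DERIV_cdivide[OF DERIV_mult[OF DERIV_diff[OF DERIV_const DERIV_ident]
        DERIV_add[OF DERIV_const d(1)]]]]]])
      (simp add: algebra_simps add_divide_distrib diff_divide_distrib)
qed

lemma continuous_h_liquid: "continuous_on (prange (Liq M)) (h M p)"
  unfolding h_def[abs_def]
  by (intro continuous_intros L.continuous_gib L.continuous_vol) auto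

lemma h_strict_antimono:
  assumes "p \<in> dom" "q \<in> prange (Liq M)" "q < q'"
  shows "h M p q' < h M p q"
proof -
  have "- h M p q < - h M p q'"
  proof (rule increasing_by_derivative[OF \<open>q < q'\<close>])
    show "continuous_on {q..q'} (\<lambda>x. - h M p x)"
      by (intro continuous_intros continuous_on_subset[OF continuous_h_liquid
            L.segment_in_range[OF assms(2)]])
    fix x assume x: "q < x" "x < q'"
    have xr: "x \<in> prange (Liq M)" "pmin M < x" using assms(2) x by (auto simp: in_Liq)
    show "((\<lambda>x. - h M p x) has_real_derivative
        - (tau M / 2 * (v\<^sub>L x - v\<^sub>V p + (x - p) / (i\<^sub>L x)\<^sup>2))) (at x)"
      by (rule DERIV_minus[OF h_deriv_liquid[OF xr(2)]])
    show "- (tau M / 2 * (v\<^sub>L x - v\<^sub>V p + (x - p) / (i\<^sub>L x)\<^sup>2)) > 0"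
      using H_neg[OF assms(1) xr(1)] tau by (simp add: mult_pos_neg)
  qed
  thus ?thesis by simp
qed

lemma h_antimono:
  "p \<in> dom \<Longrightarrow> q \<in> prange (Liq M) \<Longrightarrow> q \<le> q' \<Longrightarrow> h M p q' \<le> h M p q"
  using h_strict_antimono[of p q q'] by (cases "q = q'") auto

lemma h_diagonal: "h M p p = tau M * (gib (Liq M) p - gib (Vap M) p)"
  by (simp add: h_def)

text \<open>The derivative \<open>v\<^sub>L - v\<^sub>V\<close> is negative. Hence within
  \<open>dom\<close> the saturation pressure is the only zero of \<open>h\<close> on the diagonal,
  and the sign there decides the direction of the phase transition.\<close>

lemma gib_difference_strict_antimono:
  assumes "p \<in> dom" "q \<in> dom" "p < q"
  shows "gib (Liq M) q - gib (Vap M) q < gib (Liq M) p - gib (Vap M) p"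
proof -
  have "gib (Vap M) p - gib (Liq M) p < gib (Vap M) q - gib (Liq M) q"
  proof (rule increasing_by_derivative[OF \<open>p < q\<close>])
    show "continuous_on {p..q} (\<lambda>x. gib (Vap M) x - gib (Liq M) x)"
      using dom_range(1,2)[OF assms(1)]
      by (intro continuous_intros continuous_on_subset[OF V.continuous_gib]
          continuous_on_subset[OF L.continuous_gib] V.segment_in_range L.segment_in_range)
    fix x assume x: "p < x" "x < q"
    hence xd: "x \<in> dom" using dom_below[OF assms(2)] dom_pos[OF assms(1)] by simp
    show "((\<lambda>x. gib (Vap M) x - gib (Liq M) x) has_real_derivative v\<^sub>V x - v\<^sub>L x) (at x)"
      by (intro DERIV_diff V.gib_deriv_pos L.gib_deriv_pos dom_pos xd)
    show "v\<^sub>V x - v\<^sub>L x > 0" using v\<^sub>L_less[OF xd dom_range(2)[OF xd]] by simp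
  qed
  thus ?thesis by simp
qed

lemma h_diagonal_psat: "h M (psat M) (psat M) = 0"
  by (simp add: h_diagonal psat)

lemma h_diagonal_pos: "p \<in> dom \<Longrightarrow> p < psat M \<Longrightarrow> h M p p > 0"
  using gib_difference_strict_antimono[of p "psat M"] psat_in_dom psat tau
  by (simp add: h_diagonal)

lemma h_diagonal_neg: "p \<in> dom \<Longrightarrow> p > psat M \<Longrightarrow> h M p p < 0"
  using gib_difference_strict_antimono[of "psat M" p] psat_in_dom psat tau
  by (simp add: h_diagonal mult_pos_neg)

lemma interface_pressure_iff:
  "interface_pressure M p q \<longleftrightarrow> q \<in> prange (Liq M) \<and> q - p = (S p q)\<^sup>2 * (v\<^sub>V p - v\<^sub>L q)
     \<and> - i\<^sub>V p \<le> S p q \<and> S p q \<le> i\<^sub>L q"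
proof -
  have "q - p + (S p q)\<^sup>2 * (v\<^sub>L q - v\<^sub>V p) = 0 \<longleftrightarrow> q - p = (S p q)\<^sup>2 * (v\<^sub>V p - v\<^sub>L q)"
  proof -
    have "(S p q)\<^sup>2 * (v\<^sub>L q - v\<^sub>V p) = - ((S p q)\<^sup>2 * (v\<^sub>V p - v\<^sub>L q))"
      by (simp add: right_diff_distrib)
    thus ?thesis by (intro iffI) linarith+
  qed
  thus ?thesis
    unfolding interface_pressure_def S_def impedance_def by (simp only:)
qed

section \<open>Liquid pressure and mass flux at the phase boundary\<close>

lemma interface_phi: "p \<in> dom \<Longrightarrow> interface_pressure M p (\<phi> p)"
  unfolding phi_def by (rule theI', rule phi_unique) (simp add: dom_def)

lemma phi_eqI: "p \<in> dom \<Longrightarrow> interface_pressure M p q \<Longrightarrow> q = \<phi> p"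
  using interface_phi[of p] phi_unique[of p] by (auto simp: dom_def)

lemma zflux_S: "z p = S p (\<phi> p)"
  by (simp add: zflux_def S_def)

text \<open>By convexity of the liquid isotherm a root is subsonic on the liquid side, so the upper
  bound in \<open>interface_pressure\<close> is automatic.\<close>

lemma root_subsonic:
  assumes "p \<in> dom" "q \<in> prange (Liq M)" "q - p = Z\<^sup>2 * (v\<^sub>V p - v\<^sub>L q)"
  shows "p \<le> q" and "Z\<^sup>2 < (i\<^sub>L q)\<^sup>2" and "\<bar>Z\<bar> < i\<^sub>L q"
proof -
  have d: "v\<^sub>V p - v\<^sub>L q > 0" using v\<^sub>L_less[OF assms(1,2)] by simp
  have "Z\<^sup>2 * (v\<^sub>V p - v\<^sub>L q) \<ge> 0" using d by simp
  thus "p \<le> q" using assms(3) by linarith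
  have i: "i\<^sub>L q > 0" using i\<^sub>L_pos[OF assms(2)] .
  have "(q - p) / (i\<^sub>L q)\<^sup>2 < v\<^sub>V p - v\<^sub>L q" using H_neg[OF assms(1,2)] by linarith
  hence "Z\<^sup>2 * (v\<^sub>V p - v\<^sub>L q) < (i\<^sub>L q)\<^sup>2 * (v\<^sub>V p - v\<^sub>L q)"
    using i by (simp add: assms(3) pos_divide_less_eq mult.commute)
  thus *: "Z\<^sup>2 < (i\<^sub>L q)\<^sup>2" using d by simp
  show "\<bar>Z\<bar> < i\<^sub>L q" by (rule power2_less_imp_less) (use * i in auto)
qed

lemma phi_root:
  assumes "p \<in> dom"
  shows "\<phi> p \<in> prange (Liq M)" and "\<phi> p - p = (z p)\<^sup>2 * (v\<^sub>V p - v\<^sub>L (\<phi> p))"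
    and "- i\<^sub>V p \<le> z p" and "p \<le> \<phi> p" and "(z p)\<^sup>2 < (i\<^sub>L (\<phi> p))\<^sup>2" and "\<bar>z p\<bar> < i\<^sub>L (\<phi> p)"
  using interface_phi[OF assms] root_subsonic[OF assms, of "\<phi> p" "z p"]
  unfolding interface_pressure_iff zflux_S by auto

lemma phi_eq_iff: "p \<in> dom \<Longrightarrow> \<phi> p = p \<longleftrightarrow> z p = 0"
  using phi_root(1,2)[of p] v\<^sub>L_less[of p "\<phi> p"] by auto

lemma phi_psat: "\<phi> (psat M) = psat M" and zflux_psat: "z (psat M) = 0"
proof -
  have "interface_pressure M (psat M) (psat M)"
    unfolding interface_pressure_iff S_def h_diagonal_psat
    using i\<^sub>V_pos[OF psat_pos] i\<^sub>L_pos dom_range(2)[OF psat_in_dom] by (simp add: less_imp_le)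
  thus *: "\<phi> (psat M) = psat M" using phi_eqI psat_in_dom by metis
  show "z (psat M) = 0" using phi_eq_iff[OF psat_in_dom] * by simp
qed

lemma continuous_S_liquid: "continuous_on (prange (Liq M)) (S p)"
  unfolding S_def[abs_def] by (intro continuous_intros continuous_h_liquid)

text \<open>A nonpositive flux would force \<open>h M p\<close> to vanish between \<open>p\<close>
  and \<phi> p. Before that zero there is another admissible interface pressure, with positive flux,
  against uniqueness.\<close>

lemma zflux_pos:
  assumes p: "p \<in> dom" "p < psat M"
  shows "z p > 0"
proof (rule ccontr)
  assume neg: "\<not> z p > 0"
  note p0 = dom_pos[OF p(1)] and pL = dom_range(2)[OF p(1)]
  define q where "q = \<phi> p"
  have q: "p \<le> q" "h M p q \<le> 0"
    using phi_root(4)[OF p(1)] neg p0 by (auto simp: q_def zflux_def not_less mult_le_0_iff)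
  have cont: "continuous_on {p..x} (h M p)" "continuous_on {p..x} (S p)" "continuous_on {p..x} v\<^sub>L" for x
    using continuous_on_subset[OF continuous_h_liquid L.segment_in_range[OF pL]]
      continuous_on_subset[OF continuous_S_liquid L.segment_in_range[OF pL]]
      continuous_on_subset[OF L.continuous_vol L.segment_in_range[OF pL]] by auto
  obtain x where x: "p \<le> x" "x \<le> q" "h M p x = 0"
    using IVT2'[of "h M p" q 0 p] q h_diagonal_pos[OF p] cont by auto
  have "p \<noteq> x" using x(3) h_diagonal_pos[OF p] by auto
  hence "p < x" using x by simp
  \<comment> \<open>The momentum residual is nonnegative at \<open>p\<close> and nonpositive at the
    zero \<open>x\<close> of \<open>h\<close>, so it has a root in between.\<close>
  let ?F = "\<lambda>y. (S p y)\<^sup>2 * (v\<^sub>V p - v\<^sub>L y) - (y - p)"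
  have "?F p \<ge> 0" using v\<^sub>L_less[OF p(1) pL] by simp
  moreover have "?F x \<le> 0" using x by (simp add: S_def)
  moreover have "continuous_on {p..x} ?F" by (intro continuous_intros cont)
  ultimately obtain y where y: "p \<le> y" "y \<le> x" "?F y = 0"
    using IVT2'[of ?F x 0 p] x by auto
  have yL: "y \<in> prange (Liq M)" using L.in_range_mono[OF pL y(1)] .
  have "y \<noteq> x" using y(3) \<open>p < x\<close> x(3) by (auto simp: S_def)
  hence "h M p y > 0" using h_strict_antimono[OF p(1) yL, of x] y(2) x(3) by simp
  hence S: "S p y > 0" using p0 by (simp add: S_def)
  have "interface_pressure M p y"
    unfolding interface_pressure_iff
    using yL y(3) S i\<^sub>V_pos[OF p0] root_subsonic(3)[OF p(1) yL, of "S p y"] by auto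
  hence "y = q" using phi_eqI[OF p(1)] by (simp add: q_def)
  thus False using \<open>h M p y > 0\<close> q(2) by simp
qed

lemma zflux_neg:
  assumes p: "p \<in> dom" "p > psat M"
  shows "z p < 0"
proof -
  have "h M p (\<phi> p) \<le> h M p p"
    by (rule h_antimono[OF p(1) dom_range(2)[OF p(1)] phi_root(4)[OF p(1)]])
  thus ?thesis
    using h_diagonal_neg[OF p] dom_pos[OF p(1)] by (simp add: zflux_def mult_pos_neg)
qed

text \<open>The flux is nonnegative, so \<open>h M p\<close> is still nonnegative at \<phi> p. It
  starts from at most \<open>tau M * psat M * v\<^sub>V p\<close> at \<open>p\<close> and falls at
  least at the rate \<open>tau M / 2 * d\<close>, where \<open>d\<close> is at least
  \<open>(1 - alpha M) * v\<^sub>V p\<close>. The vapor volume cancels, so the bound is uniform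
  towards vacuum.\<close>

lemma phi_le_below_psat:
  assumes p: "p \<in> dom" "p \<le> psat M"
  shows "\<phi> p \<le> p + 2 * psat M / (1 - alpha M)"
proof -
  note p0 = dom_pos[OF p(1)] and pL = dom_range(2)[OF p(1)]
  define d where "d = v\<^sub>V p - v\<^sub>L p"
  define q where "q = \<phi> p"
  have q: "p \<le> q" using phi_root(4)[OF p(1)] by (simp add: q_def)
  have "z p \<ge> 0" using zflux_pos[OF p(1)] p(2) zflux_psat by (cases "p = psat M") (auto simp: less_imp_le)
  hence h0: "h M p q \<ge> 0" using p0 by (simp add: zflux_def q_def zero_le_mult_iff)
  have "- h M p p - tau M / 2 * d * p \<le> - h M p q - tau M / 2 * d * q"
  proof (rule nondecreasing_by_derivative[OF q])
    show "continuous_on {p..q} (\<lambda>x. - h M p x - tau M / 2 * d * x)"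
      by (intro continuous_intros continuous_on_subset[OF continuous_h_liquid
            L.segment_in_range[OF pL]])
    fix x assume x: "p < x" "x < q"
    have xr: "x \<in> prange (Liq M)" "pmin M < x" using pL x by (auto simp: in_Liq)
    let ?D = "\<lambda>x. - (tau M / 2 * (v\<^sub>L x - v\<^sub>V p + (x - p) / (i\<^sub>L x)\<^sup>2)) - tau M / 2 * d * 1"
    show "((\<lambda>x. - h M p x - tau M / 2 * d * x) has_real_derivative ?D x) (at x)"
      by (intro DERIV_diff DERIV_minus h_deriv_liquid DERIV_cmult DERIV_ident xr(2))
    have eq: "?D x = tau M / 2 * (v\<^sub>L p - v\<^sub>L x - (x - p) / (i\<^sub>L x)\<^sup>2)"
      by (simp add: d_def algebra_simps)
    show "?D x \<ge> 0"
      unfolding eq using L.vol_above_tangent[OF pL xr(1)] tau by (intro mult_nonneg_nonneg) auto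
  qed
  hence 1: "tau M / 2 * d * (q - p) \<le> h M p p" using h0 by (simp add: algebra_simps)
  \<comment> \<open>Below saturation the liquid Gibbs energy is less than the common value at
    \<open>psat M\<close>, so the gap is less than the vapor increase up to \<open>psat M\<close>,
    which the trapezoid estimates.\<close>
  have "gib (Liq M) p - gib (Vap M) p \<le> psat M * v\<^sub>V p"
  proof (cases "p = psat M")
    case True thus ?thesis using psat psat_pos v\<^sub>V_pos[OF p0] by simp
  next
    case False
    hence lt: "p < psat M" using p by simp
    have "gib (Vap M) (psat M) - gib (Vap M) p \<le> (psat M - p) * v\<^sub>V p"
    proof -
      have "gib (Vap M) (psat M) - gib (Vap M) p < (psat M - p) * (v\<^sub>V p + v\<^sub>V (psat M)) / 2"
        by (rule V.gib_below_trapezoid[OF dom_range(1)[OF p(1)] lt])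
      also have "\<dots> \<le> (psat M - p) * (v\<^sub>V p + v\<^sub>V p) / 2"
        using V.vol_strict_antimono[OF dom_range(1)[OF p(1)] lt] lt
        by (intro divide_right_mono mult_left_mono) auto
      finally show ?thesis by simp
    qed
    moreover have "gib (Liq M) p < gib (Liq M) (psat M)"
    proof (rule increasing_by_derivative[OF lt])
      show "continuous_on {p..psat M} (gib (Liq M))"
        by (rule continuous_on_subset[OF L.continuous_gib L.segment_in_range[OF pL]])
      fix x assume "p < x"
      hence "x > 0" using p0 by simp
      thus "(gib (Liq M) has_real_derivative v\<^sub>L x) (at x)" "v\<^sub>L x > 0"
        using L.gib_deriv_pos v\<^sub>L_pos pos_in_Liq by auto
    qed
    moreover have "p * v\<^sub>V p > 0" using p0 v\<^sub>V_pos by simp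
    ultimately show ?thesis using psat by (simp add: algebra_simps)
  qed
  hence "h M p p \<le> tau M * (psat M * v\<^sub>V p)"
    unfolding h_diagonal using tau by (intro mult_left_mono) auto
  with 1 have "tau M / 2 * (d * (q - p)) \<le> tau M / 2 * (2 * psat M * v\<^sub>V p)"
    by (simp add: algebra_simps)
  hence "d * (q - p) \<le> 2 * psat M * v\<^sub>V p" using tau by simp
  moreover have "(1 - alpha M) * v\<^sub>V p * (q - p) \<le> d * (q - p)"
    using v\<^sub>L_le[OF p(1) pL] q by (intro mult_right_mono) (auto simp: d_def algebra_simps)
  ultimately have "v\<^sub>V p * ((1 - alpha M) * (q - p)) \<le> v\<^sub>V p * (2 * psat M)"
    by (simp add: mult_ac)
  hence "(1 - alpha M) * (q - p) \<le> 2 * psat M" using v\<^sub>V_pos[OF p0] by simp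
  thus ?thesis using alpha by (simp add: q_def field_simps)
qed

text \<open>The sonic bound replaces \<open>(z p)\<^sup>2\<close> by
  \<open>(i\<^sub>V p)\<^sup>2\<close>, and \<open>gamma \<le> 1\<close> then bounds the pressure
  jump by \<open>p\<close>.\<close>

lemma phi_le_above_psat:
  assumes p: "p \<in> dom" "p > psat M"
  shows "\<phi> p \<le> 2 * p"
proof -
  have "(z p)\<^sup>2 \<le> (i\<^sub>V p)\<^sup>2"
    using zflux_neg[OF p] phi_root(3)[OF p(1)] by (intro power2_le_iff_abs_le[THEN iffD2]) auto
  moreover have "v\<^sub>V p - v\<^sub>L (\<phi> p) \<le> v\<^sub>V p" "0 \<le> v\<^sub>V p - v\<^sub>L (\<phi> p)"
    using v\<^sub>L_pos[OF phi_root(1)[OF p(1)]] v\<^sub>L_less[OF p(1) phi_root(1)[OF p(1)]] by auto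
  ultimately have "(z p)\<^sup>2 * (v\<^sub>V p - v\<^sub>L (\<phi> p)) \<le> (i\<^sub>V p)\<^sup>2 * v\<^sub>V p"
    by (intro mult_mono) auto
  thus ?thesis using phi_root(2)[OF p(1)] i\<^sub>V_v\<^sub>V_le[OF p(1)] by linarith
qed

text \<open>By uniqueness of the interface pressure the graph is cut out by closed conditions on
  continuous functions. As \<phi> takes values in a compact interval, a closed graph means
  continuity.\<close>

lemma continuous_phi: "continuous_on dom \<phi>"
proof -
  define B where "B = 2 * (sigma_max M * psat M) + 2 * psat M / (1 - alpha M)"
  have "\<phi> p \<in> {0..B}" if p: "p \<in> dom" for p
  proof -
    have "2 * psat M / (1 - alpha M) > 0" using psat_pos alpha by simp
    thus ?thesis
      using phi_root(4)[OF p] dom_pos[OF p] phi_le_below_psat[OF p] phi_le_above_psat[OF p] p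
      by (cases "p \<le> psat M") (auto simp: B_def dom_def)
  qed
  hence fim: "\<phi> \<in> dom \<rightarrow> {0..B}" by blast
  let ?X = "dom \<times> {0..B}"
  have dV: "x \<in> ?X \<Longrightarrow> fst x \<in> prange (Vap M)" and dL: "x \<in> ?X \<Longrightarrow> snd x \<in> prange (Liq M)" for x
    using dom_range pos_in_Liq by auto
  note c = continuous_on_compose2[OF V.continuous_vol continuous_on_fst[OF continuous_on_id]]
    continuous_on_compose2[OF L.continuous_vol continuous_on_snd[OF continuous_on_id]]
    continuous_on_compose2[OF V.continuous_gib continuous_on_fst[OF continuous_on_id]]
    continuous_on_compose2[OF L.continuous_gib continuous_on_snd[OF continuous_on_id]]
    continuous_on_compose2[OF V.continuous_impedance continuous_on_fst[OF continuous_on_id]]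
    continuous_on_compose2[OF L.continuous_impedance continuous_on_snd[OF continuous_on_id]]
  have cS: "continuous_on ?X (\<lambda>x. S (fst x) (snd x))"
    unfolding S_def h_def by (intro continuous_intros c image_subsetI dV dL) auto
  let ?f1 = "\<lambda>x. snd x - fst x - (S (fst x) (snd x))\<^sup>2 * (v\<^sub>V (fst x) - v\<^sub>L (snd x))"
  let ?f2 = "\<lambda>x. S (fst x) (snd x) + i\<^sub>V (fst x)" and ?f3 = "\<lambda>x. i\<^sub>L (snd x) - S (fst x) (snd x)"
  have "closedin (top_of_set ?X) ((?X \<inter> ?f1 -` {0}) \<inter> (?X \<inter> ?f2 -` {0..}) \<inter> (?X \<inter> ?f3 -` {0..}))"
    by (intro closedin_Int continuous_closedin_preimage continuous_intros cS c image_subsetI dV dL) auto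
  moreover have "(\<lambda>x. (x, \<phi> x)) ` dom
      = (?X \<inter> ?f1 -` {0}) \<inter> (?X \<inter> ?f2 -` {0..}) \<inter> (?X \<inter> ?f3 -` {0..})" (is "_ = ?C")
  proof
    show "(\<lambda>x. (x, \<phi> x)) ` dom \<subseteq> ?C"
    proof (rule image_subsetI)
      fix p assume p: "p \<in> dom"
      have "\<phi> p - p - (S p (\<phi> p))\<^sup>2 * (v\<^sub>V p - v\<^sub>L (\<phi> p)) = 0"
        "0 \<le> S p (\<phi> p) + i\<^sub>V p" "0 \<le> i\<^sub>L (\<phi> p) - S p (\<phi> p)"
        using interface_phi[OF p] unfolding interface_pressure_iff by auto
      thus "(p, \<phi> p) \<in> ?C" using fim p by auto
    qed
    show "?C \<subseteq> (\<lambda>x. (x, \<phi> x)) ` dom"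
    proof
      fix x assume x: "x \<in> ?C"
      hence "interface_pressure M (fst x) (snd x)" "fst x \<in> dom"
        using dL[of x] unfolding interface_pressure_iff by auto
      hence "x = (fst x, \<phi> (fst x))" "fst x \<in> dom"
        using phi_eqI[of "fst x" "snd x"] by (simp_all add: prod_eq_iff)
      thus "x \<in> (\<lambda>x. (x, \<phi> x)) ` dom" by (rule image_eqI)
    qed
  qed
  ultimately show ?thesis
    using continuous_closed_graph_eq[OF compact_Icc fim] by simp
qed

end

section \<open>Monotonicity of \<open>f_z\<close>\<close>

context two_phase_setting
begin

subsection \<open>Above the saturation pressure\<close>

text \<open>\<open>T\<close> places the liquid state on or below the tangent to the vapor isotherm
  at \<open>p\<close>; equivalently, \<open>h\<close> has a nonpositive derivative in the vapor
  pressure there. By convexity, moving the point of tangency towards \<open>q\<close> raises the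
  value of the tangent at \<open>q\<close>.\<close>

lemma subsonic_vapor_persists:
  assumes dom: "p \<in> dom" "p' \<in> dom" "p \<le> p'" and q: "q \<in> prange (Liq M)"
    and T: "(q - p) / (i\<^sub>V p)\<^sup>2 \<le> v\<^sub>V p - v\<^sub>L q"
  shows "(q - p') / (i\<^sub>V p')\<^sup>2 \<le> v\<^sub>V p' - v\<^sub>L q"
proof (cases "q \<le> p'")
  case True
  hence "(q - p') / (i\<^sub>V p')\<^sup>2 \<le> 0" by (simp add: divide_nonpos_nonneg)
  thus ?thesis using v\<^sub>L_less[OF dom(2) q] by linarith
next
  case False
  have i: "0 < i\<^sub>V p" "i\<^sub>V p \<le> i\<^sub>V p'"
    using i\<^sub>V_pos dom_pos dom V.impedance_mono dom_range(1) by auto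
  have "(q - p') / (i\<^sub>V p')\<^sup>2 \<le> (q - p') / (i\<^sub>V p)\<^sup>2"
    using False i by (intro divide_left_mono power_mono mult_pos_pos zero_less_power) auto
  also have "\<dots> = (q - p) / (i\<^sub>V p)\<^sup>2 + (p - p') / (i\<^sub>V p)\<^sup>2"
    by (simp add: add_divide_distrib[symmetric])
  also have "\<dots> \<le> v\<^sub>V p' - v\<^sub>L q"
    using T V.vol_above_tangent[OF dom_range(1)[OF dom(2)] dom_range(1)[OF dom(1)]] by linarith
  finally show ?thesis .
qed

lemma h_antimono_vapor:
  assumes dom: "p \<in> dom" "p' \<in> dom" "p \<le> p'" and q: "q \<in> prange (Liq M)"
    and T: "(q - p) / (i\<^sub>V p)\<^sup>2 \<le> v\<^sub>V p - v\<^sub>L q"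
  shows "h M p' q \<le> h M p q"
proof -
  have "- h M p q \<le> - h M p' q"
  proof (rule nondecreasing_by_derivative[OF dom(3)])
    have d: "((\<lambda>x. - h M x q) has_real_derivative
        - (tau M / 2 * (v\<^sub>L q - v\<^sub>V x + (q - x) / (i\<^sub>V x)\<^sup>2))) (at x)" if "x \<ge> p" for x
      using that dom_pos[OF dom(1)] by (intro DERIV_minus h_deriv_vapor) simp
    thus "continuous_on {p..p'} (\<lambda>x. - h M x q)"
      by (intro DERIV_atLeastAtMost_imp_continuous_on) blast
    fix x assume x: "p < x" "x < p'"
    show "((\<lambda>x. - h M x q) has_real_derivative
        - (tau M / 2 * (v\<^sub>L q - v\<^sub>V x + (q - x) / (i\<^sub>V x)\<^sup>2))) (at x)"
      using d x by simp
    have "x \<in> dom" using dom_below[OF dom(2)] dom_pos[OF dom(1)] x by simp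
    hence "v\<^sub>L q - v\<^sub>V x + (q - x) / (i\<^sub>V x)\<^sup>2 \<le> 0"
      using subsonic_vapor_persists[OF dom(1) _ _ q T, of x] x by simp
    thus "- (tau M / 2 * (v\<^sub>L q - v\<^sub>V x + (q - x) / (i\<^sub>V x)\<^sup>2)) \<ge> 0"
      using tau by (simp add: mult_nonneg_nonpos)
  qed
  thus ?thesis by simp
qed

lemma S_antimono_liquid:
  "p \<in> dom \<Longrightarrow> q \<in> prange (Liq M) \<Longrightarrow> q \<le> q' \<Longrightarrow> S p q' \<le> S p q"
  unfolding S_def using dom_pos[of p] h_antimono[of p q q'] by (intro mult_left_mono) auto

text \<open>Above saturation every root between \<open>p\<close> and \<open>\<phi> p\<close> satisfies the bounds on the mass flux,
  so that \<open>\<phi> p\<close> is the smallest root.\<close>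

lemma below_first_root:
  assumes p: "p \<in> dom" "psat M < p" and q: "p \<le> q" "q < \<phi> p"
  shows "q - p < (S p q)\<^sup>2 * (v\<^sub>V p - v\<^sub>L q)"
proof (rule ccontr)
  note pL = dom_range(2)[OF p(1)]
  let ?F = "\<lambda>y. y - p - (S p y)\<^sup>2 * (v\<^sub>V p - v\<^sub>L y)"
  assume "\<not> ?thesis"
  hence "?F q \<ge> 0" by simp
  moreover have "?F p \<le> 0" using v\<^sub>L_less[OF p(1) pL] by simp
  moreover have "continuous_on {p..q} ?F"
    by (intro continuous_intros continuous_on_subset[OF continuous_S_liquid L.segment_in_range[OF pL]]
        continuous_on_subset[OF L.continuous_vol L.segment_in_range[OF pL]])
  ultimately obtain y where y: "p \<le> y" "y \<le> q" "?F y = 0"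
    using IVT'[of ?F p 0 q] q(1) by auto
  have yL: "y \<in> prange (Liq M)" using L.in_range_mono[OF pL y(1)] .
  \<comment> \<open>\<open>S p\<close> decreases in the liquid pressure, so the lower bound passes
    from \<phi> p down to \<open>y\<close>.\<close>
  have "- i\<^sub>V p \<le> S p y"
    using phi_root(3)[OF p(1)] S_antimono_liquid[OF p(1) yL, of "\<phi> p"] y q by (simp add: zflux_S)
  moreover have "S p y \<le> i\<^sub>L y"
    using root_subsonic(3)[OF p(1) yL, of "S p y"] y(3) by simp
  ultimately have "interface_pressure M p y"
    unfolding interface_pressure_iff using yL y(3) by simp
  hence "y = \<phi> p" by (rule phi_eqI[OF p(1)])
  thus False using y q by simp
qed

lemma square_le_of_bounds: "- (b::real) \<le> a \<Longrightarrow> a \<le> 0 \<Longrightarrow> a\<^sup>2 \<le> b\<^sup>2"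
  by (intro power2_le_iff_abs_le[THEN iffD2]) auto

lemma zflux_nonpos: "p \<in> dom \<Longrightarrow> psat M \<le> p \<Longrightarrow> z p \<le> 0"
  using zflux_neg[of p] zflux_psat by (cases "p = psat M") auto

text \<open>If \<open>q = \<phi> p'\<close> were at most \<phi> p, raising the vapor pressure at
  fixed \<open>q\<close> would make the flux strictly more negative. The root equation at
  \<open>p'\<close> would then force the volume jump to shrink faster than the tangent to the vapor
  isotherm permits.\<close>

lemma phi_strict_mono_above:
  assumes dom: "p \<in> dom" "p' \<in> dom" and le: "psat M \<le> p" "p < p'"
  shows "\<phi> p < \<phi> p'"
proof (cases "p = psat M")
  case True
  thus ?thesis using phi_psat phi_root(4)[OF dom(2)] le by simp
next
  case False
  hence p: "psat M < p" using le by simp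
  show ?thesis
  proof (rule ccontr)
    define q where "q = \<phi> p'"
    assume "\<not> \<phi> p < \<phi> p'"
    hence q1: "q \<le> \<phi> p" by (simp add: q_def)
    have qp: "p' \<le> q" using phi_root(4)[OF dom(2)] by (simp add: q_def)
    have qL: "q \<in> prange (Liq M)" using phi_root(1)[OF dom(2)] by (simp add: q_def)
    note p0 = dom_pos[OF dom(1)] and pL = dom_range(2)[OF dom(1)]
    define X where "X = q - p"
    define a b s t where "a = v\<^sub>V p - v\<^sub>L q" and "b = v\<^sub>V p' - v\<^sub>L q" and "s = S p q" and "t = S p' q"
    have X: "X > 0" using qp le by (simp add: X_def)
    have ab: "a > 0" "b > 0" using v\<^sub>L_less[OF dom(1) qL] v\<^sub>L_less[OF dom(2) qL] by (auto simp: a_def b_def)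
    have "h M p q < 0"
      using h_antimono[OF dom(1) pL, of q] h_diagonal_neg[OF dom(1) p] qp le by simp
    hence hneg: "h M p q < 0" and sneg: "s < 0"
      using p0 by (auto simp: s_def S_def mult_pos_neg)
    have Xs: "X \<le> s\<^sup>2 * a"
    proof (cases "q = \<phi> p")
      case True thus ?thesis using phi_root(2)[OF dom(1)] by (simp add: X_def s_def a_def zflux_S)
    next
      case False
      thus ?thesis
        using below_first_root[OF dom(1) p, of q] q1 qp le by (simp add: X_def s_def a_def)
    qed
    have "- i\<^sub>V p \<le> s"
      using phi_root(3)[OF dom(1)] S_antimono_liquid[OF dom(1) qL q1] by (simp add: zflux_S s_def)
    hence "s\<^sup>2 \<le> (i\<^sub>V p)\<^sup>2" using sneg by (intro square_le_of_bounds) auto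
    hence "s\<^sup>2 * a \<le> (i\<^sub>V p)\<^sup>2 * a" using ab by (intro mult_right_mono) auto
    hence T: "X / (i\<^sub>V p)\<^sup>2 \<le> a"
      using Xs i\<^sub>V_pos[OF p0] by (simp add: pos_divide_le_eq mult.commute)
    have "h M p' q \<le> h M p q"
      using T le by (intro h_antimono_vapor dom qL) (auto simp: X_def a_def)
    hence "p' * h M p' q \<le> p' * h M p q"
      using dom_pos[OF dom(2)] by (intro mult_left_mono) auto
    also have "\<dots> < p * h M p q"
      using hneg le by (rule_tac mult_strict_right_mono_neg) auto
    finally have "t < s" by (simp add: s_def t_def S_def)
    hence st: "s\<^sup>2 < t\<^sup>2" using sneg by (intro power2_strict_mono) auto
    have "t\<^sup>2 * b = X - (p' - p)"
      using phi_root(2)[OF dom(2)] by (simp add: t_def b_def q_def X_def zflux_S)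
    hence tb: "t\<^sup>2 * a * b = (X - (p' - p)) * a" by (metis mult.assoc mult.commute)
    \<comment> \<open>The tangent at \<open>p\<close> bounds the loss of vapor volume by
      \<open>(p' - p) / (i\<^sub>V p)\<^sup>2\<close>, and \<open>T\<close> bounds the reciprocal
      squared impedance by \<open>a / X\<close>.\<close>
    have "(X - (p' - p)) * a \<le> X * b"
    proof -
      have "a - (p' - p) / (i\<^sub>V p)\<^sup>2 \<le> b"
        using V.vol_above_tangent[OF dom_range(1)[OF dom(2)] dom_range(1)[OF dom(1)]]
        by (simp add: a_def b_def diff_divide_distrib)
      hence "X * (a - (p' - p) / (i\<^sub>V p)\<^sup>2) \<le> X * b" using X by simp
      moreover have "(p' - p) * (X / (i\<^sub>V p)\<^sup>2) \<le> (p' - p) * a" using T le by (intro mult_left_mono) auto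
      ultimately show ?thesis by (simp add: algebra_simps)
    qed
    also have "\<dots> \<le> s\<^sup>2 * a * b" using Xs ab by (intro mult_right_mono) auto
    also have "\<dots> < t\<^sup>2 * a * b" using st ab by (intro mult_strict_right_mono) auto
    finally show False using tb by simp
  qed
qed

text \<open>With the liquid pressure frozen at \<open>q\<close>, the changing vapor volume costs at
  most \<open>1 / i\<^sub>V x\<close> by the sonic bound, which the vapor wave compensates. Letting
  the liquid pressure then rise to \<open>\<phi> p'\<close> does not decrease the absolute flux or
  the volume jump and strictly increases the liquid wave.\<close>

lemma f_z_strict_mono_above:
  assumes dom: "p \<in> dom" "p' \<in> dom" and le: "psat M \<le> p" "p < p'"
    and w: "fst w\<^sub>V \<in> prange (Vap M)" "fst w\<^sub>L \<in> prange (Liq M)"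
  shows "f_z M p w\<^sub>V w\<^sub>L < f_z M p' w\<^sub>V w\<^sub>L"
proof -
  define q where "q = \<phi> p"
  have q': "q < \<phi> p'" using phi_strict_mono_above[OF dom le] by (simp add: q_def)
  have qL: "q \<in> prange (Liq M)" and q0: "q > 0"
    using phi_root(1,4)[OF dom(1)] dom_pos[OF dom(1)] by (auto simp: q_def)
  note p0 = dom_pos[OF dom(1)]
  have "(z p)\<^sup>2 \<le> (i\<^sub>V p)\<^sup>2"
    using zflux_nonpos[OF dom(1) le(1)] phi_root(3)[OF dom(1)] by (intro square_le_of_bounds) auto
  hence T: "(q - p) / (i\<^sub>V p)\<^sup>2 \<le> v\<^sub>V p - v\<^sub>L q"
    using phi_root(2)[OF dom(1)] i\<^sub>V_pos[OF p0] v\<^sub>L_less[OF dom(1) qL]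
    by (simp add: pos_divide_le_eq q_def[symmetric] mult.commute mult_right_mono)
  have h0: "h M p q \<le> 0"
    using zflux_nonpos[OF dom(1) le(1)] p0 by (simp add: zflux_def q_def mult_le_0_iff)
  have S: "S x q \<le> 0 \<and> - i\<^sub>V x \<le> S x q" if x: "p \<le> x" "x \<le> p'" for x
  proof
    have xd: "x \<in> dom" using dom_below[OF dom(2)] x p0 by simp
    have "h M x q \<le> 0" using h_antimono_vapor[OF dom(1) xd x(1) qL T] h0 by simp
    thus "S x q \<le> 0" using x p0 by (simp add: S_def mult_nonneg_nonpos)
    \<comment> \<open>Monotonicity of \<phi> keeps the trial state subsonic: the bound is known at
      \<phi> x, and \<open>S x\<close> is at least as large at the lower pressure
      \<open>q\<close>.\<close>
    have "q \<le> \<phi> x"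
      using phi_strict_mono_above[OF dom(1) xd le(1)] x by (cases "p = x") (auto simp: q_def)
    thus "- i\<^sub>V x \<le> S x q"
      using phi_root(3)[OF xd] S_antimono_liquid[OF xd qL, of "\<phi> x"] by (simp add: zflux_S)
  qed
  have "f_K (Vap M) p w\<^sub>V + S p q * (v\<^sub>L q - v\<^sub>V p) \<le> f_K (Vap M) p' w\<^sub>V + S p' q * (v\<^sub>L q - v\<^sub>V p')"
  proof (rule DERIV_nonneg_imp_nondecreasing[where f = "\<lambda>x. f_K (Vap M) x w\<^sub>V + S x q * (v\<^sub>L q - v\<^sub>V x)"])
    fix x assume x: "p \<le> x" "x \<le> p'"
    hence x0: "x > 0" using p0 by simp
    have xd: "x \<in> dom" using dom_below[OF dom(2)] x p0 by simp
    obtain D where D: "((\<lambda>p. f_K (Vap M) p w\<^sub>V) has_real_derivative D) (at x)" "1 / i\<^sub>V x \<le> D"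
      using V.f_K_deriv[OF w(1), of "x/2" x] x0 by (auto simp: prange_Vap)
    let ?H = "tau M / 2 * (v\<^sub>L q - v\<^sub>V x + (q - x) / (i\<^sub>V x)\<^sup>2)"
    let ?D = "D + ((1 * h M x q + ?H * x) * (v\<^sub>L q - v\<^sub>V x) + (0 - - 1 / (i\<^sub>V x)\<^sup>2) * S x q)"
    have "((\<lambda>x. f_K (Vap M) x w\<^sub>V + S x q * (v\<^sub>L q - v\<^sub>V x)) has_real_derivative ?D) (at x)"
      unfolding S_def
      by (intro DERIV_add DERIV_mult DERIV_diff DERIV_ident DERIV_const D h_deriv_vapor
          V.vol_deriv_pos x0)
    moreover have "?D \<ge> 0"
    proof -
      have "v\<^sub>L q - v\<^sub>V x + (q - x) / (i\<^sub>V x)\<^sup>2 \<le> 0"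
        using subsonic_vapor_persists[OF dom(1) xd x(1) qL T] by simp
      hence "?H * x \<le> 0" using tau x0 by (intro mult_nonpos_nonneg mult_nonneg_nonpos) auto
      moreover have "h M x q \<le> 0" using S[OF x] x0 by (simp add: S_def mult_le_0_iff)
      ultimately have "1 * h M x q + ?H * x \<le> 0" by linarith
      hence "(1 * h M x q + ?H * x) * (v\<^sub>L q - v\<^sub>V x) \<ge> 0"
        by (rule mult_nonpos_nonpos) (use v\<^sub>L_less[OF xd qL] in simp)
      moreover have "- i\<^sub>V x / (i\<^sub>V x)\<^sup>2 \<le> S x q / (i\<^sub>V x)\<^sup>2"
        using S[OF x] by (intro divide_right_mono) auto
      hence "- (1 / i\<^sub>V x) \<le> (0 - - 1 / (i\<^sub>V x)\<^sup>2) * S x q"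
        using i\<^sub>V_pos[OF x0] by (simp add: power2_eq_square)
      ultimately show ?thesis using D(2) by linarith
    qed
    ultimately show "\<exists>y. ((\<lambda>x. f_K (Vap M) x w\<^sub>V + S x q * (v\<^sub>L q - v\<^sub>V x)) has_real_derivative y) (at x) \<and> 0 \<le> y"
      by blast
  qed (use le in simp)
  moreover have "S p' q * (v\<^sub>L q - v\<^sub>V p') \<le> S p' (\<phi> p') * (v\<^sub>L (\<phi> p') - v\<^sub>V p')"
  proof -
    have "- S p' q * (v\<^sub>V p' - v\<^sub>L q) \<le> - S p' (\<phi> p') * (v\<^sub>V p' - v\<^sub>L (\<phi> p'))"
      using S_antimono_liquid[OF dom(2) qL less_imp_le[OF q']] S[of p'] le q'
        L.vol_strict_antimono[OF qL q'] v\<^sub>L_less[OF dom(2) qL]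
      by (intro mult_mono) auto
    thus ?thesis by (simp add: algebra_simps)
  qed
  moreover have "f_K (Liq M) q w\<^sub>L < f_K (Liq M) (\<phi> p') w\<^sub>L"
    by (rule L.f_K_strict_mono[OF w(2) q0 q'])
  ultimately show ?thesis by (simp add: f_z_def zflux_S q_def)
qed

end

subsection \<open>Below the saturation pressure\<close>

text \<open>In the notation of the next lemma, \<open>A\<close> and \<open>B\<close> are the partial derivatives of the interface
  equation, so that \<open>- A / B\<close> is the slope of \<open>\<phi>\<close>. It may be negative; but this requires
  \<open>z < i\<close>, and then it is outweighed by the other terms because \<open>D\<^sub>L \<le> 1 / i\<close>.\<close>

lemma slope_positive:
  fixes p \<tau> i l d z D\<^sub>V D\<^sub>L :: real
  assumes pos: "p > 0" "\<tau> > 0" "i > 0" "d > 0" "z > 0"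
    and l: "z < l" "i \<le> l"
    and D: "1 / i \<le> D\<^sub>V" "1 / l \<le> D\<^sub>L" "D\<^sub>L \<le> 1 / i"
    and G: "i\<^sup>2 * d \<le> p" "1 - p * \<tau> * i * d\<^sup>2 \<le> i\<^sup>2 * d / p"
  defines "S\<^sub>p \<equiv> z / p + p * (\<tau> / 2 * (- d + z\<^sup>2 * d / i\<^sup>2))"
    and "S\<^sub>q \<equiv> p * (\<tau> / 2 * (- d + z\<^sup>2 * d / l\<^sup>2))"
  defines "A \<equiv> - 1 - (2 * z * S\<^sub>p * d - z\<^sup>2 / i\<^sup>2)"
    and "B \<equiv> 1 - (2 * z * S\<^sub>q * d + z\<^sup>2 / l\<^sup>2)"
  shows "B > 0"
    and "D\<^sub>V + D\<^sub>L * (- A / B) + (S\<^sub>p + S\<^sub>q * (- A / B)) * (- d) + z * (1 / i\<^sup>2 - (- A / B) / l\<^sup>2) > 0"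
proof -
  \<comment> \<open>Dimensionless quantities: \<open>m\<close> is the flux relative to the vapor
    impedance, \<mu> the squared ratio on the liquid side, \<kappa> the kinetic coefficient, and
    \<open>g\<close> the vapor \<open>gamma\<close> formed with the volume jump
    \<open>d\<close>.\<close>
  define m \<mu> \<kappa> g where "m = z / i" and "\<mu> = (z / l)\<^sup>2" and "\<kappa> = p * \<tau> * i * d\<^sup>2" and "g = i\<^sup>2 * d / p"
  define e where "e = p * \<tau> * d / 2"
  define N where "N = (1 - m\<^sup>2) * (1 - m * \<kappa>) + 2 * m\<^sup>2 * g"
  have l0: "l > 0" using l pos by simp
  have m: "m > 0" and \<kappa>: "\<kappa> > 0" and g: "0 < g" "g \<le> 1" "1 - \<kappa> \<le> g"
    using pos G by (auto simp: m_def \<kappa>_def g_def)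
  have \<mu>: "\<mu> < 1" "\<mu> \<le> m\<^sup>2"
  proof -
    have "z / l < 1" using l l0 by simp
    thus "\<mu> < 1" using pos l0 by (simp add: \<mu>_def power_less_one_iff)
    show "\<mu> \<le> m\<^sup>2" unfolding \<mu>_def m_def using pos l l0
      by (intro power_mono divide_left_mono) auto
  qed
  have E: "1 + m * \<kappa> > 0" using m \<kappa> by (simp add: add_pos_pos)
  have Sq: "S\<^sub>q = - e * (1 - \<mu>)"
    by (simp add: e_def S\<^sub>q_def \<mu>_def power_divide algebra_simps)
  have Sp: "S\<^sub>p = z / p - e * (1 - m\<^sup>2)"
    by (simp add: e_def S\<^sub>p_def m_def power_divide algebra_simps)
  have zm: "z = m * i" using pos by (simp add: m_def)
  have mk: "z * (p * \<tau> * d) * d = m * \<kappa>"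
    using pos by (simp add: m_def \<kappa>_def power2_eq_square)
  have mg: "z * (z / p) * d = m\<^sup>2 * g"
    using pos by (simp add: m_def g_def power_divide power2_eq_square)
  have B: "B = (1 - \<mu>) * (1 + m * \<kappa>)"
  proof -
    have "2 * z * S\<^sub>q * d = - (z * (p * \<tau> * d) * d) * (1 - \<mu>)" by (simp add: Sq e_def)
    hence "B = 1 - (- (m * \<kappa>) * (1 - \<mu>) + \<mu>)"
      unfolding B_def mk by (simp add: \<mu>_def power_divide)
    thus ?thesis by (simp add: algebra_simps)
  qed
  show B0: "B > 0" unfolding B using \<mu> E by simp
  have A: "A = - N"
  proof -
    have "2 * z * S\<^sub>p * d = 2 * (z * (z / p) * d) - (z * (p * \<tau> * d) * d) * (1 - m\<^sup>2)"
      by (simp add: Sp e_def algebra_simps diff_divide_distrib)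
    hence "A = - 1 - (2 * (m\<^sup>2 * g) - m * \<kappa> * (1 - m\<^sup>2) - m\<^sup>2)"
      unfolding A_def mk mg by (simp add: m_def power_divide)
    thus ?thesis by (simp add: N_def algebra_simps)
  qed
  define r where "r = N / B"
  have rB: "r * ((1 - \<mu>) * (1 + m * \<kappa>)) = N" using \<mu> E unfolding B r_def by simp
  define T where "T = D\<^sub>V + D\<^sub>L * r + (S\<^sub>p + S\<^sub>q * r) * (- d) + z * (1 / i\<^sup>2 - r / l\<^sup>2)"
  \<comment> \<open>Multiplication by \<open>i * (1 + m * \<kappa>)\<close> clears the denominator:
    \<mu> disappears because \<open>r * ((1 - \<mu>) * (1 + m * \<kappa>))\<close> is
    \<open>N\<close>.\<close>
  have "i * (1 + m * \<kappa>) * (S\<^sub>p + S\<^sub>q * r) * (- d) = \<kappa> * (1 - m\<^sup>2) - m * g"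
  proof -
    have "i * (1 + m * \<kappa>) * (S\<^sub>p + S\<^sub>q * r) * (- d)
      = - (i * d * z / p) * (1 + m * \<kappa>) + i * e * d
          * ((1 - m\<^sup>2) * (1 + m * \<kappa>) + r * ((1 - \<mu>) * (1 + m * \<kappa>)))"
      unfolding Sp Sq by (simp add: algebra_simps add_divide_distrib)
    also have "i * d * z / p = m * g" using pos by (simp add: zm g_def power2_eq_square)
    also have "i * e * d = \<kappa> / 2" by (simp add: e_def \<kappa>_def power2_eq_square)
    also have "- (m * g) * (1 + m * \<kappa>) + \<kappa> / 2 * ((1 - m\<^sup>2) * (1 + m * \<kappa>) + r * ((1 - \<mu>) * (1 + m * \<kappa>)))
       = \<kappa> * (1 - m\<^sup>2) - m * g"
      unfolding rB N_def by (simp add: algebra_simps power2_eq_square)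
    finally show ?thesis .
  qed
  moreover have "i * (1 + m * \<kappa>) * (z * (1 / i\<^sup>2)) = m * (1 + m * \<kappa>)"
    using pos by (simp add: m_def power2_eq_square)
  ultimately have T: "i * (1 + m * \<kappa>) * T = i * D\<^sub>V * (1 + m * \<kappa>) + \<kappa> * (1 - m\<^sup>2) - m * g
      + m * (1 + m * \<kappa>) + i * (D\<^sub>L - z / l\<^sup>2) * (r * (1 + m * \<kappa>))"
    unfolding T_def by (simp add: algebra_simps)
  have iD: "i * D\<^sub>V \<ge> 1" "i * D\<^sub>L \<le> 1" "D\<^sub>L - z / l\<^sup>2 > 0"
  proof -
    show "i * D\<^sub>V \<ge> 1" "i * D\<^sub>L \<le> 1" using D pos by (auto simp: field_simps)
    have "z / l\<^sup>2 < 1 / l" using l l0 by (simp add: field_simps power2_eq_square)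
    thus "D\<^sub>L - z / l\<^sup>2 > 0" using D by simp
  qed
  have main: "(1 + m * \<kappa>) + \<kappa> * (1 - m\<^sup>2) - m * g + m * (1 + m * \<kappa>) \<ge> 1 + \<kappa> + m * \<kappa>"
  proof -
    have "m * g \<le> m" using m g by simp
    thus ?thesis by (simp add: algebra_simps power2_eq_square)
  qed
  have "i * (D\<^sub>L - z / l\<^sup>2) * (r * (1 + m * \<kappa>)) \<ge> - (m * \<kappa>)"
  proof (cases "N \<ge> 0")
    case True
    hence "r \<ge> 0" using B0 by (simp add: r_def)
    hence "i * (D\<^sub>L - z / l\<^sup>2) * (r * (1 + m * \<kappa>)) \<ge> 0"
      using iD(3) pos(3) E by (intro mult_nonneg_nonneg) auto
    moreover have "m * \<kappa> > 0" using m \<kappa> by simp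
    ultimately show ?thesis by linarith
  next
    case False
    \<comment> \<open>For \<open>m \<ge> 1\<close> the inequality
      \<open>1 - \<kappa> \<le> g\<close> makes \<open>N\<close> positive, so a negative slope
      occurs only for a flux below the vapor impedance.\<close>
    have m1: "m < 1"
    proof (rule ccontr)
      assume "\<not> m < 1"
      hence m1: "m \<ge> 1" "m\<^sup>2 \<ge> 1" by auto
      have "1 - m * \<kappa> \<le> g" using mult_right_mono[OF m1(1), of \<kappa>] \<kappa> g(3) by linarith
      hence "(m\<^sup>2 - 1) * (1 - m * \<kappa>) \<le> (m\<^sup>2 - 1) * g" using m1 by (intro mult_left_mono) auto
      moreover have "N = - ((m\<^sup>2 - 1) * (1 - m * \<kappa>)) + 2 * (m\<^sup>2 * g)"
        by (simp add: N_def algebra_simps)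
      moreover have "(m\<^sup>2 - 1) * g = m\<^sup>2 * g - g" by (simp add: algebra_simps)
      moreover have "m\<^sup>2 * g > 0" using m g by simp
      ultimately show False using False g by linarith
    qed
    hence m2: "m\<^sup>2 < 1" using m by (simp add: power_less_one_iff)
    define y where "y = r * (1 + m * \<kappa>)"
    have yN: "y * (1 - \<mu>) = N" using rB unfolding y_def by (simp only: mult_ac)
    have y0: "y \<le> 0"
      using False B0 E by (simp add: y_def r_def mult_nonpos_nonneg divide_nonpos_pos)
    have "N \<ge> (1 - m\<^sup>2) * (- (m * \<kappa>))"
    proof -
      have "(1 - m\<^sup>2) * (1 - m * \<kappa>) \<ge> (1 - m\<^sup>2) * (- (m * \<kappa>))" using m2 by (intro mult_left_mono) auto
      moreover have "2 * m\<^sup>2 * g \<ge> 0" using g by simp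
      ultimately show ?thesis unfolding N_def by linarith
    qed
    \<comment> \<open>As \<open>y\<close> is nonpositive and \<open>\<mu> \<le> m\<^sup>2\<close>,
      the unknown factor \<open>1 - \<mu>\<close> can be exchanged for \<open>1 - m\<^sup>2\<close>
      and cancelled. The loss is then at most \<open>m * \<kappa>\<close>, which is the reserve in
      \<open>main\<close>.\<close>
    moreover have "(1 - m\<^sup>2) * y \<ge> (1 - \<mu>) * y" using \<mu>(2) y0 by (intro mult_right_mono_neg) auto
    ultimately have "(1 - m\<^sup>2) * (- (m * \<kappa>)) \<le> (1 - m\<^sup>2) * y" using yN by (simp add: mult.commute)
    hence 1: "- (m * \<kappa>) \<le> y" by (rule mult_left_le_imp_le) (use m2 in simp)
    have "i * (D\<^sub>L - z / l\<^sup>2) \<le> 1"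
    proof -
      have "i * (z / l\<^sup>2) \<ge> 0" using pos by simp
      thus ?thesis using iD(2) by (simp add: right_diff_distrib)
    qed
    hence "1 * y \<le> i * (D\<^sub>L - z / l\<^sup>2) * y" using y0 by (intro mult_right_mono_neg) auto
    thus ?thesis using 1 by (simp add: y_def)
  qed
  moreover have "1 + m * \<kappa> \<le> i * D\<^sub>V * (1 + m * \<kappa>)"
    using mult_right_mono[OF iD(1), of "1 + m * \<kappa>"] E by simp
  moreover have "1 + \<kappa> \<le> a + b - c + f + x"
    if "- (m * \<kappa>) \<le> x" "1 + m * \<kappa> \<le> a" "1 + \<kappa> + m * \<kappa> \<le> 1 + m * \<kappa> + b - c + f"
    for a b c f x :: real using that by linarith
  ultimately have "i * (1 + m * \<kappa>) * T \<ge> 1 + \<kappa>" using main unfolding T by blast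
  hence "i * (1 + m * \<kappa>) * T > 0" using \<kappa> by linarith
  moreover have "i * (1 + m * \<kappa>) > 0" using pos(3) E by simp
  ultimately have "T > 0" by (rule zero_less_mult_pos)
  thus "D\<^sub>V + D\<^sub>L * (- A / B) + (S\<^sub>p + S\<^sub>q * (- A / B)) * (- d) + z * (1 / i\<^sup>2 - (- A / B) / l\<^sup>2) > 0"
    by (simp add: T_def r_def A)
qed

context two_phase_setting
begin

lemma S_has_derivative:
  assumes "0 < p" "0 < q"
  shows "((\<lambda>x. S (fst x) (snd x)) has_derivative (\<lambda>(s, t).
      (h M p q + p * (tau M / 2 * (v\<^sub>L q - v\<^sub>V p + (q - p) / (i\<^sub>V p)\<^sup>2))) * s
      + p * (tau M / 2 * (v\<^sub>L q - v\<^sub>V p + (q - p) / (i\<^sub>L q)\<^sup>2)) * t)) (at (p, q))"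
proof -
  note fst = has_derivative_fst[OF has_derivative_ident[of "at (p, q)"]]
    and snd = has_derivative_snd[OF has_derivative_ident[of "at (p, q)"]]
  note gV = DERIV_compose_FDERIV[OF V.gib_deriv_pos fst, simplified, OF assms(1)]
    and vV = DERIV_compose_FDERIV[OF V.vol_deriv_pos fst, simplified, OF assms(1)]
    and gL = DERIV_compose_FDERIV[OF L.gib_deriv_pos snd, simplified, OF assms(2)]
    and vL = DERIV_compose_FDERIV[OF L.vol_deriv_pos snd, simplified, OF assms(2)]
  show ?thesis
    unfolding S_def h_def
    by (rule has_derivative_eq_rhs, (rule derivative_intros fst snd gV gL vV vL)+)
      (auto simp: fun_eq_iff algebra_simps add_divide_distrib diff_divide_distrib)
qed

lemma phi_pos: "p \<in> dom \<Longrightarrow> 0 < \<phi> p"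
  using phi_root(4)[of p] dom_pos[of p] by simp

lemma open_dom_below:
  assumes "p \<in> dom" "p < b" "b \<in> dom"
  shows "\<forall>\<^sub>F x in nhds p. x \<in> dom"
proof -
  have "\<forall>\<^sub>F x in nhds p. x \<in> {0<..<b}"
    using dom_pos[OF assms(1)] assms(2) by (intro eventually_nhds_in_open) auto
  thus ?thesis by eventually_elim (use dom_below[OF assms(3)] in auto)
qed

lemma f_z_deriv_below:
  assumes p: "p \<in> dom" "p < psat M"
    and w: "fst w\<^sub>V \<in> prange (Vap M)" "fst w\<^sub>L \<in> prange (Liq M)"
  obtains D where "((\<lambda>p. f_z M p w\<^sub>V w\<^sub>L) has_real_derivative D) (at p)" "D > 0"
proof -
  define q where "q = \<phi> p"
  define d where "d = v\<^sub>V p - v\<^sub>L q"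
  define Z where "Z = z p"
  have p0: "0 < p" and q0: "0 < q" using dom_pos phi_pos p by (auto simp: q_def)
  have qL: "q \<in> prange (Liq M)" using phi_root(1)[OF p(1)] by (simp add: q_def)
  have d: "d > 0" using v\<^sub>L_less[OF p(1) qL] by (simp add: d_def)
  have Z: "Z > 0" "Z = S p q" using zflux_pos[OF p] by (auto simp: Z_def zflux_S q_def)
  have root: "q - p = Z\<^sup>2 * d" using phi_root(2)[OF p(1)] by (simp add: q_def d_def Z_def)
  define S\<^sub>p where "S\<^sub>p = Z / p + p * (tau M / 2 * (- d + Z\<^sup>2 * d / (i\<^sub>V p)\<^sup>2))"
  define S\<^sub>q where "S\<^sub>q = p * (tau M / 2 * (- d + Z\<^sup>2 * d / (i\<^sub>L q)\<^sup>2))"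
  have "Z / p = h M p q" using Z p0 by (simp add: S_def)
  hence dS: "((\<lambda>x. S (fst x) (snd x)) has_derivative (\<lambda>(s, t). S\<^sub>p * s + S\<^sub>q * t)) (at (p, q))"
    using S_has_derivative[OF p0 q0] unfolding S\<^sub>p_def S\<^sub>q_def root d_def by simp
  define A where "A = - 1 - (2 * Z * S\<^sub>p * d - Z\<^sup>2 / (i\<^sub>V p)\<^sup>2)"
  define B where "B = 1 - (2 * Z * S\<^sub>q * d + Z\<^sup>2 / (i\<^sub>L q)\<^sup>2)"
  let ?F = "\<lambda>x. snd x - fst x - (S (fst x) (snd x))\<^sup>2 * (v\<^sub>V (fst x) - v\<^sub>L (snd x))"
  note fst = has_derivative_fst[OF has_derivative_ident[of "at (p, q)"]]
    and snd = has_derivative_snd[OF has_derivative_ident[of "at (p, q)"]]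
  note vV = DERIV_compose_FDERIV[OF V.vol_deriv_pos fst, simplified, OF p0]
    and vL = DERIV_compose_FDERIV[OF L.vol_deriv_pos snd, simplified, OF q0]
  have dF: "(?F has_derivative (\<lambda>(s, t). A * s + B * t)) (at (p, \<phi> p))"
    unfolding q_def[symmetric]
    by (rule has_derivative_eq_rhs, (rule derivative_intros fst snd vV vL dS)+)
      (auto simp: fun_eq_iff A_def B_def Z(2)[symmetric] d_def algebra_simps)
  obtain D\<^sub>V where D\<^sub>V: "((\<lambda>p. f_K (Vap M) p w\<^sub>V) has_real_derivative D\<^sub>V) (at p)" "1 / i\<^sub>V p \<le> D\<^sub>V"
    using V.f_K_deriv[OF w(1), of "p/2" p] p0 by (auto simp: prange_Vap)
  obtain D\<^sub>L where D\<^sub>L: "((\<lambda>q. f_K (Liq M) q w\<^sub>L) has_real_derivative D\<^sub>L) (at q)" "1 / i\<^sub>L q \<le> D\<^sub>L"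
    "D\<^sub>L \<le> 1 / i\<^sub>L (min q (fst w\<^sub>L))"
    using L.f_K_deriv[OF w(2), of 0 q] q0 pos_in_Liq by auto
  have slope: "B > 0"
    "D\<^sub>V + D\<^sub>L * (- A / B) + (S\<^sub>p + S\<^sub>q * (- A / B)) * (- d) + Z * (1 / (i\<^sub>V p)\<^sup>2 - (- A / B) / (i\<^sub>L q)\<^sup>2) > 0"
  proof -
    \<comment> \<open>The bound on the liquid wave involves the impedance at a pressure that may be
      lower than \<open>q\<close>, even negative; the comparison of impedances holds at every liquid
      pressure.\<close>
    have "min q (fst w\<^sub>L) \<in> prange (Liq M)" using qL w(2) by (simp add: min_def)
    hence "1 / i\<^sub>L (min q (fst w\<^sub>L)) \<le> 1 / i\<^sub>V p"
      using i\<^sub>V_le_i\<^sub>L[OF p(1)] i\<^sub>V_pos[OF p0] by (simp add: frac_le)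
    hence D: "D\<^sub>L \<le> 1 / i\<^sub>V p" using D\<^sub>L(3) by simp
    have l: "Z < i\<^sub>L q" using phi_root(6)[OF p(1)] by (simp add: Z_def q_def)
    have dv: "d \<le> v\<^sub>V p" using v\<^sub>L_pos[OF qL] by (simp add: d_def)
    have "(i\<^sub>V p)\<^sup>2 * d \<le> (i\<^sub>V p)\<^sup>2 * v\<^sub>V p" using dv by (intro mult_left_mono) auto
    hence G1: "(i\<^sub>V p)\<^sup>2 * d \<le> p" using i\<^sub>V_v\<^sub>V_le[OF p(1)] by simp
    have ad: "(1 - alpha M) * v\<^sub>V p \<le> d" using v\<^sub>L_le[OF p(1) qL] by (simp add: d_def algebra_simps)
    have a0: "0 \<le> (1 - alpha M) * v\<^sub>V p" using alpha v\<^sub>V_pos[OF p0] by simp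
    \<comment> \<open>The left side decreases and the right side increases with the volume jump, so
      it suffices to check the smallest possible jump \<open>(1 - alpha M) * v\<^sub>V p\<close>,
      where this is \<open>one_minus_k_le\<close>.\<close>
    have "1 - p * tau M * i\<^sub>V p * d\<^sup>2 \<le> 1 - tau M * p * i\<^sub>V p * ((1 - alpha M) * v\<^sub>V p)\<^sup>2"
      using power_mono[OF ad a0, of 2] p0 tau i\<^sub>V_pos[OF p0] by (simp add: mult.commute mult_left_mono)
    also have "\<dots> \<le> (1 - alpha M) * gamma (Vap M) p" by (rule one_minus_k_le[OF p(1)])
    also have "\<dots> = (i\<^sub>V p)\<^sup>2 * ((1 - alpha M) * v\<^sub>V p) / p" by (simp add: gamma\<^sub>V_eq[OF p0])
    also have "\<dots> \<le> (i\<^sub>V p)\<^sup>2 * d / p" using ad p0 by (intro divide_right_mono mult_left_mono) auto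
    finally have G2: "1 - p * tau M * i\<^sub>V p * d\<^sup>2 \<le> (i\<^sub>V p)\<^sup>2 * d / p" .
    note slope = slope_positive[OF p0 tau i\<^sub>V_pos[OF p0] d Z(1) l i\<^sub>V_le_i\<^sub>L[OF p(1) qL] D\<^sub>V(2) D\<^sub>L(2) D G1 G2]
    show "B > 0"
      "D\<^sub>V + D\<^sub>L * (- A / B) + (S\<^sub>p + S\<^sub>q * (- A / B)) * (- d) + Z * (1 / (i\<^sub>V p)\<^sup>2 - (- A / B) / (i\<^sub>L q)\<^sup>2) > 0"
      using slope unfolding A_def B_def S\<^sub>p_def S\<^sub>q_def by blast+
  qed
  define r where "r = - A / B"
  have near: "\<forall>\<^sub>F x in nhds p. x \<in> dom" by (rule open_dom_below[OF p psat_in_dom])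
  have "p \<in> interior dom" using near by (simp add: eventually_nhds interior_def) blast
  hence cont: "isCont \<phi> p" using continuous_on_interior[OF continuous_phi] by blast
  have dphi: "(\<phi> has_real_derivative r) (at p)"
    unfolding r_def
  proof (rule implicit_derivative[OF dF _ cont])
    show "\<forall>\<^sub>F x in nhds p. ?F (x, \<phi> x) = 0"
      using near by eventually_elim (use phi_root(2) in \<open>simp add: zflux_S\<close>)
  qed (use slope(1) in simp)
  have "((\<lambda>x. (x, \<phi> x)) has_derivative (\<lambda>s. (s, r * s))) (at p)"
    using has_derivative_Pair[OF has_derivative_ident dphi[unfolded has_field_derivative_def]] .
  from has_derivative_compose[OF this dS[unfolded q_def]]
  have "((\<lambda>x. S x (\<phi> x)) has_derivative (\<lambda>s. S\<^sub>p * s + S\<^sub>q * (r * s))) (at p)" by simp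
  hence dz: "((\<lambda>x. S x (\<phi> x)) has_real_derivative S\<^sub>p + S\<^sub>q * r) (at p)"
    unfolding has_field_derivative_def by (rule has_derivative_eq_rhs) (simp add: fun_eq_iff algebra_simps)
  note dv = DERIV_chain2[OF L.vol_deriv_pos[OF phi_pos[OF p(1)]] dphi]
  have "((\<lambda>x. f_K (Vap M) x w\<^sub>V + f_K (Liq M) (\<phi> x) w\<^sub>L + S x (\<phi> x) * (v\<^sub>L (\<phi> x) - v\<^sub>V x)
      + snd w\<^sub>L - snd w\<^sub>V) has_real_derivative
      D\<^sub>V + D\<^sub>L * r + ((S\<^sub>p + S\<^sub>q * r) * (v\<^sub>L q - v\<^sub>V p)
        + (- 1 / (i\<^sub>L q)\<^sup>2 * r - - 1 / (i\<^sub>V p)\<^sup>2) * S p q) + 0 - 0) (at p)"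
    unfolding q_def
    by (intro DERIV_diff DERIV_add DERIV_mult DERIV_const D\<^sub>V(1) dz dv V.vol_deriv_pos p0
        DERIV_chain2[OF D\<^sub>L(1)[unfolded q_def] dphi])
  moreover have "D\<^sub>V + D\<^sub>L * r + ((S\<^sub>p + S\<^sub>q * r) * (v\<^sub>L q - v\<^sub>V p)
        + (- 1 / (i\<^sub>L q)\<^sup>2 * r - - 1 / (i\<^sub>V p)\<^sup>2) * S p q) + 0 - 0
     = D\<^sub>V + D\<^sub>L * r + (S\<^sub>p + S\<^sub>q * r) * (- d) + Z * (1 / (i\<^sub>V p)\<^sup>2 - r / (i\<^sub>L q)\<^sup>2)"
    by (simp add: Z(2) d_def algebra_simps)
  ultimately have "((\<lambda>p. f_z M p w\<^sub>V w\<^sub>L) has_real_derivative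
      D\<^sub>V + D\<^sub>L * r + (S\<^sub>p + S\<^sub>q * r) * (- d) + Z * (1 / (i\<^sub>V p)\<^sup>2 - r / (i\<^sub>L q)\<^sup>2)) (at p)"
    unfolding f_z_def zflux_S by (simp only:)
  thus thesis using slope(2) unfolding r_def by (rule that)
qed

lemma continuous_f_z:
  assumes w: "fst w\<^sub>V \<in> prange (Vap M)" "fst w\<^sub>L \<in> prange (Liq M)"
  shows "continuous_on dom (\<lambda>p. f_z M p w\<^sub>V w\<^sub>L)"
proof -
  note phi = continuous_phi
  have pos: "dom \<subseteq> {0<..}" "\<phi> ` dom \<subseteq> {0<..}" "dom \<subseteq> prange (Vap M)" "\<phi> ` dom \<subseteq> prange (Liq M)"
    using dom_pos phi_pos dom_range(1) phi_root(1) by auto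
  note cV = continuous_on_subset[OF V.continuous_vol pos(3)]
    continuous_on_subset[OF V.continuous_gib pos(3)]
    and cL = continuous_on_compose2[OF L.continuous_vol phi pos(4)]
    continuous_on_compose2[OF L.continuous_gib phi pos(4)]
  show ?thesis
    unfolding f_z_def zflux_S S_def h_def
    by (intro continuous_intros continuous_on_subset[OF V.continuous_f_K[OF w(1)] pos(1)]
        continuous_on_compose2[OF L.continuous_f_K[OF w(2)] phi pos(2)] cV cL phi) auto
qed

lemma f_z_strict_mono:
  assumes dom: "p \<in> dom" "p' \<in> dom" "p < p'"
    and w: "fst w\<^sub>V \<in> prange (Vap M)" "fst w\<^sub>L \<in> prange (Liq M)"
  shows "f_z M p w\<^sub>V w\<^sub>L < f_z M p' w\<^sub>V w\<^sub>L"
proof -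
  have below: "f_z M x w\<^sub>V w\<^sub>L < f_z M y w\<^sub>V w\<^sub>L" if xy: "x \<in> dom" "x < y" "y \<le> psat M" for x y
  proof (rule DERIV_pos_imp_increasing_open[OF xy(2)])
    have sub: "{x..y} \<subseteq> dom"
      using dom_below[OF psat_in_dom] dom_pos[OF xy(1)] xy by auto
    thus "continuous_on {x..y} (\<lambda>p. f_z M p w\<^sub>V w\<^sub>L)"
      by (rule continuous_on_subset[OF continuous_f_z[OF w]])
    fix t assume t: "x < t" "t < y"
    hence "t \<in> dom" "t < psat M" using sub xy by auto
    from f_z_deriv_below[OF this w]
    show "\<exists>D. ((\<lambda>p. f_z M p w\<^sub>V w\<^sub>L) has_real_derivative D) (at t) \<and> 0 < D" by blast
  qed
  consider "p' \<le> psat M" | "psat M \<le> p" | "p < psat M" "psat M < p'" by linarith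
  thus ?thesis
  proof cases
    case 1 thus ?thesis using below dom by blast
  next
    case 2 thus ?thesis using f_z_strict_mono_above dom w by blast
  next
    case 3
    thus ?thesis
      using below[OF dom(1) 3(1)] f_z_strict_mono_above[OF psat_in_dom dom(2) _ 3(2) w] by simp
  qed
qed

section \<open>Divergence of \<open>f_z\<close> towards vacuum\<close>

text \<open>Since \<open>gamma \<le> 1\<close>, the product \<open>x * v\<^sub>V x\<close> is at
  least its value \<open>c\<close> at \<open>p'\<close>, and \<open>1 / i\<^sub>V x \<ge> sqrt
  (v\<^sub>V x / x) \<ge> sqrt c / x\<close>. Integration gives the logarithm.\<close>

lemma rinv_lower_bound:
  assumes "0 < p" "p \<le> p'" "p' \<in> dom"
  shows "sqrt (p' * v\<^sub>V p') * (ln p' - ln p) \<le> rinv (Vap M) p' - rinv (Vap M) p"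
proof -
  define c where "c = p' * v\<^sub>V p'"
  have p'0: "p' > 0" using assms by simp
  have c0: "c > 0" using p'0 v\<^sub>V_pos by (simp add: c_def)
  have xd: "x \<in> dom" if "0 < x" "x \<le> p'" for x using dom_below[OF assms(3)] that by simp
  have cv: "c \<le> x * v\<^sub>V x" if x: "0 < x" "x \<le> p'" for x
  proof -
    have "- (x * v\<^sub>V x) \<le> - (p' * v\<^sub>V p')"
    proof (rule DERIV_nonneg_imp_nondecreasing[OF x(2)])
      fix y assume y: "x \<le> y" "y \<le> p'"
      hence y0: "y > 0" using x by simp
      have "((\<lambda>y. - (y * v\<^sub>V y)) has_real_derivative - (1 * v\<^sub>V y + - 1 / (i\<^sub>V y)\<^sup>2 * y)) (at y)"
        by (intro DERIV_minus DERIV_mult DERIV_ident V.vol_deriv_pos y0)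
      moreover have "- (1 * v\<^sub>V y + - 1 / (i\<^sub>V y)\<^sup>2 * y) \<ge> 0"
        using i\<^sub>V_v\<^sub>V_le[OF xd[OF y0 y(2)]] i\<^sub>V_pos[OF y0] by (simp add: pos_le_divide_eq mult.commute)
      ultimately show "\<exists>D. ((\<lambda>y. - (y * v\<^sub>V y)) has_real_derivative D) (at y) \<and> 0 \<le> D" by blast
    qed
    thus ?thesis by (simp add: c_def)
  qed
  have "rinv (Vap M) p - sqrt c * ln p \<le> rinv (Vap M) p' - sqrt c * ln p'"
  proof (rule DERIV_nonneg_imp_nondecreasing[OF assms(2)])
    fix x assume x: "p \<le> x" "x \<le> p'"
    hence x0: "x > 0" using assms by simp
    have "((\<lambda>x. rinv (Vap M) x - sqrt c * ln x) has_real_derivative 1 / i\<^sub>V x - sqrt c * inverse x) (at x)"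
      using V.rinv_deriv_within[OF V.in_range_pos[OF x0]] unfolding V.at_within_range_pos[OF x0]
      by (intro DERIV_diff DERIV_cmult DERIV_ln x0)
    moreover have "1 / i\<^sub>V x - sqrt c * inverse x \<ge> 0"
    proof -
      have "(i\<^sub>V x)\<^sup>2 * c \<le> (i\<^sub>V x)\<^sup>2 * (x * v\<^sub>V x)"
        using cv[OF x0 x(2)] by (intro mult_left_mono) auto
      also have "\<dots> = x * ((i\<^sub>V x)\<^sup>2 * v\<^sub>V x)" by simp
      also have "\<dots> \<le> x * x" using i\<^sub>V_v\<^sub>V_le[OF xd[OF x0 x(2)]] x0 by (intro mult_left_mono) auto
      finally have "sqrt ((i\<^sub>V x)\<^sup>2 * c) \<le> sqrt (x * x)" by (rule real_sqrt_le_mono)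
      hence "i\<^sub>V x * sqrt c \<le> x" using x0 i\<^sub>V_pos[OF x0] by (simp add: real_sqrt_mult)
      thus ?thesis using x0 i\<^sub>V_pos[OF x0] by (simp add: field_simps)
    qed
    ultimately show "\<exists>D. ((\<lambda>x. rinv (Vap M) x - sqrt c * ln x) has_real_derivative D) (at x) \<and> 0 \<le> D"
      by blast
  qed
  thus ?thesis by (simp add: c_def algebra_simps)
qed

lemma f_z_negative_near_0:
  assumes w: "fst w\<^sub>V \<in> dom" "fst w\<^sub>L \<in> prange (Liq M)" and b: "0 < b"
  obtains p where "p \<in> dom" "p < b" "f_z M p w\<^sub>V w\<^sub>L < 0"
proof -
  define c where "c = sqrt (fst w\<^sub>V * v\<^sub>V (fst w\<^sub>V))"
  have w0: "fst w\<^sub>V > 0" using dom_pos[OF w(1)] .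
  have c: "c > 0" using w0 v\<^sub>V_pos by (simp add: c_def)
  define B where "B = psat M + 2 * psat M / (1 - alpha M)"
  define C where "C = \<bar>f_K (Liq M) B w\<^sub>L + snd w\<^sub>L - snd w\<^sub>V\<bar> + 1"
  \<comment> \<open>The exponential factor brings the logarithmic estimate of the vapor wave down to
    \<open>- C\<close>, which beats the liquid contribution by 1. Staying below
    \<open>psat M\<close> keeps \<phi> bounded and the flux nonnegative.\<close>
  define p where "p = min (min (psat M) (b / 2)) (fst w\<^sub>V * exp (- (C / c)))"
  have C: "C > 0" by (simp add: C_def)
  have p: "0 < p" "p \<le> psat M" "p < b" "p \<le> fst w\<^sub>V * exp (- (C / c))"
    using psat_pos b w0 by (auto simp: p_def)
  have pd: "p \<in> dom" using dom_below[OF psat_in_dom p(1,2)] .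
  have "ln p \<le> ln (fst w\<^sub>V * exp (- (C / c)))" using p w0 by simp
  also have "\<dots> = ln (fst w\<^sub>V) - C / c" using w0 by (simp add: ln_mult)
  finally have "C / c \<le> ln (fst w\<^sub>V) - ln p" by simp
  hence "C \<le> c * (ln (fst w\<^sub>V) - ln p)" using c by (simp add: pos_divide_le_eq mult.commute)
  have le: "p \<le> fst w\<^sub>V"
  proof -
    have "fst w\<^sub>V * exp (- (C / c)) \<le> fst w\<^sub>V * 1" using w0 C c by (intro mult_left_mono) auto
    thus ?thesis using p(4) by simp
  qed
  have "f_K (Vap M) p w\<^sub>V = rinv (Vap M) p - rinv (Vap M) (fst w\<^sub>V)"
    by (rule V.f_K_below[OF dom_range(1)[OF pd] le])
  also have "\<dots> \<le> - C"
    using rinv_lower_bound[OF p(1) le w(1)] \<open>C \<le> c * _\<close> by (simp add: c_def)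
  finally have 1: "f_K (Vap M) p w\<^sub>V \<le> - C" .
  have "\<phi> p \<le> B" using phi_le_below_psat[OF pd p(2)] p(2) by (simp add: B_def)
  hence 2: "f_K (Liq M) (\<phi> p) w\<^sub>L \<le> f_K (Liq M) B w\<^sub>L"
    by (intro L.f_K_mono w(2) phi_pos pd)
  have "z p \<ge> 0" using zflux_pos[OF pd] zflux_psat p(2) by (cases "p = psat M") (auto simp: less_imp_le)
  hence 3: "z p * (v\<^sub>L (\<phi> p) - v\<^sub>V p) \<le> 0"
    using v\<^sub>L_less[OF pd phi_root(1)[OF pd]] by (intro mult_nonneg_nonpos) auto
  have "f_z M p w\<^sub>V w\<^sub>L < 0"
    using 1 2 3 unfolding f_z_def C_def by linarith
  thus thesis using that pd p(3) by blast
qed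

end

section \<open>Solutions of the Riemann problem\<close>

text \<open>The Euler equations are demanded in the open fan only, where the two profiles agree near
  each point; this permits changing the profile outside.\<close>

lemma rarefaction_cong:
  assumes rf: "rarefaction K e w\<^sub>l w\<^sub>r s\<^sub>1 s\<^sub>2 w" and eq: "\<And>\<xi>. \<xi> \<in> {s\<^sub>1..s\<^sub>2} \<Longrightarrow> w' \<xi> = w \<xi>"
  shows "rarefaction K e w\<^sub>l w\<^sub>r s\<^sub>1 s\<^sub>2 w'"
  unfolding rarefaction_def
proof (intro conjI ballI allI impI)
  show s: "s\<^sub>1 \<le> s\<^sub>2" using rf by (simp add: rarefaction_def)
  thus "w' s\<^sub>1 = w\<^sub>l" "w' s\<^sub>2 = w\<^sub>r" using rf eq by (auto simp: rarefaction_def)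
  show "continuous_on {s\<^sub>1..s\<^sub>2} w'"
    by (rule continuous_on_eq[OF _ eq[symmetric]]) (use rf in \<open>auto simp: rarefaction_def\<close>)
  fix \<xi> assume "\<xi> \<in> {s\<^sub>1..s\<^sub>2}"
  thus "\<xi> = snd (w' \<xi>) + e * cs K (fst (w' \<xi>))" using rf eq by (simp add: rarefaction_def)
next
  fix t x :: real assume t: "t > 0" and x: "s\<^sub>1 < x / t \<and> x / t < s\<^sub>2"
  have near: "\<forall>\<^sub>F y in F. w' (f y) = w (f y)" if "(f \<longlongrightarrow> x / t) F" for f :: "real \<Rightarrow> real" and F
    using topological_tendstoD[OF that open_greaterThanLessThan[of s\<^sub>1 s\<^sub>2]] x
    by (auto elim!: eventually_mono intro: eq)
  have ev: "\<forall>\<^sub>F s in nhds t. w' (x / s) = w (x / s)" "\<forall>\<^sub>F y in nhds x. w' (y / t) = w (y / t)"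
    using t by (auto intro!: near tendsto_divide tendsto_const filterlim_ident)
  have E: "euler_at (\<lambda>t x. density K (fst (w (x / t)))) (\<lambda>t x. snd (w (x / t)))
      (\<lambda>t x. fst (w (x / t))) t x"
    using rf t x by (simp add: rarefaction_def)
  have cong_t: "((\<lambda>s. f (w' (x / s))) has_real_derivative D) (at t)
      \<longleftrightarrow> ((\<lambda>s. f (w (x / s))) has_real_derivative D) (at t)" for f :: "state \<Rightarrow> real" and D
    by (rule DERIV_cong_ev[OF refl eventually_mono[OF ev(1)] refl]) simp
  have cong_x: "((\<lambda>y. f (w' (y / t))) has_real_derivative D) (at x)
      \<longleftrightarrow> ((\<lambda>y. f (w (y / t))) has_real_derivative D) (at x)" for f :: "state \<Rightarrow> real" and D
    by (rule DERIV_cong_ev[OF refl eventually_mono[OF ev(2)] refl]) simp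
  show "euler_at (\<lambda>t x. density K (fst (w' (x / t)))) (\<lambda>t x. snd (w' (x / t)))
      (\<lambda>t x. fst (w' (x / t))) t x"
    using E unfolding euler_at_def
    using cong_t[of "\<lambda>v. density K (fst v)"] cong_t[of "\<lambda>v. density K (fst v) * snd v"]
      cong_x[of "\<lambda>v. density K (fst v) * snd v"]
      cong_x[of "\<lambda>v. density K (fst v) * (snd v)\<^sup>2 + fst v"]
    by simp
qed

context half_line_phase
begin

text \<open>\<open>b_solution\<close> prescribes the profiles beyond the fan as well, hence the
  constant continuation.\<close>

lemma rarefaction_profile:
  assumes e: "e = 1 \<or> e = -1" and pr: "p\<^sub>l \<in> prange K" "p\<^sub>r \<in> prange K"
    and c: "e * (p\<^sub>r - p\<^sub>l) \<ge> 0" and u: "u\<^sub>r - u\<^sub>l = e * (rinv K p\<^sub>r - rinv K p\<^sub>l)"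
  obtains w where
    "rarefaction K e (p\<^sub>l, u\<^sub>l) (p\<^sub>r, u\<^sub>r) (u\<^sub>l + e * cs K p\<^sub>l) (u\<^sub>r + e * cs K p\<^sub>r) w"
    and "\<And>\<xi>. \<xi> < u\<^sub>l + e * cs K p\<^sub>l \<Longrightarrow> w \<xi> = (p\<^sub>l, u\<^sub>l)"
    and "\<And>\<xi>. \<xi> > u\<^sub>r + e * cs K p\<^sub>r \<Longrightarrow> w \<xi> = (p\<^sub>r, u\<^sub>r)"
    and "\<And>\<xi>. fst (w \<xi>) \<in> {min p\<^sub>l p\<^sub>r..max p\<^sub>l p\<^sub>r}"
proof -
  let ?a = "u\<^sub>l + e * cs K p\<^sub>l" and ?b = "u\<^sub>r + e * cs K p\<^sub>r"
  obtain w where w: "rarefaction K e (p\<^sub>l, u\<^sub>l) (p\<^sub>r, u\<^sub>r) ?a ?b w"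
    and r: "\<And>\<xi>. \<xi> \<in> {?a..?b} \<Longrightarrow> fst (w \<xi>) \<in> {min p\<^sub>l p\<^sub>r..max p\<^sub>l p\<^sub>r}"
    using rarefactionI[OF assms] by blast
  define w' where "w' = (\<lambda>\<xi>. if \<xi> < ?a then (p\<^sub>l, u\<^sub>l) else if \<xi> > ?b then (p\<^sub>r, u\<^sub>r) else w \<xi>)"
  have ab: "?a \<le> ?b" using w by (simp add: rarefaction_def)
  show thesis
  proof (rule that)
    show "rarefaction K e (p\<^sub>l, u\<^sub>l) (p\<^sub>r, u\<^sub>r) ?a ?b w'"
      by (rule rarefaction_cong[OF w]) (simp add: w'_def)
    show "fst (w' \<xi>) \<in> {min p\<^sub>l p\<^sub>r..max p\<^sub>l p\<^sub>r}" for \<xi>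
      using r[of \<xi>] by (auto simp: w'_def)
  qed (use ab in \<open>auto simp: w'_def\<close>)
qed

lemma chord_impedance:
  assumes p: "p \<in> prange K" and "p < q"
  obtains x where "x \<in> {p<..<q}" "(impedance K x)\<^sup>2 = (q - p) / (vol K p - vol K q)"
proof -
  obtain x where x: "p < x" "x < q" "vol K p - vol K q = (q - p) / (impedance K x)\<^sup>2"
    using vol_mean_value[OF assms] .
  have "impedance K x > 0" using impedance_pos in_range_mono[OF p] x by simp
  hence "(impedance K x)\<^sup>2 = (q - p) / (vol K p - vol K q)" using x \<open>p < q\<close> by simp
  thus thesis using that x by simp
qed

end

context two_phase_setting
begin

text \<open>Under the jump conditions the energy jump is \<open>h M p q / tau M\<close>, so the
  kinetic relation reads \<open>Z = S p q\<close>, and uniqueness of the interface pressure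
  identifies \<open>q\<close>.\<close>

lemma phase_transition_iff:
  assumes p: "p \<in> dom" and q: "q \<in> prange (Liq M)"
  shows "phase_transition M (p, u) (q, u') W \<longleftrightarrow>
    q = \<phi> p \<and> u = W - z p * v\<^sub>V p \<and> u' = W - z p * v\<^sub>L q"
proof -
  note p0 = dom_pos[OF p]
  note pos = v\<^sub>V_pos[OF p0] v\<^sub>L_pos[OF q]
  let ?g = "gib (Liq M) q - gib (Vap M) p - (q - p) * (v\<^sub>L q + v\<^sub>V p) / 2"
  have S: "S p q = tau M * p * ?g" by (simp add: S_def h_def)
  show ?thesis
  proof
    assume t: "phase_transition M (p, u) (q, u') W"
    define Z where "Z = mass_flux (Vap M) W (p, u)"
    have flux: "mass_flux (Vap M) W (p, u) = Z" by (simp add: Z_def)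
    have u: "u = W - Z * v\<^sub>V p" using flux mass_flux_iff[OF pos(1)] by blast
    have j: "u' = W - Z * v\<^sub>L q" "q - p + Z\<^sup>2 * (v\<^sub>L q - v\<^sub>V p) = 0"
      using t jump_conditions_iff[OF pos flux] unfolding phase_transition_def by auto
    have "Z = S p q \<and> - i\<^sub>V p \<le> Z \<and> Z \<le> i\<^sub>L q"
      using t energy_jump_eq[OF u j] S
      unfolding phase_transition_def Let_def flux by (simp add: impedance_def)
    hence Z: "Z = S p q" "- i\<^sub>V p \<le> Z" "Z \<le> i\<^sub>L q" by auto
    have "q - p = Z\<^sup>2 * (v\<^sub>V p - v\<^sub>L q)" using j(2) by (simp add: right_diff_distrib)
    hence "interface_pressure M p q"
      unfolding interface_pressure_iff using Z q by simp
    hence "q = \<phi> p" by (rule phi_eqI[OF p])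
    thus "q = \<phi> p \<and> u = W - z p * v\<^sub>V p \<and> u' = W - z p * v\<^sub>L q"
      using u j Z by (simp add: zflux_S)
  next
    assume a: "q = \<phi> p \<and> u = W - z p * v\<^sub>V p \<and> u' = W - z p * v\<^sub>L q"
    have flux: "mass_flux (Vap M) W (p, u) = z p" using a mass_flux_iff[OF pos(1)] by blast
    have root: "q - p + (z p)\<^sup>2 * (v\<^sub>L q - v\<^sub>V p) = 0"
      using a phi_root(2)[OF p] by (simp add: right_diff_distrib)
    have zg: "z p = tau M * p * ?g" using a S by (simp add: zflux_S)
    \<comment> \<open>The entropy inequality follows from the kinetic relation, which makes
      \<open>z p * ?g\<close> a square divided by \<open>tau M * p\<close>.\<close>
    have "tau M * p * (z p * ?g) = (z p)\<^sup>2" unfolding zg by (simp add: power2_eq_square)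
    hence "tau M * p * 0 \<le> tau M * p * (z p * ?g)" by (simp only: mult_zero_right zero_le_power2)
    hence "z p * ?g \<ge> 0" by (rule mult_left_le_imp_le) (use tau p0 in simp)
    hence "jump_conditions (Vap M) (p, u) (Liq M) (q, u') W"
      unfolding jump_conditions_iff[OF pos flux] using a root by blast
    moreover have "energy_jump (Vap M) (p, u) (Liq M) (q, u') W = ?g"
      using a root by (intro energy_jump_eq) auto
    ultimately show "phase_transition M (p, u) (q, u') W"
      unfolding phase_transition_def Let_def flux
      using zg phi_root(3,6)[OF p] a by (simp add: impedance_def)
  qed
qed

text \<open>Both squared fluxes are ratios of pressure to volume differences along chords ending in
  the liquid state at \<phi> p. For \<open>p \<le> r\<close> the liquid chord is steeper by
  convexity and because the vapor volume at \<open>p\<close> exceeds the liquid one. For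
  \<open>r < p\<close> it spans a larger pressure difference over a volume difference that is no
  larger.\<close>

lemma liquid_shock_faster:
  assumes p: "p \<in> dom" and r: "r \<in> prange (Liq M)" "r < \<phi> p"
  shows "z p < sqrt ((\<phi> p - r) / (v\<^sub>L r - v\<^sub>L (\<phi> p)))"
proof -
  define q where "q = \<phi> p"
  define d where "d = v\<^sub>V p - v\<^sub>L q"
  define a where "a = v\<^sub>L r - v\<^sub>L q"
  have rq: "r < q" using r by (simp add: q_def)
  have root: "q - p = (z p)\<^sup>2 * d" using phi_root(2)[OF p] by (simp add: q_def d_def)
  have qL: "q \<in> prange (Liq M)" using phi_root(1)[OF p] by (simp add: q_def)
  note pL = dom_range(2)[OF p]
  have d: "d > 0" using v\<^sub>L_less[OF p qL] by (simp add: d_def)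
  have a: "a > 0" using L.vol_strict_antimono[OF r(1) rq] by (simp add: a_def)
  have "(z p)\<^sup>2 * a < q - r"
  proof (cases "p \<le> r")
    case True
    let ?s = "1 / (i\<^sub>L r)\<^sup>2"
    have 1: "a \<le> (q - r) * ?s" using L.chord_slope(2)[OF r(1) rq] by (simp add: a_def)
    have 2: "v\<^sub>L p \<ge> v\<^sub>L r + (r - p) * ?s" using L.vol_above_tangent[OF pL r(1)] by simp
    have "(r - p) * a \<le> (r - p) * ((q - r) * ?s)" using 1 True by (intro mult_left_mono) auto
    moreover have "(q - r) * (v\<^sub>L r + (r - p) * ?s) \<le> (q - r) * v\<^sub>L p" using 2 rq by (intro mult_left_mono) auto
    moreover have "(q - r) * v\<^sub>L p < (q - r) * v\<^sub>V p"
      using rq v\<^sub>L_less[OF p pL] by (intro mult_strict_left_mono) auto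
    ultimately have "(q - p) * a < (q - r) * d"
      by (simp add: a_def d_def algebra_simps)
    hence "(z p)\<^sup>2 * a * d < (q - r) * d" unfolding root by (simp add: mult_ac)
    thus ?thesis using d by simp
  next
    case False
    have "a \<le> d" using v\<^sub>L_less[OF p r(1)] by (simp add: a_def d_def)
    hence "(z p)\<^sup>2 * a \<le> (z p)\<^sup>2 * d" by (intro mult_left_mono) auto
    thus ?thesis using root False by linarith
  qed
  hence "(z p)\<^sup>2 < (q - r) / a" using a by (simp add: pos_less_divide_eq)
  hence "\<bar>z p\<bar> < sqrt ((q - r) / a)" using real_sqrt_less_mono by fastforce
  thus ?thesis by (simp add: q_def a_def)
qed

lemma f_K_above: "q > fst w \<Longrightarrow> f_K K q w = sqrt ((fst w - q) * (vol K q - vol K (fst w)))"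
  by (simp add: f_K_def algebra_simps)

lemma pmax_in_dom: "0 < p \<Longrightarrow> p \<le> pmax M \<Longrightarrow> p \<in> dom"
  using pmax by (simp add: dom_def)

abbreviation shock_bound :: "real \<Rightarrow> real \<Rightarrow> bool" where
  "shock_bound p\<^sub>V p \<equiv> (\<exists>p'\<in>{p\<^sub>V<..<p}.
     (cs (Vap M) p')\<^sup>2 / (v\<^sub>V p')\<^sup>2 = - ((p - p\<^sub>V) / (v\<^sub>V p - v\<^sub>V p\<^sub>V)) \<and>
     z p > - (cs (Vap M) p' / v\<^sub>V p'))"

text \<open>The pressure \<open>p'\<close> exists by the mean value theorem, and its impedance is
  the absolute flux of the vapor shock. The condition thus says that the shock has a smaller signed
  flux than the phase boundary, hence a smaller speed.\<close>

lemma shock_bound_iff: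
  assumes "0 < p\<^sub>V" "p\<^sub>V < p"
  shows "shock_bound p\<^sub>V p \<longleftrightarrow> z p > - sqrt ((p\<^sub>V - p) / (v\<^sub>V p - v\<^sub>V p\<^sub>V))"
proof -
  have r: "p\<^sub>V \<in> prange (Vap M)" using assms by (simp add: prange_Vap)
  have eq: "- ((p - p\<^sub>V) / (v\<^sub>V p - v\<^sub>V p\<^sub>V)) = (p\<^sub>V - p) / (v\<^sub>V p - v\<^sub>V p\<^sub>V)"
    by (simp add: minus_divide_left)
  have s: "sqrt ((p\<^sub>V - p) / (v\<^sub>V p - v\<^sub>V p\<^sub>V)) = i\<^sub>V x"
    if "x > p\<^sub>V" "(i\<^sub>V x)\<^sup>2 = (p\<^sub>V - p) / (v\<^sub>V p - v\<^sub>V p\<^sub>V)" for x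
    using i\<^sub>V_pos[of x] that assms by (simp flip: that(2))
  have "(p - p\<^sub>V) / (v\<^sub>V p\<^sub>V - v\<^sub>V p) = (p\<^sub>V - p) / (v\<^sub>V p - v\<^sub>V p\<^sub>V)"
    by (metis minus_diff_eq minus_divide_divide)
  then obtain x where x: "x \<in> {p\<^sub>V<..<p}" "(i\<^sub>V x)\<^sup>2 = (p\<^sub>V - p) / (v\<^sub>V p - v\<^sub>V p\<^sub>V)"
    using V.chord_impedance[OF r assms(2)] by metis
  have "shock_bound p\<^sub>V p \<longleftrightarrow> (\<exists>p'\<in>{p\<^sub>V<..<p}.
      (i\<^sub>V p')\<^sup>2 = (p\<^sub>V - p) / (v\<^sub>V p - v\<^sub>V p\<^sub>V) \<and> z p > - i\<^sub>V p')"
    unfolding eq by (simp add: impedance_def power_divide)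
  also have "\<dots> \<longleftrightarrow> z p > - sqrt ((p\<^sub>V - p) / (v\<^sub>V p - v\<^sub>V p\<^sub>V))"
    using x s by (metis greaterThanLessThan_iff)
  finally show ?thesis .
qed

section \<open>Solutions and roots\<close>

text \<open>Each classical wave contributes its velocity jump through \<open>f_K\<close>, the phase
  boundary contributes \<open>- z p * (v\<^sub>L q - v\<^sub>V p)\<close>, and together they must
  join the initial velocities. The order of the speeds at a vapor shock becomes
  \<open>shock_bound\<close>.\<close>

lemma b_solution_imp_root:
  assumes sol: "b_solution M (p\<^sub>V, u\<^sub>V) (p\<^sub>L, u\<^sub>L) \<rho> u"
    and p\<^sub>V: "p\<^sub>V \<in> {0<..pmax M}" and p\<^sub>L: "p\<^sub>L \<ge> pmin M"
  shows "\<exists>p\<in>{0<..pmax M}. f_z M p (p\<^sub>V, u\<^sub>V) (p\<^sub>L, u\<^sub>L) = 0 \<and> (p > p\<^sub>V \<longrightarrow> shock_bound p\<^sub>V p)"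
proof -
  obtain w\<^sub>V w\<^sub>L W s\<^sub>1 s\<^sub>2 s\<^sub>3 s\<^sub>4 where
    rV: "\<forall>\<xi>\<le>W. fst (w\<^sub>V \<xi>) \<in> {0<..pmax M}" and rL: "\<forall>\<xi>\<ge>W. fst (w\<^sub>L \<xi>) \<in> prange (Liq M)"
    and waveV: "s\<^sub>1 = s\<^sub>2 \<and> s\<^sub>2 < W \<and> shock (Vap M) (-1) (p\<^sub>V, u\<^sub>V) (w\<^sub>V W) s\<^sub>1
        \<or> s\<^sub>2 \<le> W \<and> rarefaction (Vap M) (-1) (p\<^sub>V, u\<^sub>V) (w\<^sub>V W) s\<^sub>1 s\<^sub>2 w\<^sub>V"
    and waveL: "s\<^sub>3 = s\<^sub>4 \<and> W < s\<^sub>3 \<and> shock (Liq M) 1 (w\<^sub>L W) (p\<^sub>L, u\<^sub>L) s\<^sub>3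
        \<or> W \<le> s\<^sub>3 \<and> rarefaction (Liq M) 1 (w\<^sub>L W) (p\<^sub>L, u\<^sub>L) s\<^sub>3 s\<^sub>4 w\<^sub>L"
    and pt: "phase_transition M (w\<^sub>V W) (w\<^sub>L W) W"
    using sol unfolding b_solution_def by (elim exE conjE) (rule that)
  obtain p u\<^sub>1 where V: "w\<^sub>V W = (p, u\<^sub>1)" by (cases "w\<^sub>V W")
  obtain q u\<^sub>2 where L: "w\<^sub>L W = (q, u\<^sub>2)" by (cases "w\<^sub>L W")
  have p: "0 < p" "p \<le> pmax M" and qL: "q \<in> prange (Liq M)"
    using rV[rule_format, of W] rL[rule_format, of W] V L by auto
  note pd = pmax_in_dom[OF p]
  have pV: "p \<in> prange (Vap M)" "p\<^sub>V \<in> prange (Vap M)" and pL: "p\<^sub>L \<in> prange (Liq M)"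
    using p p\<^sub>V p\<^sub>L by (auto simp: prange_Vap prange_Liq)
  have ph: "q = \<phi> p" "u\<^sub>1 = W - z p * v\<^sub>V p" "u\<^sub>2 = W - z p * v\<^sub>L q"
    using pt phase_transition_iff[OF pd qL] unfolding V L by auto
  have e: "(-1::real) = 1 \<or> (-1::real) = -1" "(1::real) = 1 \<or> (1::real) = -1" by auto
  have vapor: "u\<^sub>1 - u\<^sub>V = - f_K (Vap M) p (p\<^sub>V, u\<^sub>V) \<and> (p > p\<^sub>V \<longrightarrow> shock_bound p\<^sub>V p)"
    using waveV unfolding V
  proof
    assume a: "s\<^sub>1 = s\<^sub>2 \<and> s\<^sub>2 < W \<and> shock (Vap M) (-1) (p\<^sub>V, u\<^sub>V) (p, u\<^sub>1) s\<^sub>1"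
    hence sh: "shock (Vap M) (-1) (p\<^sub>V, u\<^sub>V) (p, u\<^sub>1) s\<^sub>1" and s1: "s\<^sub>1 < W" by auto
    note sh = V.shockD[OF sh e(1) pV(2,1)]
    have gt: "p > p\<^sub>V" using sh(1) by simp
    define Z where "Z = - sqrt ((p\<^sub>V - p) / (v\<^sub>V p - v\<^sub>V p\<^sub>V))"
    \<comment> \<open>Shock and phase boundary share the state \<open>(p, u\<^sub>1)\<close>, so
      their speeds are ordered like their fluxes.\<close>
    have "u\<^sub>1 = s\<^sub>1 - Z * v\<^sub>V p" using sh(5) unfolding sh(2) by (simp add: Z_def)
    hence "Z * v\<^sub>V p < z p * v\<^sub>V p" using ph(2) s1 by linarith
    hence "Z < z p" using v\<^sub>V_pos[OF p(1)] by simp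
    hence "shock_bound p\<^sub>V p" using shock_bound_iff[of p\<^sub>V p] gt p\<^sub>V by (simp add: Z_def)
    thus ?thesis using sh(3) f_K_above[of "(p\<^sub>V, u\<^sub>V)" p] gt by simp
  next
    assume "s\<^sub>2 \<le> W \<and> rarefaction (Vap M) (-1) (p\<^sub>V, u\<^sub>V) (p, u\<^sub>1) s\<^sub>1 s\<^sub>2 w\<^sub>V"
    hence rf: "rarefaction (Vap M) (-1) (p\<^sub>V, u\<^sub>V) (p, u\<^sub>1) s\<^sub>1 s\<^sub>2 w\<^sub>V" and "s\<^sub>2 \<le> W" by auto
    hence "fst (w\<^sub>V \<xi>) \<in> prange (Vap M)" if "\<xi> \<in> {s\<^sub>1..s\<^sub>2}" for \<xi>
      using rV that by (auto simp: prange_Vap)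
    note rf = V.rarefactionD[OF rf e(1) this]
    have "p \<le> p\<^sub>V" using rf(1) by simp
    thus ?thesis using rf(2) V.f_K_below[OF pV(1), of "(p\<^sub>V, u\<^sub>V)"] by simp
  qed
  have liquid: "u\<^sub>2 = u\<^sub>L + f_K (Liq M) q (p\<^sub>L, u\<^sub>L)"
    using waveL unfolding L
  proof
    assume "s\<^sub>3 = s\<^sub>4 \<and> W < s\<^sub>3 \<and> shock (Liq M) 1 (q, u\<^sub>2) (p\<^sub>L, u\<^sub>L) s\<^sub>3"
    hence sh: "shock (Liq M) 1 (q, u\<^sub>2) (p\<^sub>L, u\<^sub>L) s\<^sub>3" by auto
    note sh = L.shockD[OF sh e(2) qL pL]
    have "(p\<^sub>L - q) * (v\<^sub>L q - v\<^sub>L p\<^sub>L) = (q - p\<^sub>L) * (v\<^sub>L p\<^sub>L - v\<^sub>L q)" by (simp add: algebra_simps)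
    thus ?thesis using sh(1,3) f_K_above[of "(p\<^sub>L, u\<^sub>L)" q] by simp
  next
    assume "W \<le> s\<^sub>3 \<and> rarefaction (Liq M) 1 (q, u\<^sub>2) (p\<^sub>L, u\<^sub>L) s\<^sub>3 s\<^sub>4 w\<^sub>L"
    hence rf: "rarefaction (Liq M) 1 (q, u\<^sub>2) (p\<^sub>L, u\<^sub>L) s\<^sub>3 s\<^sub>4 w\<^sub>L" and "W \<le> s\<^sub>3" by auto
    hence "fst (w\<^sub>L \<xi>) \<in> prange (Liq M)" if "\<xi> \<in> {s\<^sub>3..s\<^sub>4}" for \<xi>
      using rL that by auto
    note rf = L.rarefactionD[OF rf e(2) this]
    thus ?thesis using L.f_K_below[OF qL, of "(p\<^sub>L, u\<^sub>L)"] by simp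
  qed
  have "f_z M p (p\<^sub>V, u\<^sub>V) (p\<^sub>L, u\<^sub>L) = 0"
    unfolding f_z_def using vapor liquid ph by (simp add: algebra_simps)
  thus ?thesis using p vapor by auto
qed

lemma root_imp_b_solution:
  assumes p: "p \<in> {0<..pmax M}" and root: "f_z M p (p\<^sub>V, u\<^sub>V) (p\<^sub>L, u\<^sub>L) = 0"
    and bound: "p > p\<^sub>V \<Longrightarrow> shock_bound p\<^sub>V p"
    and p\<^sub>V: "p\<^sub>V \<in> {0<..pmax M}" and p\<^sub>L: "p\<^sub>L \<ge> pmin M"
  shows "\<exists>\<rho> u. b_solution M (p\<^sub>V, u\<^sub>V) (p\<^sub>L, u\<^sub>L) \<rho> u"
proof -
  define q Z where "q = \<phi> p" and "Z = z p"
  define u\<^sub>1 u\<^sub>2 where "u\<^sub>1 = u\<^sub>V - f_K (Vap M) p (p\<^sub>V, u\<^sub>V)" and "u\<^sub>2 = u\<^sub>L + f_K (Liq M) q (p\<^sub>L, u\<^sub>L)"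
  \<comment> \<open>The speed at which the vapor state has flux \<open>Z\<close>; the root equation
    says that the liquid side yields the same speed.\<close>
  define W where "W = u\<^sub>1 + Z * v\<^sub>V p"
  have pd: "p \<in> dom" using p pmax_in_dom by simp
  have p0: "p > 0" using p by simp
  have qL: "q \<in> prange (Liq M)" using phi_root(1)[OF pd] by (simp add: q_def)
  have pV: "p \<in> prange (Vap M)" "p\<^sub>V \<in> prange (Vap M)" and pL: "p\<^sub>L \<in> prange (Liq M)"
    using p p\<^sub>V p\<^sub>L by (auto simp: prange_Vap prange_Liq)
  have e: "(-1::real) = 1 \<or> (-1::real) = -1" "(1::real) = 1 \<or> (1::real) = -1" by auto
  have W2: "W = u\<^sub>2 + Z * v\<^sub>L q"
    using root by (simp add: f_z_def W_def u\<^sub>1_def u\<^sub>2_def q_def Z_def algebra_simps)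
  have pt: "phase_transition M (p, u\<^sub>1) (q, u\<^sub>2) W"
    unfolding phase_transition_iff[OF pd qL] by (simp add: q_def W2[unfolded q_def] Z_def[symmetric])
      (simp add: W_def flip: W2[unfolded q_def])
  have "\<exists>w s\<^sub>1 s\<^sub>2. (\<forall>\<xi>\<le>W. fst (w \<xi>) \<in> {0<..pmax M}) \<and> w W = (p, u\<^sub>1)
      \<and> (\<forall>\<xi><s\<^sub>1. w \<xi> = (p\<^sub>V, u\<^sub>V)) \<and> (\<forall>\<xi>\<in>{s\<^sub>2<..W}. w \<xi> = (p, u\<^sub>1))
      \<and> (s\<^sub>1 = s\<^sub>2 \<and> s\<^sub>2 < W \<and> shock (Vap M) (-1) (p\<^sub>V, u\<^sub>V) (p, u\<^sub>1) s\<^sub>1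
        \<or> s\<^sub>2 \<le> W \<and> rarefaction (Vap M) (-1) (p\<^sub>V, u\<^sub>V) (p, u\<^sub>1) s\<^sub>1 s\<^sub>2 w)"
  proof (cases "p > p\<^sub>V")
    case True
    define Y where "Y = (-1) * sqrt ((p\<^sub>V - p) / (v\<^sub>V p - v\<^sub>V p\<^sub>V))"
    define s where "s = u\<^sub>V + Y * v\<^sub>V p\<^sub>V"
    have u: "u\<^sub>1 - u\<^sub>V = - sqrt ((p\<^sub>V - p) * (v\<^sub>V p - v\<^sub>V p\<^sub>V))"
      using f_K_above[of "(p\<^sub>V, u\<^sub>V)" p] True by (simp add: u\<^sub>1_def)
    have c: "- 1 * (p\<^sub>V - p) > 0" using True by simp
    note sh = V.shockI[OF e(1) pV(2,1) c u, folded Y_def, folded s_def]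
    have "Y < Z" using bound[OF True] shock_bound_iff[of p\<^sub>V p] True p\<^sub>V by (simp add: Y_def Z_def)
    hence "Y * v\<^sub>V p < Z * v\<^sub>V p" using v\<^sub>V_pos[OF p0] by simp
    hence sW: "s < W" using sh(2) by (simp add: W_def)
    show ?thesis
      by (rule exI[of _ "\<lambda>\<xi>. if \<xi> < s then (p\<^sub>V, u\<^sub>V) else (p, u\<^sub>1)"], rule exI[of _ s], rule exI[of _ s])
        (use sh(1) sW p p\<^sub>V in auto)
  next
    case False
    have c: "- 1 * (p - p\<^sub>V) \<ge> 0" using False by simp
    have u: "u\<^sub>1 - u\<^sub>V = - 1 * (rinv (Vap M) p - rinv (Vap M) p\<^sub>V)"
      using V.f_K_below[OF pV(1), of "(p\<^sub>V, u\<^sub>V)"] False by (simp add: u\<^sub>1_def)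
    let ?a = "u\<^sub>V + (- 1) * cs (Vap M) p\<^sub>V" and ?b = "u\<^sub>1 + (- 1) * cs (Vap M) p"
    obtain w where rf: "rarefaction (Vap M) (-1) (p\<^sub>V, u\<^sub>V) (p, u\<^sub>1) ?a ?b w"
      and w: "\<And>\<xi>. \<xi> < ?a \<Longrightarrow> w \<xi> = (p\<^sub>V, u\<^sub>V)" "\<And>\<xi>. \<xi> > ?b \<Longrightarrow> w \<xi> = (p, u\<^sub>1)"
        "\<And>\<xi>. fst (w \<xi>) \<in> {min p\<^sub>V p..max p\<^sub>V p}"
      using V.rarefaction_profile[OF e(1) pV(2,1) c u] by blast
    \<comment> \<open>The right edge of the fan moves with speed
      \<open>u\<^sub>1 - i\<^sub>V p * v\<^sub>V p\<close>, so the lower sonic bound on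
      \<open>z\<close> keeps it from overtaking the boundary.\<close>
    have "- i\<^sub>V p * v\<^sub>V p \<le> Z * v\<^sub>V p"
      using phi_root(3)[OF pd] v\<^sub>V_pos[OF p0] unfolding Z_def by (intro mult_right_mono) auto
    hence bW: "?b \<le> W" using v\<^sub>V_pos[OF p0] by (simp add: W_def impedance_def)
    \<comment> \<open>If the fan touches the boundary, the value at \<open>W\<close> is the end
      value of the rarefaction; otherwise it comes from the constant continuation.\<close>
    have wW: "w W = (p, u\<^sub>1)"
      using w(2)[of W] rf bW by (cases "?b = W") (auto simp: rarefaction_def)
    have "fst (w \<xi>) \<in> {0<..pmax M}" for \<xi>
      using w(3)[of \<xi>] p p\<^sub>V False by (auto simp: min_def max_def split: if_splits)
    thus ?thesis using w rf bW wW by (intro exI[of _ w] exI[of _ ?a] exI[of _ ?b]) auto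
  qed
  then obtain w\<^sub>V s\<^sub>1 s\<^sub>2 where V: "\<forall>\<xi>\<le>W. fst (w\<^sub>V \<xi>) \<in> {0<..pmax M}" "w\<^sub>V W = (p, u\<^sub>1)"
    "\<forall>\<xi><s\<^sub>1. w\<^sub>V \<xi> = (p\<^sub>V, u\<^sub>V)" "\<forall>\<xi>\<in>{s\<^sub>2<..W}. w\<^sub>V \<xi> = (p, u\<^sub>1)"
    "s\<^sub>1 = s\<^sub>2 \<and> s\<^sub>2 < W \<and> shock (Vap M) (-1) (p\<^sub>V, u\<^sub>V) (p, u\<^sub>1) s\<^sub>1
        \<or> s\<^sub>2 \<le> W \<and> rarefaction (Vap M) (-1) (p\<^sub>V, u\<^sub>V) (p, u\<^sub>1) s\<^sub>1 s\<^sub>2 w\<^sub>V"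
    by blast
  have "\<exists>w s\<^sub>3 s\<^sub>4. (\<forall>\<xi>\<ge>W. fst (w \<xi>) \<in> prange (Liq M)) \<and> w W = (q, u\<^sub>2)
      \<and> (\<forall>\<xi>\<in>{W..<s\<^sub>3}. w \<xi> = (q, u\<^sub>2)) \<and> (\<forall>\<xi>>s\<^sub>4. w \<xi> = (p\<^sub>L, u\<^sub>L))
      \<and> (s\<^sub>3 = s\<^sub>4 \<and> W < s\<^sub>3 \<and> shock (Liq M) 1 (q, u\<^sub>2) (p\<^sub>L, u\<^sub>L) s\<^sub>3
        \<or> W \<le> s\<^sub>3 \<and> rarefaction (Liq M) 1 (q, u\<^sub>2) (p\<^sub>L, u\<^sub>L) s\<^sub>3 s\<^sub>4 w)"
  proof (cases "q > p\<^sub>L")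
    case True
    define Y where "Y = 1 * sqrt ((q - p\<^sub>L) / (v\<^sub>L p\<^sub>L - v\<^sub>L q))"
    define s where "s = u\<^sub>2 + Y * v\<^sub>L q"
    have "(p\<^sub>L - q) * (v\<^sub>L q - v\<^sub>L p\<^sub>L) = (q - p\<^sub>L) * (v\<^sub>L p\<^sub>L - v\<^sub>L q)" by (simp add: algebra_simps)
    hence u: "u\<^sub>L - u\<^sub>2 = - sqrt ((q - p\<^sub>L) * (v\<^sub>L p\<^sub>L - v\<^sub>L q))"
      using f_K_above[of "(p\<^sub>L, u\<^sub>L)" q] True by (simp add: u\<^sub>2_def)
    have c: "1 * (q - p\<^sub>L) > 0" using True by simp
    note sh = L.shockI[OF e(2) qL pL c u, folded Y_def, folded s_def]
    have "Z < Y" using liquid_shock_faster[OF pd pL] True by (simp add: Y_def Z_def q_def)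
    hence "Z * v\<^sub>L q < Y * v\<^sub>L q" using v\<^sub>L_pos[OF qL] by simp
    hence sW: "W < s" by (simp add: W2 s_def)
    show ?thesis
      by (rule exI[of _ "\<lambda>\<xi>. if \<xi> > s then (p\<^sub>L, u\<^sub>L) else (q, u\<^sub>2)"], rule exI[of _ s], rule exI[of _ s])
        (use sh(1) sW qL pL in auto)
  next
    case False
    have c: "1 * (p\<^sub>L - q) \<ge> 0" using False by simp
    have u: "u\<^sub>L - u\<^sub>2 = 1 * (rinv (Liq M) p\<^sub>L - rinv (Liq M) q)"
      using L.f_K_below[OF qL, of "(p\<^sub>L, u\<^sub>L)"] False by (simp add: u\<^sub>2_def)
    let ?a = "u\<^sub>2 + 1 * cs (Liq M) q" and ?b = "u\<^sub>L + 1 * cs (Liq M) p\<^sub>L"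
    obtain w where rf: "rarefaction (Liq M) 1 (q, u\<^sub>2) (p\<^sub>L, u\<^sub>L) ?a ?b w"
      and w: "\<And>\<xi>. \<xi> < ?a \<Longrightarrow> w \<xi> = (q, u\<^sub>2)" "\<And>\<xi>. \<xi> > ?b \<Longrightarrow> w \<xi> = (p\<^sub>L, u\<^sub>L)"
        "\<And>\<xi>. fst (w \<xi>) \<in> {min q p\<^sub>L..max q p\<^sub>L}"
      using L.rarefaction_profile[OF e(2) qL pL c u] by blast
    have "Z * v\<^sub>L q \<le> i\<^sub>L q * v\<^sub>L q"
      using phi_root(6)[OF pd] v\<^sub>L_pos[OF qL] unfolding Z_def q_def by (intro mult_right_mono) auto
    hence aW: "W \<le> ?a" using v\<^sub>L_pos[OF qL] by (simp add: W2 impedance_def)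
    have wW: "w W = (q, u\<^sub>2)"
      using w(1)[of W] rf aW by (cases "?a = W") (auto simp: rarefaction_def)
    have "fst (w \<xi>) \<in> prange (Liq M)" for \<xi>
      using w(3)[of \<xi>] qL False by (auto simp: in_Liq min_def max_def split: if_splits)
    thus ?thesis using w rf aW wW by (intro exI[of _ w] exI[of _ ?a] exI[of _ ?b]) auto
  qed
  then obtain w\<^sub>L s\<^sub>3 s\<^sub>4 where L: "\<forall>\<xi>\<ge>W. fst (w\<^sub>L \<xi>) \<in> prange (Liq M)" "w\<^sub>L W = (q, u\<^sub>2)"
    "\<forall>\<xi>\<in>{W..<s\<^sub>3}. w\<^sub>L \<xi> = (q, u\<^sub>2)" "\<forall>\<xi>>s\<^sub>4. w\<^sub>L \<xi> = (p\<^sub>L, u\<^sub>L)"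
    "s\<^sub>3 = s\<^sub>4 \<and> W < s\<^sub>3 \<and> shock (Liq M) 1 (q, u\<^sub>2) (p\<^sub>L, u\<^sub>L) s\<^sub>3
        \<or> W \<le> s\<^sub>3 \<and> rarefaction (Liq M) 1 (q, u\<^sub>2) (p\<^sub>L, u\<^sub>L) s\<^sub>3 s\<^sub>4 w\<^sub>L"
    by blast
  \<comment> \<open>\<open>b_solution\<close> leaves the values on the line \<open>x = W * t\<close>
    and at the origin free; the liquid ones are taken.\<close>
  define \<rho> where "\<rho> = (\<lambda>t x. if t = 0 then (if x < 0 then density (Vap M) p\<^sub>V else density (Liq M) p\<^sub>L)
    else if x < W * t then density (Vap M) (fst (w\<^sub>V (x / t))) else density (Liq M) (fst (w\<^sub>L (x / t))))"
  define u where "u = (\<lambda>t x. if t = 0 then (if x < 0 then u\<^sub>V else u\<^sub>L)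
    else if x < W * t then snd (w\<^sub>V (x / t)) else snd (w\<^sub>L (x / t)))"
  have "b_solution M (p\<^sub>V, u\<^sub>V) (p\<^sub>L, u\<^sub>L) \<rho> u"
    unfolding b_solution_def
    by (rule exI[of _ w\<^sub>V], rule exI[of _ w\<^sub>L], rule exI[of _ W], rule exI[of _ s\<^sub>1],
        rule exI[of _ s\<^sub>2], rule exI[of _ s\<^sub>3], rule exI[of _ s\<^sub>4], unfold V(2) L(2), intro conjI)
      (use V L pt in \<open>simp_all add: \<rho>_def u_def\<close>)
  thus ?thesis by blast
qed

lemma root_exists:
  assumes "f_z M (pmax M) (p\<^sub>V, u\<^sub>V) (p\<^sub>L, u\<^sub>L) \<ge> 0"
    and p\<^sub>V: "p\<^sub>V \<in> {0<..pmax M}" and p\<^sub>L: "p\<^sub>L \<ge> pmin M"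
  obtains p where "p \<in> {0<..pmax M}" "f_z M p (p\<^sub>V, u\<^sub>V) (p\<^sub>L, u\<^sub>L) = 0"
proof -
  have w: "p\<^sub>V \<in> dom" "p\<^sub>V \<in> prange (Vap M)" "p\<^sub>L \<in> prange (Liq M)"
    using p\<^sub>V p\<^sub>L pmax_in_dom by (auto simp: prange_Vap prange_Liq)
  obtain p where p: "p \<in> dom" "p < pmax M" "f_z M p (p\<^sub>V, u\<^sub>V) (p\<^sub>L, u\<^sub>L) < 0"
    using f_z_negative_near_0[of "(p\<^sub>V, u\<^sub>V)" "(p\<^sub>L, u\<^sub>L)" "pmax M"] w pmax by auto
  have "{p..pmax M} \<subseteq> dom" using dom_pos[OF p(1)] pmax_in_dom by auto
  hence "continuous_on {p..pmax M} (\<lambda>p. f_z M p (p\<^sub>V, u\<^sub>V) (p\<^sub>L, u\<^sub>L))"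
    using w by (intro continuous_on_subset[OF continuous_f_z]) auto
  then obtain x where "p \<le> x" "x \<le> pmax M" "f_z M x (p\<^sub>V, u\<^sub>V) (p\<^sub>L, u\<^sub>L) = 0"
    using IVT'[of "\<lambda>p. f_z M p (p\<^sub>V, u\<^sub>V) (p\<^sub>L, u\<^sub>L)" p 0 "pmax M"] p assms(1) by auto
  thus thesis using dom_pos[OF p(1)] by (intro that[of x]) auto
qed

end

theorem theorem4p12:
  fixes M :: two_phase and p\<^sub>V u\<^sub>V p\<^sub>L u\<^sub>L :: real
  assumes "two_phase_setting M"
    and "p\<^sub>V \<in> {0<..pmax M}" and "p\<^sub>L \<ge> pmin M"
  defines "W\<^sub>V \<equiv> (p\<^sub>V, u\<^sub>V)" and "W\<^sub>L \<equiv> (p\<^sub>L, u\<^sub>L)"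
  shows "(\<exists>\<rho> u. b_solution M W\<^sub>V W\<^sub>L \<rho> u) \<longleftrightarrow>
    f_z M (pmax M) W\<^sub>V W\<^sub>L \<ge> 0 \<and>
    (\<forall>p\<in>{0<..pmax M}. f_z M p W\<^sub>V W\<^sub>L = 0 \<and> p > p\<^sub>V \<longrightarrow>
      (\<exists>p'\<in>{p\<^sub>V<..<p}.
         (cs (Vap M) p')\<^sup>2 / (vol (Vap M) p')\<^sup>2
           = - ((p - p\<^sub>V) / (vol (Vap M) p - vol (Vap M) p\<^sub>V)) \<and>
         zflux M p > - (cs (Vap M) p' / vol (Vap M) p')))"
proof -
  interpret two_phase_setting M by (fact assms(1))
  have w: "fst W\<^sub>V \<in> prange (Vap M)" "fst W\<^sub>L \<in> prange (Liq M)"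
    using assms by (auto simp: prange_Vap prange_Liq)
  have mono: "f_z M p W\<^sub>V W\<^sub>L < f_z M p' W\<^sub>V W\<^sub>L" if "0 < p" "p < p'" "p' \<le> pmax M" for p p'
    using f_z_strict_mono[OF pmax_in_dom pmax_in_dom _ w] that by simp
  show ?thesis
  proof
    assume "\<exists>\<rho> u. b_solution M W\<^sub>V W\<^sub>L \<rho> u"
    then obtain p where p: "p \<in> {0<..pmax M}" "f_z M p W\<^sub>V W\<^sub>L = 0" "p > p\<^sub>V \<longrightarrow> shock_bound p\<^sub>V p"
      using b_solution_imp_root assms(2,3) unfolding W\<^sub>V_def W\<^sub>L_def by blast
    have "f_z M (pmax M) W\<^sub>V W\<^sub>L \<ge> 0"
      using mono[of p "pmax M"] p by (cases "p = pmax M") auto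
    \<comment> \<open>Strict monotonicity makes the quantified condition a statement about the one
      root that the solution supplies.\<close>
    moreover have "x = p" if "x \<in> {0<..pmax M}" "f_z M x W\<^sub>V W\<^sub>L = 0" for x
      using mono[of x p] mono[of p x] that p by (cases x p rule: linorder_cases) auto
    ultimately show "f_z M (pmax M) W\<^sub>V W\<^sub>L \<ge> 0 \<and>
      (\<forall>p\<in>{0<..pmax M}. f_z M p W\<^sub>V W\<^sub>L = 0 \<and> p > p\<^sub>V \<longrightarrow> shock_bound p\<^sub>V p)"
      using p by blast
  next
    assume a: "f_z M (pmax M) W\<^sub>V W\<^sub>L \<ge> 0 \<and>
      (\<forall>p\<in>{0<..pmax M}. f_z M p W\<^sub>V W\<^sub>L = 0 \<and> p > p\<^sub>V \<longrightarrow> shock_bound p\<^sub>V p)"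
    obtain p where "p \<in> {0<..pmax M}" "f_z M p W\<^sub>V W\<^sub>L = 0"
      using root_exists a assms(2,3) unfolding W\<^sub>V_def W\<^sub>L_def by blast
    thus "\<exists>\<rho> u. b_solution M W\<^sub>V W\<^sub>L \<rho> u"
      using root_imp_b_solution a assms(2,3) unfolding W\<^sub>V_def W\<^sub>L_def by blast
  qed
qed

end
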